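(* Let $(A,[\![\cdot,\cdot]\!],\rho)$ be a Lie algebroid over $M$ and $\Phi:G\times A\to A$ a free and proper action of a connected Lie group $G$ by complete lifts with respect to the Lie algebra anti-morphism $\psi:\mathfrak g\to\Gamma(A)$. Let $J_{A^*}:A^*\to\mathfrak g^*$ be given by $$J_{A^*}(\alpha_x)(\xi)=\alpha_x(\psi(\xi)(x)),\qquad x\in M,\ \alpha_x\in A_x^*,\ \xi\in\mathfrak g.$$ Then $J_{A^*}$ is an equivariant momentum map for the Poisson action $\Phi^*:G\times A^*\to A^*$.
   Context: Let $\tau:A\to M$, $\tau_*:A^*\to M$ be the projections, $d^A$ the differential of $A$, $\mathcal L^A_X=i_Xd^A+d^Ai_X$. The complete lift of $X\in\Gamma(A)$ is the unique vector field $X^c$ on $A$, $\tau$-projectable onto $\rho(X)$, with $X^c(\widehat\alpha)=\widehat{\mathcal L^A_X\alpha}$ for $\alpha\in\Gamma(A^* )$, where a hat denotes the fiberwise linear function defined by a section of the dual bundle. A left action $\Phi:G\times A\to A$ by vector bundle automorphisms covering $\phi:G\times M\to M$ is by complete lifts with respect to a Lie algebra anti-morphism $\psi:\mathfrak g\to\Gamma(A)$ if the infinitesimal generator of each $\xi\in\mathfrak g$ is $(\psi(\xi))^c$. The dual left action is $\Phi^*_g|_{A_x^*}=((\Phi_{g^{-1}})|_{A_{\phi_g(x)}})^*:A^*_x\to A^*_{\phi_g(x)}$, with infinitesimal generators $\xi_{A^*}$. The linear Poisson structure $\Pi_{A^*}$ on $A^*$ is characterized by $\{\widehat X,\widehat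 Y\}=-\widehat{[\![X,Y]\!]}$, $\{\widehat X,f\circ\tau_*\}=-\rho(X)(f)\circ\tau_*$, $\{f\circ\tau_*,h\circ\tau_*\}=0$, for $X,Y\in\Gamma(A)$, $f,h\in C^\infty(M)$. The action $\Phi^*$ is by Poisson automorphisms. The Hamiltonian vector field $H_F$ of $F\in C^\infty(A^* )$ is $H_F(K)=\{K,F\}$. A map $J:A^*\to\mathfrak g^*$ is a momentum map for $\Phi^*$ if $H_{J_\xi}=\xi_{A^*}$ for all $\xi\in\mathfrak g$, where $J_\xi(\alpha)=J(\alpha)(\xi)$; it is equivariant if $J\circ\Phi_g^*=Coad^G_g\circ J$ for all $g\in G$, where $(Coad^G_g\mu)(\xi)=\mu(Ad^G_{g^{-1}}\xi)$ is the left coadjoint action. *)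

theory Defs
  imports "HOL-Analysis.Analysis" "HOL-Algebra.Group"
begin

section \<open>Smooth manifolds\<close>

text \<open>
  The model spaces are finite-dimensional real inner product spaces, i.e. Euclidean spaces of an
  arbitrary dimension. The library class \<open>euclidean_space\<close> is not used because its instances have
  positive dimension, while a base manifold that is a point (Lie algebras) and bundles of rank zero
  have to be admitted.
\<close>

definition finite_dim :: "'e::real_vector itself \<Rightarrow> bool" where
  "finite_dim _ \<longleftrightarrow> (\<exists>B::'e set. finite B \<and> span B = UNIV)"

text \<open>Both notions are meant for open sets \<open>U\<close>.\<close>

primrec Ck_on :: "nat \<Rightarrow> 'e::real_normed_vector set \<Rightarrow> ('e \<Rightarrow> 'f::real_normed_vector) \<Rightarrow> bool" where
  "Ck_on 0 U f \<longleftrightarrow> continuous_on U f"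
| "Ck_on (Suc k) U f \<longleftrightarrow>
     (\<forall>x\<in>U. f differentiable (at x)) \<and> (\<forall>v. Ck_on k U (\<lambda>x. frechet_derivative f (at x) v))"

definition smooth_on :: "'e::real_normed_vector set \<Rightarrow> ('e \<Rightarrow> 'f::real_normed_vector) \<Rightarrow> bool" where
  "smooth_on U f \<longleftrightarrow> (\<forall>k. Ck_on k U f)"

text \<open>
  A manifold is given by an atlas; its points are those covered by the charts. The values of
  charts, functions and maps outside their domains are irrelevant.
\<close>

type_synonym ('p, 'e) atlas = "('p set \<times> ('p \<Rightarrow> 'e)) set"

definition pts :: "('p, 'e) atlas \<Rightarrow> 'p set" where
  "pts \<A> = (\<Union>(U, \<kappa>)\<in>\<A>. U)"

definition is_atlas :: "('p, 'e::real_normed_vector) atlas \<Rightarrow> bool" where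
  "is_atlas \<A> \<longleftrightarrow>
     (\<forall>(U, \<kappa>)\<in>\<A>. inj_on \<kappa> U) \<and>
     (\<forall>(U, \<kappa>)\<in>\<A>. \<forall>(V, \<mu>)\<in>\<A>.
        open (\<kappa> ` (U \<inter> V)) \<and> smooth_on (\<kappa> ` (U \<inter> V)) (\<mu> \<circ> inv_into U \<kappa>))"

definition mtop :: "('p, 'e::real_normed_vector) atlas \<Rightarrow> 'p topology" where
  "mtop \<A> = topology (\<lambda>W. W \<subseteq> pts \<A> \<and> (\<forall>(U, \<kappa>)\<in>\<A>. open (\<kappa> ` (U \<inter> W))))"

definition smooth_manifold :: "('p, 'e::real_inner) atlas \<Rightarrow> bool" where
  "smooth_manifold \<A> \<longleftrightarrow> finite_dim TYPE('e) \<and> is_atlas \<A> \<and>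
     Hausdorff_space (mtop \<A>) \<and> second_countable (mtop \<A>)"

definition smooth_map ::
  "('p, 'e::real_inner) atlas \<Rightarrow> ('q, 'f::real_inner) atlas \<Rightarrow> ('p \<Rightarrow> 'q) \<Rightarrow> bool" where
  "smooth_map \<A> \<B> h \<longleftrightarrow> continuous_map (mtop \<A>) (mtop \<B>) h \<and>
     (\<forall>(U, \<kappa>)\<in>\<A>. \<forall>(V, \<mu>)\<in>\<B>.
        smooth_on (\<kappa> ` {p \<in> U. h p \<in> V}) (\<mu> \<circ> h \<circ> inv_into U \<kappa>))"

definition prod_atlas :: "('p, 'e) atlas \<Rightarrow> ('q, 'f) atlas \<Rightarrow> ('p \<times> 'q, 'e \<times> 'f) atlas" where
  "prod_atlas \<A> \<B> = {(U \<times> V, \<lambda>(p, q). (\<kappa> p, \<mu> q)) | U \<kappa> V \<mu>. (U, \<kappa>) \<in> \<A> \<and> (V, \<mu>) \<in> \<B>}"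

definition Cinf :: "('p, 'e::real_inner) atlas \<Rightarrow> ('p \<Rightarrow> real) set" where
  "Cinf \<A> = {f. \<forall>(U, \<kappa>)\<in>\<A>. smooth_on (\<kappa> ` U) (f \<circ> inv_into U \<kappa>)}"

text \<open>
  Tangent vectors are derivations of the algebra of smooth functions; they are normalised to \<open>0\<close>
  off that algebra so that equality of tangent vectors is equality in HOL. By the Leibniz rule they
  do not see the values of a function outside the manifold.
\<close>

definition tangent :: "('p, 'e::real_inner) atlas \<Rightarrow> 'p \<Rightarrow> (('p \<Rightarrow> real) \<Rightarrow> real) set" where
  "tangent \<A> p = {v.
     (\<forall>f\<in>Cinf \<A>. \<forall>h\<in>Cinf \<A>. v (\<lambda>q. f q + h q) = v f + v h) \<and>
     (\<forall>c. \<forall>f\<in>Cinf \<A>. v (\<lambda>q. c * f q) = c * v f) \<and>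
     (\<forall>f\<in>Cinf \<A>. \<forall>h\<in>Cinf \<A>. v (\<lambda>q. f q * h q) = f p * v h + h p * v f) \<and>
     (\<forall>f. f \<notin> Cinf \<A> \<longrightarrow> v f = 0)}"

text \<open>The tangent map of \<open>h\<close>, with values in the tangent spaces of \<open>\<B>\<close>.\<close>

definition push :: "('q, 'f::real_inner) atlas \<Rightarrow> ('p \<Rightarrow> 'q) \<Rightarrow>
    (('p \<Rightarrow> real) \<Rightarrow> real) \<Rightarrow> ('q \<Rightarrow> real) \<Rightarrow> real" where
  "push \<B> h v = (\<lambda>f. if f \<in> Cinf \<B> then v (f \<circ> h) else 0)"

definition vector_field ::
  "('p, 'e::real_inner) atlas \<Rightarrow> ('p \<Rightarrow> ('p \<Rightarrow> real) \<Rightarrow> real) \<Rightarrow> bool" where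
  "vector_field \<A> V \<longleftrightarrow> (\<forall>p\<in>pts \<A>. V p \<in> tangent \<A> p) \<and>
     (\<forall>f\<in>Cinf \<A>. (\<lambda>p. V p f) \<in> Cinf \<A>)"


section \<open>Lie groups and their actions\<close>

definition lie_group :: "('g, 'b) monoid_scheme \<Rightarrow> ('g, 'k::real_inner) atlas \<Rightarrow> bool" where
  "lie_group G \<G> \<longleftrightarrow> group G \<and> smooth_manifold \<G> \<and> pts \<G> = carrier G \<and>
     smooth_map (prod_atlas \<G> \<G>) \<G> (\<lambda>(g, h). g \<otimes>\<^bsub>G\<^esub> h) \<and>
     smooth_map \<G> \<G> (\<lambda>g. inv\<^bsub>G\<^esub> g)"

type_synonym 'g lie_vec = "('g \<Rightarrow> real) \<Rightarrow> real"

definition lie_alg :: "('g, 'b) monoid_scheme \<Rightarrow> ('g, 'k::real_inner) atlas \<Rightarrow> 'g lie_vec set" where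
  "lie_alg G \<G> = tangent \<G> \<one>\<^bsub>G\<^esub>"

definition left_inv_field :: "('g, 'b) monoid_scheme \<Rightarrow> ('g, 'k::real_inner) atlas \<Rightarrow>
    'g lie_vec \<Rightarrow> 'g \<Rightarrow> 'g lie_vec" where
  "left_inv_field G \<G> \<xi> g = push \<G> (\<lambda>h. g \<otimes>\<^bsub>G\<^esub> h) \<xi>"

text \<open>The value at the unit of the commutator of the left-invariant vector fields.\<close>

definition lie_bracket :: "('g, 'b) monoid_scheme \<Rightarrow> ('g, 'k::real_inner) atlas \<Rightarrow>
    'g lie_vec \<Rightarrow> 'g lie_vec \<Rightarrow> 'g lie_vec" where
  "lie_bracket G \<G> \<xi> \<eta> = (\<lambda>f. if f \<in> Cinf \<G>
     then \<xi> (\<lambda>g. left_inv_field G \<G> \<eta> g f) - \<eta> (\<lambda>g. left_inv_field G \<G> \<xi> g f) else 0)"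

definition Ad :: "('g, 'b) monoid_scheme \<Rightarrow> ('g, 'k::real_inner) atlas \<Rightarrow>
    'g \<Rightarrow> 'g lie_vec \<Rightarrow> 'g lie_vec" where
  "Ad G \<G> g \<xi> = push \<G> (\<lambda>h. g \<otimes>\<^bsub>G\<^esub> h \<otimes>\<^bsub>G\<^esub> inv\<^bsub>G\<^esub> g) \<xi>"

definition lie_dual ::
  "('g, 'b) monoid_scheme \<Rightarrow> ('g, 'k::real_inner) atlas \<Rightarrow> ('g lie_vec \<Rightarrow> real) set" where
  "lie_dual G \<G> = {\<mu> \<in> extensional (lie_alg G \<G>).
     (\<forall>\<xi>\<in>lie_alg G \<G>. \<forall>\<eta>\<in>lie_alg G \<G>. \<mu> (\<lambda>f. \<xi> f + \<eta> f) = \<mu> \<xi> + \<mu> \<eta>) \<and>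
     (\<forall>c. \<forall>\<xi>\<in>lie_alg G \<G>. \<mu> (\<lambda>f. c * \<xi> f) = c * \<mu> \<xi>)}"

definition Coad :: "('g, 'b) monoid_scheme \<Rightarrow> ('g, 'k::real_inner) atlas \<Rightarrow>
    'g \<Rightarrow> ('g lie_vec \<Rightarrow> real) \<Rightarrow> 'g lie_vec \<Rightarrow> real" where
  "Coad G \<G> g \<mu> = (\<lambda>\<xi>\<in>lie_alg G \<G>. \<mu> (Ad G \<G> (inv\<^bsub>G\<^esub> g) \<xi>))"

definition smooth_action :: "('g, 'b) monoid_scheme \<Rightarrow> ('g, 'k::real_inner) atlas \<Rightarrow>
    ('p, 'e::real_inner) atlas \<Rightarrow> ('g \<Rightarrow> 'p \<Rightarrow> 'p) \<Rightarrow> bool" where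
  "smooth_action G \<G> \<A> \<Phi> \<longleftrightarrow>
     smooth_map (prod_atlas \<G> \<A>) \<A> (\<lambda>(g, p). \<Phi> g p) \<and>
     (\<forall>p\<in>pts \<A>. \<Phi> \<one>\<^bsub>G\<^esub> p = p) \<and>
     (\<forall>g\<in>carrier G. \<forall>h\<in>carrier G. \<forall>p\<in>pts \<A>. \<Phi> (g \<otimes>\<^bsub>G\<^esub> h) p = \<Phi> g (\<Phi> h p))"

definition free_action :: "('g, 'b) monoid_scheme \<Rightarrow> ('p, 'e) atlas \<Rightarrow> ('g \<Rightarrow> 'p \<Rightarrow> 'p) \<Rightarrow> bool" where
  "free_action G \<A> \<Phi> \<longleftrightarrow> (\<forall>g\<in>carrier G. \<forall>p\<in>pts \<A>. \<Phi> g p = p \<longrightarrow> g = \<one>\<^bsub>G\<^esub>)"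

definition proper_action :: "('g, 'k::real_inner) atlas \<Rightarrow> ('p, 'e::real_inner) atlas \<Rightarrow>
    ('g \<Rightarrow> 'p \<Rightarrow> 'p) \<Rightarrow> bool" where
  "proper_action \<G> \<A> \<Phi> \<longleftrightarrow>
     proper_map (prod_topology (mtop \<G>) (mtop \<A>)) (prod_topology (mtop \<A>) (mtop \<A>))
       (\<lambda>(g, p). (p, \<Phi> g p))"

text \<open>
  The velocity at the unit of the orbit map of \<open>p\<close> in the direction \<open>\<xi>\<close>, i.e. the derivative at
  \<open>t = 0\<close> of the curve \<open>exp (t \<xi>) p\<close>.
\<close>

definition inf_gen :: "('p, 'e::real_inner) atlas \<Rightarrow> ('g \<Rightarrow> 'p \<Rightarrow> 'p) \<Rightarrow>
    'g lie_vec \<Rightarrow> 'p \<Rightarrow> ('p \<Rightarrow> real) \<Rightarrow> real" where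
  "inf_gen \<A> \<Phi> \<xi> p = push \<A> (\<lambda>g. \<Phi> g p) \<xi>"


section \<open>Vector bundles\<close>

text \<open>
  An element \<open>(U, \<theta>)\<close> of \<open>trivs\<close> stands for the local trivialisation \<open>a \<mapsto> (proj a, \<theta> a)\<close> over \<open>U\<close>.
\<close>

record ('m, 'e, 'a, 'f) vbundle =
  base :: "('m, 'e) atlas"
  total :: "'a set"
  proj :: "'a \<Rightarrow> 'm"
  fadd :: "'a \<Rightarrow> 'a \<Rightarrow> 'a"
  fscale :: "real \<Rightarrow> 'a \<Rightarrow> 'a"
  trivs :: "('m set \<times> ('a \<Rightarrow> 'f)) set"

definition fib :: "('m, 'e, 'a, 'f) vbundle \<Rightarrow> 'm \<Rightarrow> 'a set" where
  "fib E x = {a \<in> total E. proj E a = x}"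

definition total_atlas :: "('m, 'e, 'a, 'f) vbundle \<Rightarrow> ('a, 'e \<times> 'f) atlas" where
  "total_atlas E = {({a \<in> total E. proj E a \<in> U \<inter> W}, \<lambda>a. (\<kappa> (proj E a), \<theta> a)) | U \<kappa> W \<theta>.
     (U, \<kappa>) \<in> base E \<and> (W, \<theta>) \<in> trivs E}"

text \<open>
  That the fibres are vector spaces is implied, as \<open>\<theta>\<close> transports their operations to those of
  \<open>'f\<close>. Smoothness of the transition functions between trivialisations is the compatibility of the
  charts of \<open>total_atlas\<close>.
\<close>

definition vector_bundle :: "('m, 'e::real_inner, 'a, 'f::real_inner) vbundle \<Rightarrow> bool" where
  "vector_bundle E \<longleftrightarrow> smooth_manifold (base E) \<and> finite_dim TYPE('f) \<and>
     proj E ` total E \<subseteq> pts (base E) \<and>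
     (\<Union>(W, \<theta>)\<in>trivs E. W) = pts (base E) \<and>
     (\<forall>(W, \<theta>)\<in>trivs E. openin (mtop (base E)) W \<and>
        (\<forall>x\<in>W. bij_betw \<theta> (fib E x) UNIV \<and>
          (\<forall>a\<in>fib E x. \<forall>b\<in>fib E x. fadd E a b \<in> fib E x \<and> \<theta> (fadd E a b) = \<theta> a + \<theta> b) \<and>
          (\<forall>c. \<forall>a\<in>fib E x. fscale E c a \<in> fib E x \<and> \<theta> (fscale E c a) = c *\<^sub>R \<theta> a))) \<and>
     smooth_manifold (total_atlas E)"

definition sections :: "('m, 'e::real_inner, 'a, 'f::real_inner) vbundle \<Rightarrow> ('m \<Rightarrow> 'a) set" where
  "sections E = {X \<in> extensional (pts (base E)).
     smooth_map (base E) (total_atlas E) X \<and> (\<forall>x\<in>pts (base E). proj E (X x) = x)}"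

definition sec_add ::
  "('m, 'e, 'a, 'f) vbundle \<Rightarrow> ('m \<Rightarrow> 'a) \<Rightarrow> ('m \<Rightarrow> 'a) \<Rightarrow> 'm \<Rightarrow> 'a" where
  "sec_add E X Y = (\<lambda>x\<in>pts (base E). fadd E (X x) (Y x))"

definition sec_mult ::
  "('m, 'e, 'a, 'f) vbundle \<Rightarrow> ('m \<Rightarrow> real) \<Rightarrow> ('m \<Rightarrow> 'a) \<Rightarrow> 'm \<Rightarrow> 'a" where
  "sec_mult E f X = (\<lambda>x\<in>pts (base E). fscale E (f x) (X x))"

definition dual_fib :: "('m, 'e, 'a, 'f) vbundle \<Rightarrow> 'm \<Rightarrow> ('a \<Rightarrow> real) set" where
  "dual_fib E x = {\<alpha>.
     (\<forall>a\<in>fib E x. \<forall>b\<in>fib E x. \<alpha> (fadd E a b) = \<alpha> a + \<alpha> b) \<and>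
     (\<forall>c. \<forall>a\<in>fib E x. \<alpha> (fscale E c a) = c * \<alpha> a) \<and>
     (\<forall>a. a \<notin> fib E x \<longrightarrow> \<alpha> a = 0)}"

text \<open>
  Elements of the dual bundle are pairs of a base point and a covector. The trivialisation induced
  by \<open>\<theta>\<close> is the inverse transpose of \<open>\<theta>\<close>, where the dual of \<open>'f\<close> is identified with \<open>'f\<close> by the
  inner product.
\<close>

definition dual_bundle :: "('m, 'e, 'a, 'f::real_inner) vbundle \<Rightarrow>
    ('m, 'e, 'm \<times> ('a \<Rightarrow> real), 'f) vbundle" where
  "dual_bundle E =
     \<lparr> base = base E,
       total = (SIGMA x:pts (base E). dual_fib E x),
       proj = fst,
       fadd = (\<lambda>(x, \<alpha>) (y, \<beta>). (x, \<lambda>a. \<alpha> a + \<beta> a)),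
       fscale = (\<lambda>c (x, \<alpha>). (x, \<lambda>a. c * \<alpha> a)),
       trivs = {(W, \<lambda>(x, \<alpha>). THE w. \<forall>v. w \<bullet> v = \<alpha> (inv_into (fib E x) \<theta> v)) | W \<theta>.
         (W, \<theta>) \<in> trivs E} \<rparr>"

text \<open>The fibrewise linear functions on \<open>A\<^sup>*\<close> and on \<open>A\<close> defined by sections of \<open>A\<close> and of \<open>A\<^sup>*\<close>.\<close>

definition hat :: "('m \<Rightarrow> 'a) \<Rightarrow> 'm \<times> ('a \<Rightarrow> real) \<Rightarrow> real" where
  "hat X = (\<lambda>(x, \<alpha>). \<alpha> (X x))"

definition hat_dual :: "('m, 'e, 'a, 'f) vbundle \<Rightarrow> ('m \<Rightarrow> 'm \<times> ('a \<Rightarrow> real)) \<Rightarrow> 'a \<Rightarrow> real" where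
  "hat_dual E \<alpha> = (\<lambda>a. snd (\<alpha> (proj E a)) a)"

definition bundle_action :: "('g, 'b) monoid_scheme \<Rightarrow> ('g, 'k::real_inner) atlas \<Rightarrow>
    ('m, 'e::real_inner, 'a, 'f::real_inner) vbundle \<Rightarrow>
    ('g \<Rightarrow> 'a \<Rightarrow> 'a) \<Rightarrow> ('g \<Rightarrow> 'm \<Rightarrow> 'm) \<Rightarrow> bool" where
  "bundle_action G \<G> E \<Phi> \<phi> \<longleftrightarrow>
     smooth_action G \<G> (total_atlas E) \<Phi> \<and> smooth_action G \<G> (base E) \<phi> \<and>
     (\<forall>g\<in>carrier G. \<forall>a\<in>total E. proj E (\<Phi> g a) = \<phi> g (proj E a)) \<and>
     (\<forall>g\<in>carrier G. \<forall>x\<in>pts (base E).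
        (\<forall>a\<in>fib E x. \<forall>b\<in>fib E x. \<Phi> g (fadd E a b) = fadd E (\<Phi> g a) (\<Phi> g b)) \<and>
        (\<forall>c. \<forall>a\<in>fib E x. \<Phi> g (fscale E c a) = fscale E c (\<Phi> g a)))"

definition dual_action :: "('g, 'b) monoid_scheme \<Rightarrow> ('m, 'e, 'a, 'f) vbundle \<Rightarrow>
    ('g \<Rightarrow> 'a \<Rightarrow> 'a) \<Rightarrow> ('g \<Rightarrow> 'm \<Rightarrow> 'm) \<Rightarrow>
    'g \<Rightarrow> 'm \<times> ('a \<Rightarrow> real) \<Rightarrow> 'm \<times> ('a \<Rightarrow> real)" where
  "dual_action G E \<Phi> \<phi> g =
     (\<lambda>(x, \<alpha>). (\<phi> g x, \<lambda>b. if b \<in> fib E (\<phi> g x) then \<alpha> (\<Phi> (inv\<^bsub>G\<^esub> g) b) else 0))"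


section \<open>Lie algebroids\<close>

definition lie_algebroid :: "('m, 'e::real_inner, 'a, 'f::real_inner) vbundle \<Rightarrow>
    (('m \<Rightarrow> 'a) \<Rightarrow> ('m \<Rightarrow> 'a) \<Rightarrow> 'm \<Rightarrow> 'a) \<Rightarrow> ('a \<Rightarrow> ('m \<Rightarrow> real) \<Rightarrow> real) \<Rightarrow> bool" where
  "lie_algebroid E br \<rho> \<longleftrightarrow> vector_bundle E \<and>
     \<comment> \<open>the anchor is a smooth bundle map to the tangent bundle\<close>
     (\<forall>a\<in>total E. \<rho> a \<in> tangent (base E) (proj E a)) \<and>
     (\<forall>x\<in>pts (base E).
        (\<forall>a\<in>fib E x. \<forall>b\<in>fib E x. \<rho> (fadd E a b) = (\<lambda>f. \<rho> a f + \<rho> b f)) \<and>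
        (\<forall>c. \<forall>a\<in>fib E x. \<rho> (fscale E c a) = (\<lambda>f. c * \<rho> a f))) \<and>
     (\<forall>X\<in>sections E. \<forall>f\<in>Cinf (base E). (\<lambda>x. \<rho> (X x) f) \<in> Cinf (base E)) \<and>
     \<comment> \<open>the bracket is a real Lie algebra structure on the sections\<close>
     (\<forall>X\<in>sections E. \<forall>Y\<in>sections E. br X Y \<in> sections E) \<and>
     (\<forall>X\<in>sections E. \<forall>Y\<in>sections E. br X Y = sec_mult E (\<lambda>_. -1) (br Y X)) \<and>
     (\<forall>X\<in>sections E. \<forall>Y\<in>sections E. \<forall>Z\<in>sections E.
        br X (sec_add E Y Z) = sec_add E (br X Y) (br X Z)) \<and>
     (\<forall>c. \<forall>X\<in>sections E. \<forall>Y\<in>sections E.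
        br X (sec_mult E (\<lambda>_. c) Y) = sec_mult E (\<lambda>_. c) (br X Y)) \<and>
     (\<forall>X\<in>sections E. \<forall>Y\<in>sections E. \<forall>Z\<in>sections E.
        br X (br Y Z) = sec_add E (br (br X Y) Z) (br Y (br X Z))) \<and>
     \<comment> \<open>Leibniz rule\<close>
     (\<forall>X\<in>sections E. \<forall>Y\<in>sections E. \<forall>f\<in>Cinf (base E).
        br X (sec_mult E f Y) =
          sec_add E (sec_mult E f (br X Y)) (sec_mult E (\<lambda>x. \<rho> (X x) f) Y))"

text \<open>
  Forms of degree \<open>k\<close> are represented as functions on the lists of \<open>k\<close> sections, with values in the
  functions on the base.
\<close>

type_synonym ('m, 'a) form = "('m \<Rightarrow> 'a) list \<Rightarrow> 'm \<Rightarrow> real"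

definition omit :: "nat \<Rightarrow> 'c list \<Rightarrow> 'c list" where
  "omit i xs = take i xs @ drop (Suc i) xs"

definition dA :: "(('m \<Rightarrow> 'a) \<Rightarrow> ('m \<Rightarrow> 'a) \<Rightarrow> 'm \<Rightarrow> 'a) \<Rightarrow> ('a \<Rightarrow> ('m \<Rightarrow> real) \<Rightarrow> real) \<Rightarrow>
    ('m, 'a) form \<Rightarrow> ('m, 'a) form" where
  "dA br \<rho> \<omega> Xs x =
     (\<Sum>i<length Xs. (-1) ^ i * \<rho> ((Xs ! i) x) (\<omega> (omit i Xs))) +
     (\<Sum>j<length Xs. \<Sum>i<j.
        (-1) ^ (i + j) * \<omega> (br (Xs ! i) (Xs ! j) # omit i (omit j Xs)) x)"

definition contract :: "('m \<Rightarrow> 'a) \<Rightarrow> ('m, 'a) form \<Rightarrow> ('m, 'a) form" where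
  "contract X \<omega> = (\<lambda>Xs. \<omega> (X # Xs))"

definition lie_deriv_form :: "(('m \<Rightarrow> 'a) \<Rightarrow> ('m \<Rightarrow> 'a) \<Rightarrow> 'm \<Rightarrow> 'a) \<Rightarrow>
    ('a \<Rightarrow> ('m \<Rightarrow> real) \<Rightarrow> real) \<Rightarrow> ('m \<Rightarrow> 'a) \<Rightarrow> ('m, 'a) form \<Rightarrow> ('m, 'a) form" where
  "lie_deriv_form br \<rho> X \<omega> = (\<lambda>Xs x.
     contract X (dA br \<rho> \<omega>) Xs x + dA br \<rho> (contract X \<omega>) Xs x)"

text \<open>The two directions of the identification of sections of \<open>A\<^sup>*\<close> with forms of degree one.\<close>

definition form_of :: "('m \<Rightarrow> 'm \<times> ('a \<Rightarrow> real)) \<Rightarrow> ('m, 'a) form" where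
  "form_of \<alpha> = (\<lambda>Xs x. snd (\<alpha> x) (hd Xs x))"

definition section_of :: "('m, 'e::real_inner, 'a, 'f::real_inner) vbundle \<Rightarrow> ('m, 'a) form \<Rightarrow>
    'm \<Rightarrow> 'm \<times> ('a \<Rightarrow> real)" where
  "section_of E \<omega> = (\<lambda>x\<in>pts (base E).
     (x, \<lambda>a. if a \<in> fib E x then \<omega> [SOME Y. Y \<in> sections E \<and> Y x = a] x else 0))"

definition lie_deriv :: "('m, 'e::real_inner, 'a, 'f::real_inner) vbundle \<Rightarrow>
    (('m \<Rightarrow> 'a) \<Rightarrow> ('m \<Rightarrow> 'a) \<Rightarrow> 'm \<Rightarrow> 'a) \<Rightarrow> ('a \<Rightarrow> ('m \<Rightarrow> real) \<Rightarrow> real) \<Rightarrow>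
    ('m \<Rightarrow> 'a) \<Rightarrow> ('m \<Rightarrow> 'm \<times> ('a \<Rightarrow> real)) \<Rightarrow> 'm \<Rightarrow> 'm \<times> ('a \<Rightarrow> real)" where
  "lie_deriv E br \<rho> X \<alpha> = section_of E (lie_deriv_form br \<rho> X (form_of \<alpha>))"

definition complete_lift :: "('m, 'e::real_inner, 'a, 'f::real_inner) vbundle \<Rightarrow>
    (('m \<Rightarrow> 'a) \<Rightarrow> ('m \<Rightarrow> 'a) \<Rightarrow> 'm \<Rightarrow> 'a) \<Rightarrow> ('a \<Rightarrow> ('m \<Rightarrow> real) \<Rightarrow> real) \<Rightarrow>
    ('m \<Rightarrow> 'a) \<Rightarrow> ('a \<Rightarrow> ('a \<Rightarrow> real) \<Rightarrow> real) \<Rightarrow> bool" where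
  "complete_lift E br \<rho> X V \<longleftrightarrow> vector_field (total_atlas E) V \<and>
     (\<forall>a\<in>total E. push (base E) (proj E) (V a) = \<rho> (X (proj E a))) \<and>
     (\<forall>\<alpha>\<in>sections (dual_bundle E). \<forall>a\<in>total E.
        V a (hat_dual E \<alpha>) = hat_dual E (lie_deriv E br \<rho> X \<alpha>) a)"

definition lie_anti_morphism :: "('g, 'b) monoid_scheme \<Rightarrow> ('g, 'k::real_inner) atlas \<Rightarrow>
    ('m, 'e::real_inner, 'a, 'f::real_inner) vbundle \<Rightarrow>
    (('m \<Rightarrow> 'a) \<Rightarrow> ('m \<Rightarrow> 'a) \<Rightarrow> 'm \<Rightarrow> 'a) \<Rightarrow> ('g lie_vec \<Rightarrow> 'm \<Rightarrow> 'a) \<Rightarrow> bool" where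
  "lie_anti_morphism G \<G> E br \<psi> \<longleftrightarrow>
     (\<forall>\<xi>\<in>lie_alg G \<G>. \<psi> \<xi> \<in> sections E) \<and>
     (\<forall>\<xi>\<in>lie_alg G \<G>. \<forall>\<eta>\<in>lie_alg G \<G>. \<psi> (\<lambda>f. \<xi> f + \<eta> f) = sec_add E (\<psi> \<xi>) (\<psi> \<eta>)) \<and>
     (\<forall>c. \<forall>\<xi>\<in>lie_alg G \<G>. \<psi> (\<lambda>f. c * \<xi> f) = sec_mult E (\<lambda>_. c) (\<psi> \<xi>)) \<and>
     (\<forall>\<xi>\<in>lie_alg G \<G>. \<forall>\<eta>\<in>lie_alg G \<G>.
        \<psi> (lie_bracket G \<G> \<xi> \<eta>) = sec_mult E (\<lambda>_. -1) (br (\<psi> \<xi>) (\<psi> \<eta>)))"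

definition by_complete_lifts :: "('g, 'b) monoid_scheme \<Rightarrow> ('g, 'k::real_inner) atlas \<Rightarrow>
    ('m, 'e::real_inner, 'a, 'f::real_inner) vbundle \<Rightarrow>
    (('m \<Rightarrow> 'a) \<Rightarrow> ('m \<Rightarrow> 'a) \<Rightarrow> 'm \<Rightarrow> 'a) \<Rightarrow> ('a \<Rightarrow> ('m \<Rightarrow> real) \<Rightarrow> real) \<Rightarrow>
    ('g \<Rightarrow> 'a \<Rightarrow> 'a) \<Rightarrow> ('g lie_vec \<Rightarrow> 'm \<Rightarrow> 'a) \<Rightarrow> bool" where
  "by_complete_lifts G \<G> E br \<rho> \<Phi> \<psi> \<longleftrightarrow> lie_anti_morphism G \<G> E br \<psi> \<and>
     (\<forall>\<xi>\<in>lie_alg G \<G>. complete_lift E br \<rho> (\<psi> \<xi>) (inf_gen (total_atlas E) \<Phi> \<xi>))"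


section \<open>Poisson structures and momentum maps\<close>

definition poisson_bracket :: "('p, 'e::real_inner) atlas \<Rightarrow>
    (('p \<Rightarrow> real) \<Rightarrow> ('p \<Rightarrow> real) \<Rightarrow> 'p \<Rightarrow> real) \<Rightarrow> bool" where
  "poisson_bracket \<A> P \<longleftrightarrow>
     (\<forall>F\<in>Cinf \<A>. \<forall>K\<in>Cinf \<A>. P F K \<in> Cinf \<A>) \<and>
     (\<forall>F\<in>Cinf \<A>. \<forall>K\<in>Cinf \<A>. \<forall>p\<in>pts \<A>. P F K p = - P K F p) \<and>
     (\<forall>F\<in>Cinf \<A>. \<forall>K\<in>Cinf \<A>. \<forall>L\<in>Cinf \<A>. \<forall>p\<in>pts \<A>.
        P F (\<lambda>q. K q + L q) p = P F K p + P F L p \<and>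
        P F (\<lambda>q. K q * L q) p = P F K p * L p + K p * P F L p \<and>
        P F (P K L) p + P K (P L F) p + P L (P F K) p = 0) \<and>
     (\<forall>c. \<forall>F\<in>Cinf \<A>. \<forall>K\<in>Cinf \<A>. \<forall>p\<in>pts \<A>. P F (\<lambda>q. c * K q) p = c * P F K p)"

text \<open>\<open>P\<close> is the bracket of the linear Poisson structure on \<open>A\<^sup>*\<close>.\<close>

definition linear_poisson :: "('m, 'e::real_inner, 'a, 'f::real_inner) vbundle \<Rightarrow>
    (('m \<Rightarrow> 'a) \<Rightarrow> ('m \<Rightarrow> 'a) \<Rightarrow> 'm \<Rightarrow> 'a) \<Rightarrow> ('a \<Rightarrow> ('m \<Rightarrow> real) \<Rightarrow> real) \<Rightarrow>
    (('m \<times> ('a \<Rightarrow> real) \<Rightarrow> real) \<Rightarrow> ('m \<times> ('a \<Rightarrow> real) \<Rightarrow> real) \<Rightarrow> 'm \<times> ('a \<Rightarrow> real) \<Rightarrow> real) \<Rightarrow>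
    bool" where
  "linear_poisson E br \<rho> P \<longleftrightarrow> poisson_bracket (total_atlas (dual_bundle E)) P \<and>
     (\<forall>p\<in>total (dual_bundle E).
        (\<forall>X\<in>sections E. \<forall>Y\<in>sections E. P (hat X) (hat Y) p = - hat (br X Y) p) \<and>
        (\<forall>X\<in>sections E. \<forall>f\<in>Cinf (base E).
           P (hat X) (f \<circ> proj (dual_bundle E)) p = - \<rho> (X (proj (dual_bundle E) p)) f) \<and>
        (\<forall>f\<in>Cinf (base E). \<forall>h\<in>Cinf (base E).
           P (f \<circ> proj (dual_bundle E)) (h \<circ> proj (dual_bundle E)) p = 0))"

definition ham_field :: "(('p \<Rightarrow> real) \<Rightarrow> ('p \<Rightarrow> real) \<Rightarrow> 'p \<Rightarrow> real) \<Rightarrow>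
    ('p \<Rightarrow> real) \<Rightarrow> 'p \<Rightarrow> ('p \<Rightarrow> real) \<Rightarrow> real" where
  "ham_field P F = (\<lambda>p K. P K F p)"

text \<open>
  Equality of vector fields is equality on smooth functions. Smoothness of \<open>J\<close> as a map into the
  finite-dimensional space \<open>lie_dual G \<G>\<close> is smoothness of all its components.
\<close>

definition momentum_map :: "('g, 'b) monoid_scheme \<Rightarrow> ('g, 'k::real_inner) atlas \<Rightarrow>
    ('p, 'e::real_inner) atlas \<Rightarrow> (('p \<Rightarrow> real) \<Rightarrow> ('p \<Rightarrow> real) \<Rightarrow> 'p \<Rightarrow> real) \<Rightarrow>
    ('g \<Rightarrow> 'p \<Rightarrow> 'p) \<Rightarrow> ('p \<Rightarrow> 'g lie_vec \<Rightarrow> real) \<Rightarrow> bool" where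
  "momentum_map G \<G> \<A> P \<Phi> J \<longleftrightarrow> (\<forall>p\<in>pts \<A>. J p \<in> lie_dual G \<G>) \<and>
     (\<forall>\<xi>\<in>lie_alg G \<G>. (\<lambda>p. J p \<xi>) \<in> Cinf \<A> \<and>
        (\<forall>p\<in>pts \<A>. \<forall>K\<in>Cinf \<A>. ham_field P (\<lambda>q. J q \<xi>) p K = inf_gen \<A> \<Phi> \<xi> p K))"

definition equivariant_momentum_map :: "('g, 'b) monoid_scheme \<Rightarrow> ('g, 'k::real_inner) atlas \<Rightarrow>
    ('p, 'e::real_inner) atlas \<Rightarrow> (('p \<Rightarrow> real) \<Rightarrow> ('p \<Rightarrow> real) \<Rightarrow> 'p \<Rightarrow> real) \<Rightarrow>
    ('g \<Rightarrow> 'p \<Rightarrow> 'p) \<Rightarrow> ('p \<Rightarrow> 'g lie_vec \<Rightarrow> real) \<Rightarrow> bool" where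
  "equivariant_momentum_map G \<G> \<A> P \<Phi> J \<longleftrightarrow> momentum_map G \<G> \<A> P \<Phi> J \<and>
     (\<forall>g\<in>carrier G. \<forall>p\<in>pts \<A>. J (\<Phi> g p) = Coad G \<G> g (J p))"

definition J_dual :: "('g, 'b) monoid_scheme \<Rightarrow> ('g, 'k::real_inner) atlas \<Rightarrow>
    ('g lie_vec \<Rightarrow> 'm \<Rightarrow> 'a) \<Rightarrow> 'm \<times> ('a \<Rightarrow> real) \<Rightarrow> 'g lie_vec \<Rightarrow> real" where
  "J_dual G \<G> \<psi> = (\<lambda>(x, \<alpha>). \<lambda>\<xi>\<in>lie_alg G \<G>. \<alpha> (\<psi> \<xi> x))"

end

theory Submission
  imports Defs
begin

text \<open>
  Both sides of \<open>H\<^bsub>J\<^sub>\<xi>\<^esub> = \<xi>\<^bsub>A\<^sup>*\<^esub>\<close> are derivations of the smooth functions on \<open>A\<^sup>*\<close> at a point, and such a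
  derivation is determined by its values on the functions pulled back from the base and on the
  fibrewise linear functions \<open>hat Y\<close>. On the former both sides are given by the anchor of \<open>\<psi> \<xi>\<close>. On
  \<open>hat Y\<close> the bracket gives the pairing with \<open>br (\<psi> \<xi>) Y\<close>, and the generator gives the same by
  differentiating the pairing of a dual section \<open>\<beta>\<close> with \<open>Y\<close> along an orbit, because \<open>\<psi> \<xi>\<close> generates
  its complete lift.

  For the equivariance, consider \<open>u g = \<langle>\<Phi>\<^sup>*\<^sub>g \<alpha>, \<psi> (Ad g \<xi>)\<rangle>\<close>. By translation it suffices to
  differentiate \<open>u\<close> at the unit, in a direction \<open>\<eta>\<close>: the first factor contributes the pairing of \<open>\<alpha>\<close>
  with \<open>br (\<psi> \<eta>) (\<psi> \<xi>)\<close> and the second its pairing with \<open>\<psi> [\<eta>, \<xi>]\<close>, which cancel since \<open>\<psi>\<close> is an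
  anti-morphism. So \<open>u\<close> is constant on the connected group.
\<close>

section \<open>Finite-dimensional inner product spaces\<close>

text \<open>A complete lift is prescribed through \<open>section_of\<close>, which picks, for each
  vector \<open>a\<close> of a fibre, one section through \<open>a\<close>. The orbit derivative of
  \<open>hat Y\<close> is therefore known at first for one \<open>Y\<close> per \<open>a\<close>
  only. This is enough for the momentum identity: a tangent vector of the dual bundle that kills the
  functions from the base is vertical, and a vertical vector sees of \<open>Y\<close> only its value
  at the base point. The identity, once proved, yields the derivative of \<open>hat Y\<close> for
  every section \<open>Y\<close>, and equivariance uses it for \<open>\<psi> \<xi>\<close>.

  Tangent vectors are abstract derivations, so computing with them takes coordinates: Hadamard's
  lemma and bump functions turn every derivation into a directional derivative in a chart. This is
  what the calculus on the model spaces is for. Neither flows nor the exponential map occur;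
  derivatives are taken at the unit along maps out of the group, and a group element that occurs
  twice is treated as two variables restricted to the diagonal.\<close>

lemma orthonormal_basis_exists:
  assumes "finite_dim TYPE('e::real_inner)"
  shows "\<exists>B::'e set. finite B \<and> (\<forall>x. (\<Sum>b\<in>B. (x \<bullet> b) *\<^sub>R b) = x)"
proof -
  obtain S :: "'e set" where S: "finite S" "span S = UNIV"
    using assms by (auto simp: finite_dim_def)
  obtain C where C: "finite C" "span C = span S" "pairwise orthogonal C"
    using basis_orthogonal[OF S(1)] by blast
  define B where "B = (\<lambda>x. x /\<^sub>R norm x) ` (C - {0})"
  have "finite B" using C by (simp add: B_def)
  have ip: "b \<bullet> c = (if b = c then 1 else 0)" if "b \<in> B" "c \<in> B" for b c
  proof -
    obtain x y where xy: "x \<in> C" "x \<noteq> 0" "b = x /\<^sub>R norm x" "y \<in> C" "y \<noteq> 0" "c = y /\<^sub>R norm y"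
      using \<open>b \<in> B\<close> \<open>c \<in> B\<close> unfolding B_def by blast
    have 1: "b \<bullet> b = 1" using xy by (simp add: dot_square_norm power2_eq_square)
    have "b \<bullet> c = 0" if "b \<noteq> c"
    proof -
      have "x \<noteq> y" using that xy by auto
      then have "x \<bullet> y = 0" using C(3) xy by (auto simp: pairwise_def orthogonal_def)
      then show ?thesis using xy by simp
    qed
    with 1 show ?thesis by auto
  qed
  have sp: "span B = UNIV"
  proof -
    have "x \<in> span B" if "x \<in> C" for x
    proof (cases "x = 0")
      case False
      then have "x /\<^sub>R norm x \<in> span B" using that by (intro span_base) (auto simp: B_def)
      then have "norm x *\<^sub>R (x /\<^sub>R norm x) \<in> span B" by (rule span_scale)
      then show ?thesis using False by simp
    qed (simp add: span_zero)
    then have "span C \<subseteq> span B" by (simp add: span_minimal subsetI)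
    then show ?thesis using C S by auto
  qed
  have "(\<Sum>b\<in>B. (x \<bullet> b) *\<^sub>R b) = x" for x
  proof -
    have "x \<in> span B" using sp by auto
    then show ?thesis
    proof (induction rule: span_induct_alt)
      case (step c x y)
      have "(\<Sum>b\<in>B. (x \<bullet> b) *\<^sub>R b) = (\<Sum>b\<in>B. if b = x then x else 0)"
        using step by (intro sum.cong) (auto simp: ip)
      also have "\<dots> = x" using step \<open>finite B\<close> by simp
      finally have "(\<Sum>b\<in>B. (x \<bullet> b) *\<^sub>R b) = x" .
      with step show ?case
        by (simp add: inner_add_left scaleR_add_left sum.distrib flip: scaleR_scaleR scaleR_sum_right)
    qed simp
  qed
  with \<open>finite B\<close> show ?thesis by blast
qed

text \<open>One fixed choice lets later statements expand vectors in coordinates without carrying a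
  basis along. In dimension zero the empty set qualifies.\<close>

definition onb :: "'e::real_inner set" where
  "onb = (SOME B. finite B \<and> (\<forall>x. (\<Sum>b\<in>B. (x \<bullet> b) *\<^sub>R b) = x))"

lemma
  assumes "finite_dim TYPE('e::real_inner)"
  shows finite_onb: "finite (onb :: 'e set)"
    and onb_expand: "(\<Sum>b\<in>onb. (x \<bullet> b) *\<^sub>R b) = (x :: 'e)"
  using someI_ex[OF orthonormal_basis_exists[OF assms]] by (simp_all add: onb_def)

lemma linear_onb_expand:
  fixes f :: "'e::real_inner \<Rightarrow> 'f::real_vector"
  assumes "finite_dim TYPE('e)" "linear f"
  shows "f x = (\<Sum>b\<in>onb. (x \<bullet> b) *\<^sub>R f b)"
proof -
  have "f x = f (\<Sum>b\<in>onb. (x \<bullet> b) *\<^sub>R b)" by (simp only: onb_expand[OF assms(1)])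
  then show ?thesis using assms(2) by (simp add: linear_sum linear_scale)
qed

text \<open>By the expansion in \<open>onb\<close>, a linear map is a finite sum of bounded
  functionals times constant vectors.\<close>

lemma finite_dim_linear_bounded:
  fixes f :: "'e::real_inner \<Rightarrow> 'f::real_normed_vector"
  assumes "finite_dim TYPE('e)" "linear f"
  shows "bounded_linear f"
proof -
  have "bounded_linear (\<lambda>x. \<Sum>b\<in>onb. (x \<bullet> b) *\<^sub>R f b)"
    by (intro bounded_linear_sum bounded_linear_scaleR_const bounded_linear_inner_left)
  then show ?thesis by (simp flip: linear_onb_expand[OF assms])
qed

lemma finite_dim_prod:
  assumes "finite_dim TYPE('e::real_inner)" "finite_dim TYPE('f::real_inner)"
  shows "finite_dim TYPE('e \<times> 'f)"
proof -
  define B :: "('e \<times> 'f) set" where "B = (\<lambda>b. (b, 0)) ` onb \<union> (\<lambda>c. (0, c)) ` onb"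
  have "finite B" using assms by (simp add: B_def finite_onb)
  moreover have "span B = UNIV"
  proof -
    have "p \<in> span B" for p :: "'e \<times> 'f"
    proof -
      have "p = (\<Sum>b\<in>onb. (fst p \<bullet> b) *\<^sub>R (b, 0)) + (\<Sum>c\<in>onb. (snd p \<bullet> c) *\<^sub>R (0, c))"
        by (simp add: prod_eq_iff fst_sum snd_sum onb_expand assms)
      also have "\<dots> \<in> span B"
        by (intro span_add span_sum span_scale span_base) (auto simp: B_def)
      finally show ?thesis .
    qed
    then show ?thesis by auto
  qed
  ultimately show ?thesis by (auto simp: finite_dim_def)
qed

lemma finite_dim_real: "finite_dim TYPE(real)"
proof -
  have "x \<in> span {1}" for x :: real
    using span_scale[OF span_base[of 1 "{1::real}"], of x] by simp
  then have "span {1::real} = UNIV" by auto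
  then show ?thesis unfolding finite_dim_def by (intro exI[of _ "{1}"]) simp
qed

text \<open>The combinations of a finite set with coefficients in a bounded interval form a compact
  set, by adding one vector at a time. By Cauchy-Schwarz the ball is a closed subset of such a
  set.\<close>

lemma finite_dim_compact_cball:
  assumes fd: "finite_dim TYPE('e::real_inner)"
  shows "compact (cball (x::'e) r)"
proof -
  define K where "K B R = {v::'e. \<exists>c. (\<forall>b\<in>B. \<bar>c b\<bar> \<le> R) \<and> v = (\<Sum>b\<in>B. c b *\<^sub>R b)}" for B R
  have K: "compact (K B R)" if "finite B" for B :: "'e set" and R :: real
    using that
  proof (induction B)
    case empty
    then show ?case by (simp add: K_def)
  next
    case (insert a B)
    have eq: "K (insert a B) R = (\<lambda>(t, v). t *\<^sub>R a + v) ` ({-R..R} \<times> K B R)" (is "?l = ?r")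
    proof (intro equalityI subsetI)
      fix v assume "v \<in> ?l"
      then obtain c where c: "\<forall>b\<in>insert a B. \<bar>c b\<bar> \<le> R" "v = (\<Sum>b\<in>insert a B. c b *\<^sub>R b)"
        by (auto simp: K_def)
      then have "v = c a *\<^sub>R a + (\<Sum>b\<in>B. c b *\<^sub>R b)" "(\<Sum>b\<in>B. c b *\<^sub>R b) \<in> K B R"
        "c a \<in> {-R..R}"
        using insert by (auto simp: K_def)
      then show "v \<in> ?r" by force
    next
      fix v assume "v \<in> ?r"
      then obtain t c where tc: "t \<in> {-R..R}" "\<forall>b\<in>B. \<bar>c b\<bar> \<le> R" "v = t *\<^sub>R a + (\<Sum>b\<in>B. c b *\<^sub>R b)"
        by (auto simp: K_def)
      have "(\<Sum>b\<in>B. c b *\<^sub>R b) = (\<Sum>b\<in>B. (c(a := t)) b *\<^sub>R b)"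
        using insert by (intro sum.cong) auto
      then have "v = (\<Sum>b\<in>insert a B. (c(a := t)) b *\<^sub>R b)" "\<forall>b\<in>insert a B. \<bar>(c(a := t)) b\<bar> \<le> R"
        using tc insert by auto
      then show "v \<in> ?l" unfolding K_def by blast
    qed
    show ?case unfolding eq
      by (intro compact_continuous_image compact_Times compact_Icc insert.IH)
         (auto simp: split_beta intro!: continuous_intros)
  qed
  \<comment> \<open>A common bound for the coordinates of all points of the ball. The inserted 0
    keeps \<open>Max\<close> meaningful when \<open>onb\<close> is empty.\<close>
  define R where "R = Max (insert 0 ((\<lambda>b. (norm x + \<bar>r\<bar>) * norm b) ` (onb :: 'e set)))"
  have "cball x r \<subseteq> K onb R"
  proof
    fix y assume "y \<in> cball x r"
    then have ny: "norm y \<le> norm x + \<bar>r\<bar>"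
      by (smt (verit) dist_norm mem_cball norm_minus_commute norm_triangle_sub)
    have "\<bar>y \<bullet> b\<bar> \<le> R" if "b \<in> onb" for b
    proof -
      have "\<bar>y \<bullet> b\<bar> \<le> norm y * norm b" by (rule Cauchy_Schwarz_ineq2)
      also have "\<dots> \<le> (norm x + \<bar>r\<bar>) * norm b" using ny by (intro mult_right_mono) auto
      also have "\<dots> \<le> R" unfolding R_def using that fd by (intro Max_ge) (auto simp: finite_onb)
      finally show ?thesis .
    qed
    then show "y \<in> K onb R"
      unfolding K_def using onb_expand[OF fd, of y] by (auto intro!: exI[of _ "\<lambda>b. y \<bullet> b"])
  qed
  moreover have "compact (K onb R)" using fd by (intro K finite_onb)
  ultimately show ?thesis
    by (metis closed_Int_compact closed_cball inf.absorb_iff1)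
qed

section \<open>Calculus of smooth functions\<close>

lemma has_derivative_frechet:
  "f differentiable (at x) \<Longrightarrow> (f has_derivative (\<lambda>v. frechet_derivative f (at x) v)) (at x)"
  by (simp add: frechet_derivative_works)

lemma Ck_on_continuous: "Ck_on k U f \<Longrightarrow> continuous_on U f"
  by (cases k) (simp_all add: continuous_at_imp_continuous_on differentiable_imp_continuous_within)

lemma Ck_on_Suc_D: "Ck_on (Suc k) U f \<Longrightarrow> Ck_on k U f"
proof (induction k arbitrary: f)
  case 0
  then show ?case using Ck_on_continuous by fastforce
next
  case (Suc k)
  then show ?case by (metis Ck_on.simps(2))
qed

lemma Ck_on_mono: "Ck_on k U f \<Longrightarrow> V \<subseteq> U \<Longrightarrow> Ck_on k V f"
  by (induction k arbitrary: f) (auto intro: continuous_on_subset)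

lemma frechet_derivative_cong_open:
  assumes "open U" "x \<in> U" "\<And>y. y \<in> U \<Longrightarrow> f y = g y"
  shows "frechet_derivative f (at x) = frechet_derivative g (at x)"
proof -
  have "(f has_derivative D) (at x) \<longleftrightarrow> (g has_derivative D) (at x)" for D
    using assms by (metis has_derivative_transform_within_open)
  then show ?thesis by (simp add: frechet_derivative_def)
qed

lemma differentiable_cong_open:
  assumes "open U" "x \<in> U" "\<And>y. y \<in> U \<Longrightarrow> f y = g y"
  shows "f differentiable (at x) \<longleftrightarrow> g differentiable (at x)"
proof
  assume "f differentiable (at x)"
  then show "g differentiable (at x)"
    unfolding differentiable_def using assms(3)
    by (meson has_derivative_transform_within_open[OF _ assms(1,2)])
next
  assume "g differentiable (at x)"
  moreover have "\<And>y. y \<in> U \<Longrightarrow> g y = f y" using assms(3) by simp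
  ultimately show "f differentiable (at x)"
    unfolding differentiable_def by (meson has_derivative_transform_within_open[OF _ assms(1,2)])
qed

lemma Ck_on_cong:
  assumes "open U" "\<And>x. x \<in> U \<Longrightarrow> f x = g x"
  shows "Ck_on k U f \<longleftrightarrow> Ck_on k U g"
  using assms(2)
proof (induction k arbitrary: f g)
  case 0
  then show ?case by (simp cong: continuous_on_cong)
next
  case (Suc k)
  have "Ck_on k U (\<lambda>x. frechet_derivative f (at x) v) \<longleftrightarrow>
      Ck_on k U (\<lambda>x. frechet_derivative g (at x) v)" for v
    using frechet_derivative_cong_open[OF assms(1) _ Suc.prems] by (intro Suc.IH) simp
  moreover have "f differentiable (at x) \<longleftrightarrow> g differentiable (at x)" if "x \<in> U" for x
    using assms(1) that Suc.prems by (rule differentiable_cong_open)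
  ultimately show ?case by simp
qed

text \<open>Derivatives in \<open>Ck_on\<close> are taken at full neighbourhoods of a point, so it
  is enough to look near each point of \<open>U\<close>. This allows smoothness on images of charts
  to be checked one point at a time.\<close>

lemma Ck_on_local:
  assumes "\<And>x. x \<in> U \<Longrightarrow> \<exists>V. open V \<and> x \<in> V \<and> Ck_on k V f"
  shows "Ck_on k U f"
  using assms
proof (induction k arbitrary: f)
  case 0
  show ?case unfolding Ck_on.simps
  proof (rule continuous_at_imp_continuous_on, rule ballI)
    show "isCont f x" if "x \<in> U" for x
      using 0[OF that] by (auto simp: continuous_on_eq_continuous_at)
  qed
next
  case (Suc k)
  have "f differentiable (at x)" if "x \<in> U" for x
    using Suc.prems[OF that] by auto
  moreover have "Ck_on k U (\<lambda>x. frechet_derivative f (at x) v)" for v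
    using Suc.prems by (intro Suc.IH) (metis Ck_on.simps(2))
  ultimately show ?case by simp
qed

text \<open>Lets an induction step exhibit the derivative by a formula. Openness of \<open>U\<close>
  is what permits replacing \<open>frechet_derivative\<close> by \<open>f'\<close> under further
  differentiation.\<close>

lemma Ck_on_SucI:
  assumes "\<And>x. x \<in> U \<Longrightarrow> (f has_derivative f' x) (at x)" "open U"
    and "\<And>v. Ck_on k U (\<lambda>x. f' x v)"
  shows "Ck_on (Suc k) U f"
proof -
  have fr: "frechet_derivative f (at x) = f' x" if "x \<in> U" for x
    using assms(1)[OF that] by (metis frechet_derivative_at)
  have "Ck_on k U (\<lambda>x. frechet_derivative f (at x) v)" for v
    using assms(3)[of v] Ck_on_cong[OF assms(2), of "\<lambda>x. frechet_derivative f (at x) v" "\<lambda>x. f' x v"] fr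
    by simp
  then show ?thesis using assms(1) by (auto simp: differentiable_def)
qed

lemma Ck_on_const: "Ck_on k U (\<lambda>_. c)"
  by (induction k arbitrary: c) auto

lemma Ck_on_linear:
  assumes "bounded_linear L"
  shows "Ck_on k U L"
proof (cases k)
  case 0
  then show ?thesis using assms by (simp add: linear_continuous_on)
next
  case (Suc n)
  have "(L has_derivative L) (at x)" for x
    using assms by (rule bounded_linear_imp_has_derivative)
  then show ?thesis unfolding Suc
    by (intro Ck_on_mono[OF Ck_on_SucI[where U = UNIV and f' = "\<lambda>_. L"]]) (auto simp: Ck_on_const)
qed

lemma Ck_on_linear_compose:
  assumes "bounded_linear L" "open U" "Ck_on k U f"
  shows "Ck_on k U (\<lambda>x. L (f x))"
  using assms(3)
proof (induction k arbitrary: f)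
  case 0
  then show ?case using assms(1) by (auto intro: bounded_linear.continuous_on)
next
  case (Suc k)
  show ?case
  proof (rule Ck_on_SucI[where f' = "\<lambda>x v. L (frechet_derivative f (at x) v)"])
    show "((\<lambda>x. L (f x)) has_derivative (\<lambda>v. L (frechet_derivative f (at x) v))) (at x)"
      if "x \<in> U" for x
      using that Suc.prems
      by (intro bounded_linear.has_derivative[OF assms(1)] has_derivative_frechet) simp
    show "Ck_on k U (\<lambda>x. L (frechet_derivative f (at x) v))" for v
      using Suc.prems by (intro Suc.IH) simp
  qed (rule assms)
qed

lemma Ck_on_add:
  assumes "open U" "Ck_on k U f" "Ck_on k U g"
  shows "Ck_on k U (\<lambda>x. f x + g x)"
  using assms(2,3)
proof (induction k arbitrary: f g)
  case 0
  then show ?case by (auto intro: continuous_on_add)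
next
  case (Suc k)
  from Suc.prems have f: "\<And>x. x \<in> U \<Longrightarrow> f differentiable (at x)" "\<And>v. Ck_on k U (\<lambda>x. frechet_derivative f (at x) v)"
    and g: "\<And>x. x \<in> U \<Longrightarrow> g differentiable (at x)" "\<And>v. Ck_on k U (\<lambda>x. frechet_derivative g (at x) v)"
    by simp_all
  show ?case
  proof (rule Ck_on_SucI[where f' = "\<lambda>x v. frechet_derivative f (at x) v + frechet_derivative g (at x) v"])
    show "((\<lambda>x. f x + g x) has_derivative
        (\<lambda>v. frechet_derivative f (at x) v + frechet_derivative g (at x) v)) (at x)" if "x \<in> U" for x
      using that by (intro has_derivative_add has_derivative_frechet f g)
    show "Ck_on k U (\<lambda>x. frechet_derivative f (at x) v + frechet_derivative g (at x) v)" for v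
      by (intro Suc.IH f g)
  qed (rule assms)
qed

lemma Ck_on_sum:
  assumes "open U" "\<And>i. i \<in> I \<Longrightarrow> Ck_on k U (f i)"
  shows "Ck_on k U (\<lambda>x. \<Sum>i\<in>I. f i x)"
  using assms(2)
  by (induction I rule: infinite_finite_induct) (simp_all add: Ck_on_const Ck_on_add[OF assms(1)])

text \<open>The product rule leaves each factor once undifferentiated, and
  \<open>Ck_on_Suc_D\<close> lowers its order so that the induction hypothesis applies.\<close>

lemma Ck_on_bilinear:
  assumes "bounded_bilinear B" "open U" "Ck_on k U f" "Ck_on k U g"
  shows "Ck_on k U (\<lambda>x. B (f x) (g x))"
  using assms(3,4)
proof (induction k arbitrary: f g)
  case 0
  then show ?case using assms(1) by (auto intro: bounded_bilinear.continuous_on)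
next
  case (Suc k)
  show ?case
  proof (rule Ck_on_SucI[where f' = "\<lambda>x v. B (f x) (frechet_derivative g (at x) v) + B (frechet_derivative f (at x) v) (g x)"])
    show "((\<lambda>x. B (f x) (g x)) has_derivative (\<lambda>v. B (f x) (frechet_derivative g (at x) v) + B (frechet_derivative f (at x) v) (g x))) (at x)"
      if "x \<in> U" for x
      using that Suc.prems by (intro bounded_bilinear.FDERIV[OF assms(1)] has_derivative_frechet) auto
    show "Ck_on k U (\<lambda>x. B (f x) (frechet_derivative g (at x) v) + B (frechet_derivative f (at x) v) (g x))" for v
      using Suc.prems Ck_on_Suc_D[OF Suc.prems(1)] Ck_on_Suc_D[OF Suc.prems(2)]
      by (intro Ck_on_add Suc.IH assms) simp_all
  qed (rule assms)
qed

text \<open>In the chain rule the derivative of \<open>f\<close> is applied to a direction that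
  varies with \<open>x\<close>, whereas \<open>Ck_on\<close> controls derivatives in fixed
  directions. Expanding the direction in \<open>onb\<close> gives a finite sum of products, each
  with a factor of the form treated by the induction hypothesis. This is where the middle space has
  to be finite-dimensional.\<close>

lemma Ck_on_compose:
  fixes f :: "'f::real_inner \<Rightarrow> 'h::real_normed_vector" and g :: "'e::real_normed_vector \<Rightarrow> 'f"
  assumes fd: "finite_dim TYPE('f)" and "open U" "open V"
    and "Ck_on k U g" "Ck_on k V f" "g ` U \<subseteq> V"
  shows "Ck_on k U (\<lambda>x. f (g x))"
  using assms(4,5)
proof (induction k arbitrary: f)
  case 0
  then show ?case using assms(6) by (auto intro: continuous_on_compose2)
next
  case (Suc k)
  have df: "f differentiable (at (g x))" if "x \<in> U" for x
    using that Suc.prems assms(6) by auto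
  have ex: "frechet_derivative f (at (g x)) w = (\<Sum>b\<in>onb. (w \<bullet> b) *\<^sub>R frechet_derivative f (at (g x)) b)"
    if "x \<in> U" for x w
    using df[OF that] by (intro linear_onb_expand[OF fd] linear_frechet_derivative)
  show ?case
  proof (rule Ck_on_SucI[where f' = "\<lambda>x v. \<Sum>b\<in>onb. (frechet_derivative g (at x) v \<bullet> b) *\<^sub>R frechet_derivative f (at (g x)) b"])
    show "((\<lambda>x. f (g x)) has_derivative (\<lambda>v. \<Sum>b\<in>onb. (frechet_derivative g (at x) v \<bullet> b) *\<^sub>R frechet_derivative f (at (g x)) b)) (at x)"
      if "x \<in> U" for x
      unfolding ex[OF that, symmetric]
      using Suc.prems(1) that
      by (intro has_derivative_compose[of g _ x UNIV f, OF has_derivative_frechet has_derivative_frechet[OF df]]) auto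
    show "Ck_on k U (\<lambda>x. \<Sum>b\<in>onb. (frechet_derivative g (at x) v \<bullet> b) *\<^sub>R frechet_derivative f (at (g x)) b)" for v
    proof (intro Ck_on_sum Ck_on_bilinear[OF bounded_bilinear_scaleR] assms)
      show "Ck_on k U (\<lambda>x. frechet_derivative g (at x) v \<bullet> b)" for b
        using Suc.prems by (intro Ck_on_linear_compose[OF bounded_linear_inner_left] assms) auto
      show "Ck_on k U (\<lambda>x. frechet_derivative f (at (g x)) b)" for b
        using Suc.prems Ck_on_Suc_D[OF Suc.prems(1)] by (intro Suc.IH) simp_all
    qed
  qed (rule assms)
qed

lemma smooth_on_continuous: "smooth_on U f \<Longrightarrow> continuous_on U f"
  by (metis Ck_on.simps(1) smooth_on_def)

lemma smooth_on_mono: "smooth_on U f \<Longrightarrow> V \<subseteq> U \<Longrightarrow> smooth_on V f"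
  by (metis Ck_on_mono smooth_on_def)

lemma smooth_on_cong:
  "open U \<Longrightarrow> (\<And>x. x \<in> U \<Longrightarrow> f x = g x) \<Longrightarrow> smooth_on U f \<longleftrightarrow> smooth_on U g"
  unfolding smooth_on_def by (metis Ck_on_cong)

lemma smooth_on_local:
  assumes "\<And>x. x \<in> U \<Longrightarrow> \<exists>V. open V \<and> x \<in> V \<and> smooth_on V f"
  shows "smooth_on U f"
  using assms unfolding smooth_on_def by (metis Ck_on_local)

lemma smooth_on_differentiable: "smooth_on U f \<Longrightarrow> x \<in> U \<Longrightarrow> f differentiable (at x)"
  unfolding smooth_on_def by (metis Ck_on.simps(2))

lemma smooth_on_has_derivative:
  "smooth_on U f \<Longrightarrow> x \<in> U \<Longrightarrow> (f has_derivative (\<lambda>v. frechet_derivative f (at x) v)) (at x)"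
  by (simp add: has_derivative_frechet smooth_on_differentiable)

lemma smooth_on_frechet: "smooth_on U f \<Longrightarrow> smooth_on U (\<lambda>x. frechet_derivative f (at x) v)"
  unfolding smooth_on_def by (metis Ck_on.simps(2))

lemma smooth_on_const: "smooth_on U (\<lambda>_. c)"
  by (simp add: smooth_on_def Ck_on_const)

lemma smooth_on_linear: "bounded_linear L \<Longrightarrow> smooth_on U L"
  by (simp add: smooth_on_def Ck_on_linear)

lemma smooth_on_linear_compose:
  "bounded_linear L \<Longrightarrow> open U \<Longrightarrow> smooth_on U f \<Longrightarrow> smooth_on U (\<lambda>x. L (f x))"
  by (simp add: smooth_on_def Ck_on_linear_compose)

lemma smooth_on_add:
  "open U \<Longrightarrow> smooth_on U f \<Longrightarrow> smooth_on U g \<Longrightarrow> smooth_on U (\<lambda>x. f x + g x)"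
  by (simp add: smooth_on_def Ck_on_add)

lemma smooth_on_bilinear:
  "bounded_bilinear B \<Longrightarrow> open U \<Longrightarrow> smooth_on U f \<Longrightarrow> smooth_on U g \<Longrightarrow>
    smooth_on U (\<lambda>x. B (f x) (g x))"
  by (simp add: smooth_on_def Ck_on_bilinear)

lemma smooth_on_Pair:
  assumes "open U" "smooth_on U f" "smooth_on U g"
  shows "smooth_on U (\<lambda>x. (f x, g x))"
proof -
  have "smooth_on U (\<lambda>x. (f x, 0) + (0, g x))"
    by (intro smooth_on_add assms smooth_on_linear_compose[OF _ assms(1,2)] 
        smooth_on_linear_compose[OF _ assms(1,3)] bounded_linear_Pair bounded_linear_ident bounded_linear_zero)
  then show ?thesis by simp
qed

lemma smooth_on_compose:
  fixes f :: "'f::real_inner \<Rightarrow> 'h::real_normed_vector" and g :: "'e::real_normed_vector \<Rightarrow> 'f"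
  assumes "finite_dim TYPE('f)" "open U" "open V" "smooth_on U g" "smooth_on V f" "g ` U \<subseteq> V"
  shows "smooth_on U (\<lambda>x. f (g x))"
  using assms unfolding smooth_on_def by (metis Ck_on_compose)

section \<open>Smooth bump functions on the model spaces\<close>

definition flat :: "nat \<Rightarrow> real \<Rightarrow> real" where
  "flat n t = (if t > 0 then inverse t ^ n * exp (- inverse t) else 0)"

lemma flat_tendsto_0: "(flat n \<longlongrightarrow> 0) (at 0)"
proof -
  have "((\<lambda>t. inverse t ^ n / exp (inverse t)) \<longlongrightarrow> (0::real)) (at_right 0)"
    using filterlim_compose[OF tendsto_power_div_exp_0 filterlim_inverse_at_top_right] .
  moreover have "eventually (\<lambda>t. inverse t ^ n / exp (inverse t) = flat n t) (at_right 0)"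
    by (auto simp: eventually_at_filter flat_def exp_minus field_simps)
  ultimately have "(flat n \<longlongrightarrow> 0) (at_right 0)"
    by (rule Lim_transform_eventually)
  moreover have "(flat n \<longlongrightarrow> 0) (at_left 0)"
    by (rule Lim_transform_eventually[OF tendsto_const])
       (auto simp: eventually_at_filter flat_def)
  ultimately show ?thesis by (simp add: filterlim_split_at_real)
qed

text \<open>The powers of \<open>inverse t\<close> in \<open>flat\<close> make the family closed
  under differentiation up to linear combinations, so that one induction proves all members
  smooth.\<close>

lemma flat_deriv:
  "(flat n has_real_derivative - real n * flat (Suc n) t + flat (Suc (Suc n)) t) (at t)"
proof (cases t "0::real" rule: linorder_cases)
  case less
  have "((\<lambda>_. 0) has_real_derivative 0) (at t)" by simp
  then have "(flat n has_real_derivative 0) (at t)"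
    by (rule has_field_derivative_transform_within_open[where S = "{..<0}"])
       (use less in \<open>auto simp: flat_def\<close>)
  then show ?thesis using less by (simp add: flat_def)
next
  case equal
  \<comment> \<open>Away from 0 the difference quotient at 0 is \<open>flat (Suc n)\<close> itself,
    so the limit is the one already computed.\<close>
  have "((\<lambda>h. (flat n (0 + h) - flat n 0) / h) \<longlongrightarrow> 0) (at 0)"
    by (rule Lim_transform_eventually[OF flat_tendsto_0[of "Suc n"]])
       (auto simp: eventually_at_filter flat_def field_simps)
  then have "(flat n has_real_derivative 0) (at 0)" by (simp add: DERIV_def)
  then show ?thesis using equal by (simp add: flat_def)
next
  case greater
  have "((\<lambda>t. inverse t ^ n * exp (- inverse t)) has_real_derivative
      - real n * (inverse t ^ Suc n * exp (- inverse t)) + inverse t ^ Suc (Suc n) * exp (- inverse t)) (at t)"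
  proof -
    \<comment> \<open>The power rule produces the truncated exponent \<open>n - Suc 0\<close>; hence
      the case split, in which the factor \<open>real n\<close> settles
      \<open>n = 0\<close>.\<close>
    have "real n * (inverse t ^ (n - Suc 0) * - (inverse t * inverse t)) * exp (- inverse t) +
        inverse t ^ n * (exp (- inverse t) * (inverse t * inverse t)) =
      - real n * (inverse t ^ Suc n * exp (- inverse t)) + inverse t ^ Suc (Suc n) * exp (- inverse t)"
      by (cases n) (simp_all add: algebra_simps)
    moreover have "((\<lambda>t. inverse t ^ n * exp (- inverse t)) has_real_derivative
        real n * (inverse t ^ (n - Suc 0) * - (inverse t * inverse t)) * exp (- inverse t) +
        inverse t ^ n * (exp (- inverse t) * (inverse t * inverse t))) (at t)"
      using greater by (auto intro!: derivative_eq_intros simp: power2_eq_square)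
    ultimately show ?thesis by (simp only:)
  qed
  then have "(flat n has_real_derivative
      - real n * (inverse t ^ Suc n * exp (- inverse t)) + inverse t ^ Suc (Suc n) * exp (- inverse t)) (at t)"
    by (rule has_field_derivative_transform_within_open[where S = "{0<..}"])
       (use greater in \<open>auto simp: flat_def\<close>)
  then show ?thesis using greater by (simp add: flat_def)
qed

lemma smooth_on_flat: "smooth_on UNIV (flat n)"
proof -
  have "Ck_on k UNIV (flat n)" for k
  proof (induction k arbitrary: n)
    case 0
    show ?case by (auto intro!: continuous_at_imp_continuous_on DERIV_isCont flat_deriv)
  next
    case (Suc k)
    show ?case
    proof (rule Ck_on_SucI[where f' = "\<lambda>t v. (- real n * flat (Suc n) t + flat (Suc (Suc n)) t) * v"])
      show "(flat n has_derivative (\<lambda>v. (- real n * flat (Suc n) t + flat (Suc (Suc n)) t) * v)) (at t)" for t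
        using flat_deriv[of n t] by (simp add: has_field_derivative_def)
      show "Ck_on k UNIV (\<lambda>t. (- real n * flat (Suc n) t + flat (Suc (Suc n)) t) * v)" for v
      proof -
        have "Ck_on k UNIV (\<lambda>t. (- real n * v) *\<^sub>R flat (Suc n) t + v *\<^sub>R flat (Suc (Suc n)) t)"
          by (intro Ck_on_add Ck_on_linear_compose[OF bounded_linear_scaleR_right] Suc) auto
        then show ?thesis by (simp add: algebra_simps)
      qed
    qed auto
  qed
  then show ?thesis by (simp add: smooth_on_def)
qed

lemma smooth_bump_exists:
  fixes e :: "'e::real_inner"
  assumes "r > 0"
  shows "\<exists>\<beta>::'e \<Rightarrow> real. smooth_on UNIV \<beta> \<and> \<beta> e = 1 \<and> (\<forall>y. r \<le> dist e y \<longrightarrow> \<beta> y = 0)"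
proof -
  \<comment> \<open>The squared distance is used because it is smooth at the centre too. The
    argument of \<open>flat 0\<close> is 1 at \<open>e\<close> and at most 0 from radius
    \<open>r\<close> on; the factor \<open>exp 1\<close> normalises \<open>flat 0 1\<close>.\<close>
  define \<beta> where "\<beta> y = exp 1 *\<^sub>R flat 0 (1 + (- 1 / r\<^sup>2) *\<^sub>R ((y + - e) \<bullet> (y + - e)))" for y :: 'e
  have sub: "smooth_on UNIV (\<lambda>y::'e. y + - e)"
    by (intro smooth_on_add smooth_on_const smooth_on_linear bounded_linear_ident) auto
  have "smooth_on UNIV (\<lambda>y::'e. 1 + (- 1 / r\<^sup>2) *\<^sub>R ((y + - e) \<bullet> (y + - e)))"
    by (intro smooth_on_add smooth_on_const smooth_on_linear_compose[OF bounded_linear_scaleR_right]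
        smooth_on_bilinear[OF bounded_bilinear_inner] sub) auto
  then have "smooth_on UNIV \<beta>" unfolding \<beta>_def
    by (intro smooth_on_linear_compose[OF bounded_linear_scaleR_right]
        smooth_on_compose[OF finite_dim_real _ _ _ smooth_on_flat]) auto
  moreover have "\<beta> e = 1" by (simp add: \<beta>_def flat_def exp_minus)
  moreover have "\<beta> y = 0" if "r \<le> dist e y" for y
  proof -
    have "r\<^sup>2 \<le> (y - e) \<bullet> (y - e)"
      using that assms by (simp add: dot_square_norm dist_norm norm_minus_commute power_mono)
    then show ?thesis using assms by (simp add: \<beta>_def flat_def field_simps)
  qed
  ultimately show ?thesis by blast
qed

text \<open>Compactness of the interval makes the partial derivatives at nearby points close to
  those at \<open>y\<close>, uniformly in \<open>t\<close>. The mean value inequality turns this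
  into an error bound for the linearisation that is uniform in \<open>t\<close>, and integration
  preserves it. Writing the derivative as a sum over \<open>B\<close> allows the integral to be
  taken of scalar functions only.\<close>

lemma has_derivative_integral_param:
  fixes F :: "'e::real_inner \<Rightarrow> real \<Rightarrow> real"
  assumes "open S" "y \<in> S" "finite B"
    and der: "\<And>z t. z \<in> S \<Longrightarrow> t \<in> {0..1} \<Longrightarrow>
      ((\<lambda>z. F z t) has_derivative (\<lambda>v. \<Sum>b\<in>B. (v \<bullet> b) * D b z t)) (at z)"
    and cont: "\<And>z. z \<in> S \<Longrightarrow> continuous_on {0..1} (F z)"
    and contD: "\<And>b. b \<in> B \<Longrightarrow> continuous_on (S \<times> {0..1}) (\<lambda>(z, t). D b z t)"
  shows "((\<lambda>z. integral {0..1} (F z)) has_derivative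
      (\<lambda>v. \<Sum>b\<in>B. (v \<bullet> b) * integral {0..1} (D b y))) (at y)"
  unfolding has_derivative_at_alt
proof (intro conjI allI impI)
  show "bounded_linear (\<lambda>v. \<Sum>b\<in>B. (v \<bullet> b) * integral {0..1} (D b y))"
    by (intro bounded_linear_sum bounded_linear_mult_const bounded_linear_inner_left)
  fix e :: real assume "e > 0"
  \<comment> \<open>The tolerance \<open>e / M\<close> for each partial derivative adds up to at
    most \<open>e\<close> for unit directions; the 1 keeps \<open>M\<close> positive when
    \<open>B\<close> is empty.\<close>
  define M where "M = (\<Sum>b\<in>B. norm b) + 1"
  have "M > 0" by (simp add: M_def add_nonneg_pos sum_nonneg)
  have "\<exists>d>0. ball y d \<subseteq> S \<and> (\<forall>z\<in>ball y d. \<forall>t\<in>{0..1}. \<bar>D b z t - D b y t\<bar> \<le> e / M)" if b: "b \<in> B" for b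
  proof -
    obtain X0 where X0: "y \<in> X0" "open X0" "\<forall>z\<in>X0 \<inter> S. \<forall>t\<in>{0..1}. dist (D b z t) (D b y t) \<le> e / M"
      using continuous_on_prod_compactE[OF contD[OF b] compact_Icc \<open>y \<in> S\<close>, of "e / M"] \<open>e > 0\<close> \<open>M > 0\<close>
      by auto
    obtain d where "d > 0" "ball y d \<subseteq> X0 \<inter> S"
      using X0 assms(1,2) by (metis Int_iff open_Int open_contains_ball)
    then show ?thesis using X0 by (intro exI[of _ d]) (auto simp: dist_real_def)
  qed
  then obtain d where d: "\<And>b. b \<in> B \<Longrightarrow> d b > 0 \<and> ball y (d b) \<subseteq> S \<and>
      (\<forall>z\<in>ball y (d b). \<forall>t\<in>{0..1}. \<bar>D b z t - D b y t\<bar> \<le> e / M)"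
    by metis
  obtain d0 where d0: "d0 > 0" "ball y d0 \<subseteq> S" using assms(1,2) by (metis open_contains_ball)
  \<comment> \<open>The radius \<open>d0\<close> makes the minimum well defined, and the ball a
    subset of \<open>S\<close>, even for empty \<open>B\<close>.\<close>
  define \<delta> where "\<delta> = Min (insert d0 (d ` B))"
  have \<delta>: "\<delta> > 0" "\<delta> \<le> d0" "\<And>b. b \<in> B \<Longrightarrow> \<delta> \<le> d b"
    using d d0 \<open>finite B\<close> by (auto simp: \<delta>_def)
  have inS: "z \<in> S" if "z \<in> ball y \<delta>" for z
    using that \<delta>(2) d0(2) by (auto simp: ball_def)
  have near: "\<bar>D b z t - D b y t\<bar> \<le> e / M" if "b \<in> B" "z \<in> ball y \<delta>" "t \<in> {0..1}" for b z t
    using d[OF that(1)] \<delta>(3)[OF that(1)] that by (auto simp: ball_def)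
  have contD1: "continuous_on {0..1} (D b z)" if "b \<in> B" "z \<in> S" for b z
    using continuous_on_compose2[OF contD[OF that(1)] continuous_on_Pair[OF continuous_on_const continuous_on_id],
        of z "{0..1}"] that(2) by auto
  have main: "norm (integral {0..1} (F z) - integral {0..1} (F y)
      - (\<Sum>b\<in>B. ((z - y) \<bullet> b) * integral {0..1} (D b y))) \<le> e * norm (z - y)"
    if z: "norm (z - y) < \<delta>" for z
  proof -
    have zb: "z \<in> ball y \<delta>" "y \<in> ball y \<delta>" using z \<delta>(1) by (auto simp: dist_norm norm_minus_commute)
    have pt: "norm (F z t - F y t - (\<Sum>b\<in>B. ((z - y) \<bullet> b) * D b y t)) \<le> e * norm (z - y)"
      if t: "t \<in> {0..1}" for t
    proof -
      have "norm (F z t - F y t - (\<Sum>b\<in>B. ((z - y) \<bullet> b) * D b y t)) \<le> norm (z - y) * e"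
      proof (rule differentiable_bound_linearization[where S = "ball y \<delta>"
            and f' = "\<lambda>w v. \<Sum>b\<in>B. (v \<bullet> b) * D b w t" and ?x0.0 = y and f = "\<lambda>z. F z t"])
        show "y + s *\<^sub>R (z - y) \<in> ball y \<delta>" if "s \<in> {0..1}" for s
        proof -
          have "norm (s *\<^sub>R (z - y)) \<le> norm (z - y)" using that by (simp add: mult_left_le_one_le)
          then show ?thesis using z by (simp add: dist_norm)
        qed
        show "((\<lambda>z. F z t) has_derivative (\<lambda>v. \<Sum>b\<in>B. (v \<bullet> b) * D b w t)) (at w within ball y \<delta>)"
          if "w \<in> ball y \<delta>" for w
          using der[OF inS[OF that] t] by (rule has_derivative_at_withinI)
        show "onorm ((\<lambda>v. \<Sum>b\<in>B. (v \<bullet> b) * D b w t) - (\<lambda>v. \<Sum>b\<in>B. (v \<bullet> b) * D b y t)) \<le> e"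
          if "w \<in> ball y \<delta>" for w
        proof (rule onorm_bound)
          show "0 \<le> e" using \<open>e > 0\<close> by simp
          fix v
          have "norm (((\<lambda>v. \<Sum>b\<in>B. (v \<bullet> b) * D b w t) - (\<lambda>v. \<Sum>b\<in>B. (v \<bullet> b) * D b y t)) v)
              = norm (\<Sum>b\<in>B. (v \<bullet> b) * (D b w t - D b y t))"
            by (simp add: algebra_simps sum_subtractf)
          also have "\<dots> \<le> (\<Sum>b\<in>B. (norm v * norm b) * (e / M))"
          proof (rule sum_norm_le)
            fix b assume b: "b \<in> B"
            have "norm ((v \<bullet> b) * (D b w t - D b y t)) = \<bar>v \<bullet> b\<bar> * \<bar>D b w t - D b y t\<bar>"
              by (simp add: abs_mult)
            also have "\<dots> \<le> (norm v * norm b) * (e / M)"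
              using near[OF b that t] Cauchy_Schwarz_ineq2[of v b] by (intro mult_mono) auto
            finally show "norm ((v \<bullet> b) * (D b w t - D b y t)) \<le> (norm v * norm b) * (e / M)" .
          qed
          also have "\<dots> = norm v * (e / M) * (M - 1)"
            unfolding M_def add_diff_cancel_right' sum_distrib_left
            by (intro sum.cong refl) (simp only: mult_ac)
          also have "\<dots> \<le> norm v * (e / M) * M"
            using \<open>e > 0\<close> \<open>M > 0\<close> by (intro mult_left_mono) auto
          also have "\<dots> = e * norm v" using \<open>M > 0\<close> by simp
          finally show "norm (((\<lambda>v. \<Sum>b\<in>B. (v \<bullet> b) * D b w t) - (\<lambda>v. \<Sum>b\<in>B. (v \<bullet> b) * D b y t)) v) \<le> e * norm v" .
        qed
      qed (use zb in auto)
      then show ?thesis by (simp add: mult.commute)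
    qed
    have int: "F z integrable_on {0..1}" "F y integrable_on {0..1}"
      "\<And>b. b \<in> B \<Longrightarrow> D b y integrable_on {0..1}"
      using cont contD1 inS zb by (auto intro!: integrable_continuous_real)
    have intS: "(\<lambda>t. \<Sum>b\<in>B. ((z - y) \<bullet> b) * D b y t) integrable_on {0..1}"
      using int(3) \<open>finite B\<close> by (intro integrable_sum integrable_on_mult_right)
    have "integral {0..1} (F z) - integral {0..1} (F y) - (\<Sum>b\<in>B. ((z - y) \<bullet> b) * integral {0..1} (D b y))
        = integral {0..1} (\<lambda>t. F z t - F y t - (\<Sum>b\<in>B. ((z - y) \<bullet> b) * D b y t))"
      using int intS \<open>finite B\<close>
      by (simp add: integral_diff integral_sum integrable_diff integrable_on_mult_right)
    also have "norm \<dots> \<le> (e * norm (z - y)) * (1 - 0)"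
    proof (rule integral_bound)
      show "continuous_on {0..1} (\<lambda>t. F z t - F y t - (\<Sum>b\<in>B. ((z - y) \<bullet> b) * D b y t))"
        using cont contD1 inS zb by (intro continuous_intros) auto
    qed (use pt in auto)
    finally show ?thesis by simp
  qed
  show "\<exists>d>0. \<forall>z. norm (z - y) < d \<longrightarrow> norm (integral {0..1} (F z) - integral {0..1} (F y)
      - (\<Sum>b\<in>B. ((z - y) \<bullet> b) * integral {0..1} (D b y))) \<le> e * norm (z - y)"
    using \<delta>(1) main by blast
qed

lemma smooth_on_line:
  fixes f :: "'e::real_inner \<Rightarrow> real"
  assumes "smooth_on S f" "p + t *\<^sub>R v \<in> S"
  shows "((\<lambda>t. f (p + t *\<^sub>R v)) has_real_derivative frechet_derivative f (at (p + t *\<^sub>R v)) v) (at t)"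
proof -
  let ?D = "frechet_derivative f (at (p + t *\<^sub>R v))"
  have "((\<lambda>t. f (p + t *\<^sub>R v)) has_derivative (\<lambda>s. ?D (s *\<^sub>R v))) (at t)"
    by (rule has_derivative_compose[of "\<lambda>t. p + t *\<^sub>R v" "\<lambda>s. s *\<^sub>R v" t UNIV f, OF _ smooth_on_has_derivative[OF assms]])
       (auto intro!: derivative_eq_intros)
  moreover have "?D (s *\<^sub>R v) = ?D v * s" for s
    using linear_scale[OF linear_frechet_derivative[OF smooth_on_differentiable[OF assms]]] by simp
  ultimately show ?thesis by (simp add: has_field_derivative_def)
qed

text \<open>The power of \<open>t\<close> is there for the induction on the order: each derivative
  in \<open>y\<close> brings out one more factor \<open>t\<close> by the chain rule and replaces
  \<open>q\<close> by one of its partial derivatives.\<close>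

lemma radial_integral_smooth:
  fixes q :: "'e::real_inner \<Rightarrow> real"
  assumes fd: "finite_dim TYPE('e)" and "smooth_on (ball e r) q"
  shows "smooth_on (ball e r) (\<lambda>y. integral {0..1} (\<lambda>t. t ^ n * q (e + t *\<^sub>R (y - e))))"
proof -
  have ball: "e + t *\<^sub>R (y - e) \<in> ball e r" if "y \<in> ball e r" "t \<in> {0..1}" for y t
  proof -
    have "norm (t *\<^sub>R (y - e)) \<le> norm (y - e)" using that(2) by (simp add: mult_left_le_one_le)
    then show ?thesis using that(1) by (simp add: dist_norm norm_minus_commute)
  qed
  have cont: "continuous_on (ball e r \<times> {0..1}) (\<lambda>(y, t). t ^ n * q (e + t *\<^sub>R (y - e)))"
    if "smooth_on (ball e r) q" for n and q :: "'e \<Rightarrow> real"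
    unfolding split_beta
    by (intro continuous_intros continuous_on_compose2[OF smooth_on_continuous[OF that]])
       (use ball in auto)
  have "Ck_on k (ball e r) (\<lambda>y. integral {0..1} (\<lambda>t. t ^ n * q (e + t *\<^sub>R (y - e))))"
    if "smooth_on (ball e r) q" for k n and q :: "'e \<Rightarrow> real"
    using that
  proof (induction k arbitrary: n q)
    case 0
    show ?case
      using integral_continuous_on_param[of "ball e r" "0::real" 1, unfolded cbox_interval, OF cont[OF 0]] by simp
  next
    case (Suc k)
    let ?D = "\<lambda>b y. frechet_derivative q (at y) b"
    show ?case
    proof (rule Ck_on_SucI[where f' = "\<lambda>y v. \<Sum>b\<in>onb. (v \<bullet> b) * integral {0..1} (\<lambda>t. t ^ Suc n * ?D b (e + t *\<^sub>R (y - e)))"])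
      fix y assume y: "y \<in> ball e r"
      show "((\<lambda>y. integral {0..1} (\<lambda>t. t ^ n * q (e + t *\<^sub>R (y - e)))) has_derivative
          (\<lambda>v. \<Sum>b\<in>onb. (v \<bullet> b) * integral {0..1} (\<lambda>t. t ^ Suc n * ?D b (e + t *\<^sub>R (y - e))))) (at y)"
      proof (rule has_derivative_integral_param[OF open_ball y finite_onb[OF fd]])
        fix z and t :: real assume z: "z \<in> ball e r" and t: "t \<in> {0..1}"
        let ?w = "e + t *\<^sub>R (z - e)"
        have dq: "(q has_derivative (\<lambda>v. frechet_derivative q (at ?w) v)) (at ?w)"
          using Suc.prems ball[OF z t] by (rule smooth_on_has_derivative)
        have "((\<lambda>z. t ^ n * q (e + t *\<^sub>R (z - e))) has_derivative
            (\<lambda>v. t ^ n * frechet_derivative q (at ?w) (t *\<^sub>R v))) (at z)"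
          by (rule has_derivative_mult_right,
              rule has_derivative_compose[of "\<lambda>z. e + t *\<^sub>R (z - e)" "\<lambda>v. t *\<^sub>R v" z UNIV q, OF _ dq])
             (auto intro!: derivative_eq_intros)
        moreover have "t ^ n * frechet_derivative q (at ?w) (t *\<^sub>R v) = (\<Sum>b\<in>onb. (v \<bullet> b) * (t ^ Suc n * ?D b ?w))" for v
        proof -
          have l: "linear (frechet_derivative q (at ?w))"
            using dq by (rule has_derivative_linear)
          have "frechet_derivative q (at ?w) (t *\<^sub>R v) = t * (\<Sum>b\<in>onb. (v \<bullet> b) *\<^sub>R ?D b ?w)"
            using linear_onb_expand[OF fd l, of v] by (simp add: linear_scale[OF l])
          then show ?thesis by (simp add: sum_distrib_left mult_ac)
        qed
        ultimately show "((\<lambda>z. t ^ n * q (e + t *\<^sub>R (z - e))) has_derivative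
            (\<lambda>v. \<Sum>b\<in>onb. (v \<bullet> b) * (t ^ Suc n * ?D b (e + t *\<^sub>R (z - e))))) (at z)"
          by simp
      next
        show "continuous_on {0..1} (\<lambda>t. t ^ n * q (e + t *\<^sub>R (z - e)))" if "z \<in> ball e r" for z
          using continuous_on_compose2[OF cont[OF Suc.prems, of n]
              continuous_on_Pair[OF continuous_on_const continuous_on_id], of z "{0..1}"] that by (simp add: image_subset_iff)
        show "continuous_on (ball e r \<times> {0..1}) (\<lambda>(z, t). t ^ Suc n * ?D b (e + t *\<^sub>R (z - e)))" for b
          using cont[OF smooth_on_frechet[OF Suc.prems]] .
      qed
    next
      fix v :: 'e
      have "Ck_on k (ball e r) (\<lambda>y. \<Sum>b\<in>onb. (v \<bullet> b) *\<^sub>R integral {0..1} (\<lambda>t. t ^ Suc n * ?D b (e + t *\<^sub>R (y - e))))"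
        by (intro Ck_on_sum Ck_on_linear_compose[OF bounded_linear_scaleR_right] Suc.IH
            smooth_on_frechet Suc.prems open_ball)
      then show "Ck_on k (ball e r) (\<lambda>y. \<Sum>b\<in>onb. (v \<bullet> b) * integral {0..1} (\<lambda>t. t ^ Suc n * ?D b (e + t *\<^sub>R (y - e))))"
        by simp
    qed simp
  qed
  then show ?thesis using assms(2) by (simp add: smooth_on_def)
qed

text \<open>Integrate the derivative of \<open>f\<close> along the segment from \<open>e\<close> to
  \<open>y\<close> and expand the direction \<open>y - e\<close> in \<open>onb\<close>. The point is
  that the factors \<open>g b\<close> are again smooth, so that a derivation can be applied to the
  products.\<close>

lemma hadamard:
  fixes f :: "'e::real_inner \<Rightarrow> real"
  assumes fd: "finite_dim TYPE('e)" and f: "smooth_on (ball e r) f"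
  shows "\<exists>g. (\<forall>b. smooth_on (ball e r) (g b) \<and> g b e = frechet_derivative f (at e) b) \<and>
      (\<forall>y\<in>ball e r. f y = f e + (\<Sum>b\<in>onb. ((y - e) \<bullet> b) * g b y))"
proof -
  \<comment> \<open>The factor \<open>t ^ 0\<close> only gives the integrand the shape of
    \<open>radial_integral_smooth\<close>.\<close>
  define g where "g b y = integral {0..1} (\<lambda>t. t ^ 0 * frechet_derivative f (at (e + t *\<^sub>R (y - e))) b)" for b y
  have "smooth_on (ball e r) (g b)" for b
    unfolding g_def by (rule radial_integral_smooth[OF fd smooth_on_frechet[OF f]])
  moreover have "g b e = frechet_derivative f (at e) b" for b
    by (simp add: g_def)
  moreover have "f y = f e + (\<Sum>b\<in>onb. ((y - e) \<bullet> b) * g b y)" if y: "y \<in> ball e r" for y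
  proof -
    have ball: "e + t *\<^sub>R (y - e) \<in> ball e r" if "t \<in> {0..1}" for t
    proof -
      have "norm (t *\<^sub>R (y - e)) \<le> norm (y - e)" using that by (simp add: mult_left_le_one_le)
      then show ?thesis using y by (simp add: dist_norm norm_minus_commute)
    qed
    let ?D = "\<lambda>t. frechet_derivative f (at (e + t *\<^sub>R (y - e)))"
    have "((\<lambda>t. ?D t (y - e)) has_integral (f (e + 1 *\<^sub>R (y - e)) - f (e + 0 *\<^sub>R (y - e)))) {0..1}"
    proof (rule fundamental_theorem_of_calculus)
      show "((\<lambda>t. f (e + t *\<^sub>R (y - e))) has_vector_derivative ?D t (y - e)) (at t within {0..1})"
        if "t \<in> {0..1}" for t
        using smooth_on_line[OF f ball[OF that]]
        by (simp add: has_field_derivative_at_within flip: has_real_derivative_iff_has_vector_derivative)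
    qed simp
    then have "f y - f e = integral {0..1} (\<lambda>t. ?D t (y - e))"
      by (simp add: integral_unique)
    also have "\<dots> = integral {0..1} (\<lambda>t. \<Sum>b\<in>onb. ((y - e) \<bullet> b) * ?D t b)"
    proof (rule integral_cong)
      show "?D t (y - e) = (\<Sum>b\<in>onb. ((y - e) \<bullet> b) * ?D t b)" if "t \<in> {0..1}" for t
        using linear_onb_expand[OF fd linear_frechet_derivative[OF smooth_on_differentiable[OF f ball[OF that]]], of "y - e"]
        by simp
    qed
    also have "\<dots> = (\<Sum>b\<in>onb. ((y - e) \<bullet> b) * integral {0..1} (\<lambda>t. ?D t b))"
    proof -
      have "continuous_on {0..1} (\<lambda>t. ?D t b)" for b
        by (rule continuous_on_compose2[OF smooth_on_continuous[OF smooth_on_frechet[OF f]]])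
           (use ball in \<open>auto intro!: continuous_intros\<close>)
      then show ?thesis
        by (subst integral_sum)
           (auto simp: finite_onb[OF fd] intro!: continuous_intros integrable_continuous_real)
    qed
    finally show ?thesis by (simp add: g_def)
  qed
  ultimately show ?thesis by blast
qed

text \<open>The left side is symmetric in \<open>u\<close> and \<open>v\<close>, so the same number
  is expressed by either order of differentiation.\<close>

lemma second_difference:
  fixes f :: "'e::real_inner \<Rightarrow> real"
  assumes f: "smooth_on S f" and "s > 0"
    and S: "\<And>a b. a \<in> {0..s} \<Longrightarrow> b \<in> {0..s} \<Longrightarrow> x + a *\<^sub>R u + b *\<^sub>R v \<in> S"
  shows "\<exists>a\<in>{0..s}. \<exists>b\<in>{0..s}. f (x + s *\<^sub>R u + s *\<^sub>R v) - f (x + s *\<^sub>R u) - f (x + s *\<^sub>R v) + f x =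
    s * s * frechet_derivative (\<lambda>y. frechet_derivative f (at y) v) (at (x + a *\<^sub>R u + b *\<^sub>R v)) u"
proof -
  \<comment> \<open>The second difference is the increment of \<phi> over the interval from 0 to
    \<open>s\<close>. One mean value theorem in direction \<open>v\<close> and a second one in
    direction \<open>u\<close> evaluate it.\<close>
  define \<phi> where "\<phi> t = f ((x + s *\<^sub>R u) + t *\<^sub>R v) - f (x + t *\<^sub>R v)" for t
  define q where "q y = frechet_derivative f (at y) v" for y
  have q: "smooth_on S q" unfolding q_def by (rule smooth_on_frechet[OF f])
  have S0: "x + b *\<^sub>R v \<in> S" if "b \<in> {0..s}" for b
    using S[of 0 b] that \<open>s > 0\<close> by simp
  have "(\<phi> has_real_derivative q ((x + s *\<^sub>R u) + t *\<^sub>R v) - q (x + t *\<^sub>R v)) (at t)" if "0 \<le> t" "t \<le> s" for t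
    unfolding \<phi>_def q_def using that \<open>s > 0\<close> by (intro DERIV_diff smooth_on_line[OF f] S S0) auto
  from MVT2[OF \<open>s > 0\<close> this] obtain b where b: "0 < b" "b < s"
    "\<phi> s - \<phi> 0 = (s - 0) * (q ((x + s *\<^sub>R u) + b *\<^sub>R v) - q (x + b *\<^sub>R v))" by blast
  have "((\<lambda>t. q ((x + b *\<^sub>R v) + t *\<^sub>R u)) has_real_derivative
      frechet_derivative q (at ((x + b *\<^sub>R v) + t *\<^sub>R u)) u) (at t)" if "0 \<le> t" "t \<le> s" for t
    using that b S[of t b] by (intro smooth_on_line[OF q]) (simp add: add_ac)
  from MVT2[OF \<open>s > 0\<close> this] obtain a where a: "0 < a" "a < s"
    "q ((x + b *\<^sub>R v) + s *\<^sub>R u) - q ((x + b *\<^sub>R v) + 0 *\<^sub>R u) =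
      (s - 0) * frechet_derivative q (at ((x + b *\<^sub>R v) + a *\<^sub>R u)) u" by blast
  have "\<phi> s - \<phi> 0 = s * s * frechet_derivative q (at (x + a *\<^sub>R u + b *\<^sub>R v)) u"
    using a(3) b(3) by (simp add: add_ac)
  then show ?thesis
    using a b by (intro bexI[of _ a] bexI[of _ b]) (auto simp: \<phi>_def q_def[abs_def])
qed

text \<open>Both orders of differentiation equal the same second difference divided by
  \<open>s * s\<close>, at points that tend to \<open>x\<close> with \<open>s\<close>; continuity of
  the second derivatives does the rest.\<close>

lemma mixed_derivatives_commute:
  fixes f :: "'e::real_inner \<Rightarrow> real"
  assumes "open S" "x \<in> S" and f: "smooth_on S f"
  shows "frechet_derivative (\<lambda>y. frechet_derivative f (at y) v) (at x) u =
    frechet_derivative (\<lambda>y. frechet_derivative f (at y) u) (at x) v"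
proof -
  define h where "h u v y = frechet_derivative (\<lambda>y. frechet_derivative f (at y) v) (at y) u" for u v y
  have cont: "isCont (h u v) x" for u v
    using smooth_on_continuous[OF smooth_on_frechet[OF smooth_on_frechet[OF f]]] assms(1,2)
    unfolding h_def[abs_def] by (metis continuous_on_eq_continuous_at)
  have "\<bar>h u v x - h v u x\<bar> < e" if "e > 0" for e
  proof -
    have "eventually (\<lambda>y. dist (h u v y) (h u v x) < e / 2 \<and> dist (h v u y) (h v u x) < e / 2 \<and> y \<in> S) (nhds x)"
      using cont[of u v] cont[of v u] \<open>e > 0\<close> assms(1,2)
      by (intro eventually_conj tendstoD eventually_nhds_in_open) (auto simp: isCont_def
          tendsto_at_iff_tendsto_nhds)
    then obtain d where d: "d > 0" "\<And>y. dist y x < d \<Longrightarrow>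
        dist (h u v y) (h u v x) < e / 2 \<and> dist (h v u y) (h v u x) < e / 2 \<and> y \<in> S"
      by (auto simp: eventually_nhds_metric)
    \<comment> \<open>Chosen so that the whole parallelogram spanned by \<open>s *\<^sub>R u\<close>
      and \<open>s *\<^sub>R v\<close> stays within \<open>d / 2\<close> of \<open>x\<close>. The 1
      avoids division by zero.\<close>
    define s where "s = d / 2 / (norm u + norm v + 1)"
    have pos: "norm u + norm v + 1 > 0" by (simp add: add_nonneg_pos)
    have "s > 0" using d(1) pos by (simp add: s_def)
    have near: "dist (x + a *\<^sub>R u + b *\<^sub>R v) x < d" if "a \<in> {0..s}" "b \<in> {0..s}" for a b
    proof -
      have "norm (a *\<^sub>R u + b *\<^sub>R v) \<le> \<bar>a\<bar> * norm u + \<bar>b\<bar> * norm v"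
        by (metis norm_scaleR norm_triangle_ineq)
      also have "\<dots> \<le> s * norm u + s * norm v"
        using that by (intro add_mono mult_right_mono) auto
      also have "\<dots> \<le> s * (norm u + norm v + 1)" using \<open>s > 0\<close> by (simp add: algebra_simps)
      also have "\<dots> = d / 2" using pos by (metis s_def less_irrefl nonzero_eq_divide_eq)
      finally show ?thesis using d(1) by (simp add: dist_norm add.assoc)
    qed
    have inS: "x + a *\<^sub>R u + b *\<^sub>R v \<in> S" if "a \<in> {0..s}" "b \<in> {0..s}" for a b
      using near[OF that] d(2) by blast
    obtain a b where ab: "a \<in> {0..s}" "b \<in> {0..s}"
      "f (x + s *\<^sub>R u + s *\<^sub>R v) - f (x + s *\<^sub>R u) - f (x + s *\<^sub>R v) + f x = s * s * h u v (x + a *\<^sub>R u + b *\<^sub>R v)"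
      using second_difference[OF f \<open>s > 0\<close> inS] unfolding h_def by blast
    have inS': "x + a *\<^sub>R v + b *\<^sub>R u \<in> S" if "a \<in> {0..s}" "b \<in> {0..s}" for a b
      using inS[OF that(2,1)] by (simp add: add_ac)
    obtain a' b' where ab': "a' \<in> {0..s}" "b' \<in> {0..s}"
      "f (x + s *\<^sub>R v + s *\<^sub>R u) - f (x + s *\<^sub>R v) - f (x + s *\<^sub>R u) + f x = s * s * h v u (x + a' *\<^sub>R v + b' *\<^sub>R u)"
      using second_difference[OF f \<open>s > 0\<close> inS'] unfolding h_def by blast
    have "s * s * h u v (x + a *\<^sub>R u + b *\<^sub>R v) = s * s * h v u (x + b' *\<^sub>R u + a' *\<^sub>R v)"
      using ab(3) ab'(3) by (simp add: add.commute add.left_commute algebra_simps)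
    then have "h u v (x + a *\<^sub>R u + b *\<^sub>R v) = h v u (x + b' *\<^sub>R u + a' *\<^sub>R v)"
      using \<open>s > 0\<close> by simp
    moreover have "dist (h u v (x + a *\<^sub>R u + b *\<^sub>R v)) (h u v x) < e / 2"
      using d(2)[OF near[OF ab(1,2)]] by blast
    moreover have "dist (h v u (x + b' *\<^sub>R u + a' *\<^sub>R v)) (h v u x) < e / 2"
      using d(2)[OF near[OF ab'(2,1)]] by blast
    ultimately show ?thesis unfolding dist_real_def by linarith
  qed
  \<comment> \<open>With the discrepancy itself as tolerance, a nonzero discrepancy would be smaller
    than itself.\<close>
  from this[of "\<bar>h u v x - h v u x\<bar>"] have "h u v x = h v u x"
    by force
  then show ?thesis by (simp add: h_def)
qed

section \<open>Manifolds and local smoothness\<close>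

text \<open>Split off from \<open>smooth_manifold\<close> so that model spaces, products and the
  total space of the dual bundle come under one predicate. The Hausdorff property is a separate
  assumption of the lemmas on bump functions and on tangent vectors.\<close>

definition mfd :: "('p, 'e::real_inner) atlas \<Rightarrow> bool" where
  "mfd \<A> \<longleftrightarrow> finite_dim TYPE('e) \<and> is_atlas \<A>"

text \<open>With this atlas on the model spaces, smooth functions and charts are smooth maps of manifolds.\<close>

definition model :: "('e, 'e::real_inner) atlas" where
  "model = {(UNIV, id)}"

lemma mfd_finite_dim: "mfd (\<A> :: ('p, 'e::real_inner) atlas) \<Longrightarrow> finite_dim TYPE('e)"
  by (simp add: mfd_def)

lemma smooth_manifold_mfd: "smooth_manifold \<A> \<Longrightarrow> mfd \<A>"
  by (simp add: smooth_manifold_def mfd_def)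

lemma chart_inj: "mfd \<A> \<Longrightarrow> (U, \<kappa>) \<in> \<A> \<Longrightarrow> inj_on \<kappa> U"
  by (auto simp: mfd_def is_atlas_def)

lemma chart_transition:
  assumes "mfd \<A>" "(U, \<kappa>) \<in> \<A>" "(V, \<mu>) \<in> \<A>"
  shows "open (\<kappa> ` (U \<inter> V))" "smooth_on (\<kappa> ` (U \<inter> V)) (\<mu> \<circ> inv_into U \<kappa>)"
  using assms unfolding mfd_def is_atlas_def by blast+

lemma chart_subset_pts: "(U, \<kappa>) \<in> \<A> \<Longrightarrow> U \<subseteq> pts \<A>"
  by (auto simp: pts_def)

lemma pts_chart: "p \<in> pts \<A> \<Longrightarrow> \<exists>U \<kappa>. (U, \<kappa>) \<in> \<A> \<and> p \<in> U"
  by (auto simp: pts_def)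

text \<open>The description of the open sets in \<open>mtop\<close> becomes available only after the
  predicate is shown to be a topology. For intersections this rests on the injectivity of the
  charts.\<close>

lemma openin_mtop:
  assumes "mfd \<A>"
  shows "openin (mtop \<A>) W \<longleftrightarrow> W \<subseteq> pts \<A> \<and> (\<forall>(U, \<kappa>)\<in>\<A>. open (\<kappa> ` (U \<inter> W)))"
proof -
  let ?P = "\<lambda>W. W \<subseteq> pts \<A> \<and> (\<forall>(U, \<kappa>)\<in>\<A>. open (\<kappa> ` (U \<inter> W)))"
  have "istopology ?P"
    unfolding istopology_def
  proof (intro conjI allI impI)
    fix S T assume ST: "?P S" "?P T"
    have "open (\<kappa> ` (U \<inter> (S \<inter> T)))" if "(U, \<kappa>) \<in> \<A>" for U \<kappa>
    proof -
      have "\<kappa> ` (U \<inter> (S \<inter> T)) = \<kappa> ` (U \<inter> S) \<inter> \<kappa> ` (U \<inter> T)"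
        using chart_inj[OF assms that] by (auto simp: inj_on_def)
      then show ?thesis using ST that by auto
    qed
    with ST show "S \<inter> T \<subseteq> pts \<A>" "\<forall>(U, \<kappa>)\<in>\<A>. open (\<kappa> ` (U \<inter> (S \<inter> T)))" by auto
  next
    fix \<K> assume K: "\<forall>K\<in>\<K>. ?P K"
    then show "\<Union>\<K> \<subseteq> pts \<A>" by blast
    have "open (\<kappa> ` (U \<inter> \<Union>\<K>))" if "(U, \<kappa>) \<in> \<A>" for U \<kappa>
    proof -
      have "\<kappa> ` (U \<inter> \<Union>\<K>) = (\<Union>K\<in>\<K>. \<kappa> ` (U \<inter> K))" by blast
      moreover have "open (\<kappa> ` (U \<inter> K))" if "K \<in> \<K>" for K
        using K that \<open>(U, \<kappa>) \<in> \<A>\<close> by blast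
      ultimately show ?thesis by auto
    qed
    then show "\<forall>(U, \<kappa>)\<in>\<A>. open (\<kappa> ` (U \<inter> \<Union>\<K>))" by blast
  qed
  then show ?thesis unfolding mtop_def using topology_inverse'[of ?P] by simp
qed

lemma chart_openin: "mfd \<A> \<Longrightarrow> (U, \<kappa>) \<in> \<A> \<Longrightarrow> openin (mtop \<A>) U"
  using chart_transition(1)[of \<A>] chart_subset_pts[of U \<kappa> \<A>]
  by (auto simp: openin_mtop Int_commute)

lemma topspace_mtop: "mfd \<A> \<Longrightarrow> topspace (mtop \<A>) = pts \<A>"
proof (intro equalityI subsetI)
  assume A: "mfd \<A>"
  show "p \<in> pts \<A>" if "p \<in> topspace (mtop \<A>)" for p
    using that A openin_mtop[OF A, of "topspace (mtop \<A>)"] by auto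
  show "p \<in> topspace (mtop \<A>)" if "p \<in> pts \<A>" for p
    using pts_chart[OF that] chart_openin[OF A] openin_subset by blast
qed

lemma open_chart_image:
  assumes "mfd \<A>" "(U, \<kappa>) \<in> \<A>" "openin (mtop \<A>) N" "N \<subseteq> U"
  shows "open (\<kappa> ` N)"
proof -
  have "open (\<kappa> ` (U \<inter> N))" using assms(2,3) by (auto simp: openin_mtop[OF assms(1)])
  then show ?thesis using assms(4) by (simp add: inf.absorb2)
qed

text \<open>Continuity of a chart: seen in any other chart, the set is a preimage under a transition
  map.\<close>

lemma openin_chart_preimage:
  assumes A: "mfd \<A>" "(U, \<kappa>) \<in> \<A>" and "open S"
  shows "openin (mtop \<A>) {q \<in> U. \<kappa> q \<in> S}"
  unfolding openin_mtop[OF A(1)]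
proof (intro conjI ballI, safe)
  show "q \<in> pts \<A>" if "q \<in> U" for q using that chart_subset_pts[OF A(2)] by auto
  fix V \<mu> assume V: "(V, \<mu>) \<in> \<A>"
  have inj: "inj_on \<mu> V" using A(1) V by (rule chart_inj)
  note tr = chart_transition[OF A(1) V A(2)]
  have "\<mu> ` (V \<inter> {q \<in> U. \<kappa> q \<in> S}) = \<mu> ` (V \<inter> U) \<inter> (\<kappa> \<circ> inv_into V \<mu>) -` S"
    using inj by (auto simp: image_iff)
  then show "open (\<mu> ` (V \<inter> {q \<in> U. \<kappa> q \<in> S}))"
    using continuous_open_preimage[OF smooth_on_continuous[OF tr(2)] tr(1) \<open>open S\<close>] by simp
qed

lemma mfd_model: "finite_dim TYPE('e::real_inner) \<Longrightarrow> mfd (model :: ('e, 'e) atlas)"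
  using smooth_on_linear[OF bounded_linear_ident, of UNIV]
  by (auto simp: mfd_def model_def is_atlas_def id_def comp_def)

lemma model_chart: "(UNIV, id) \<in> model"
  by (simp add: model_def)

lemma pts_model: "pts model = UNIV"
  by (auto simp: pts_def model_def)

lemma openin_model:
  fixes S :: "'e::real_inner set"
  assumes "finite_dim TYPE('e)"
  shows "openin (mtop model) S \<longleftrightarrow> open S"
  by (simp add: openin_mtop[OF mfd_model[OF assms]] pts_model) (simp add: model_def)

text \<open>A pointwise notion with continuity built in: a whole neighbourhood \<open>N\<close> must
  be mapped into one chart of the target. It suits maps that are smooth only near a point, such as
  charts and trivialisations.\<close>

definition smooth_at ::
  "('p, 'e::real_inner) atlas \<Rightarrow> ('q, 'f::real_inner) atlas \<Rightarrow> ('p \<Rightarrow> 'q) \<Rightarrow> 'p \<Rightarrow> bool" where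
  "smooth_at \<A> \<B> h p \<longleftrightarrow> (\<exists>U \<kappa> V \<mu> N. (U, \<kappa>) \<in> \<A> \<and> (V, \<mu>) \<in> \<B> \<and> openin (mtop \<A>) N \<and> p \<in> N \<and>
     N \<subseteq> U \<and> h ` N \<subseteq> V \<and> smooth_on (\<kappa> ` N) (\<mu> \<circ> h \<circ> inv_into U \<kappa>))"

lemma smooth_atI:
  "(U, \<kappa>) \<in> \<A> \<Longrightarrow> (V, \<mu>) \<in> \<B> \<Longrightarrow> openin (mtop \<A>) N \<Longrightarrow> p \<in> N \<Longrightarrow> N \<subseteq> U \<Longrightarrow> h ` N \<subseteq> V \<Longrightarrow>
    smooth_on (\<kappa> ` N) (\<mu> \<circ> h \<circ> inv_into U \<kappa>) \<Longrightarrow> smooth_at \<A> \<B> h p"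
  unfolding smooth_at_def by blast

lemma smooth_at_pts: "mfd \<A> \<Longrightarrow> smooth_at \<A> \<B> h p \<Longrightarrow> p \<in> pts \<A> \<and> h p \<in> pts \<B>"
  unfolding smooth_at_def by (fastforce dest: chart_subset_pts)

lemma smooth_at_open:
  "smooth_at \<A> \<B> h p \<Longrightarrow> \<exists>N. openin (mtop \<A>) N \<and> p \<in> N \<and> (\<forall>q\<in>N. smooth_at \<A> \<B> h q)"
  by (metis smooth_atI smooth_at_def)

text \<open>Recovers continuity of \<open>h\<close> on \<open>N\<close> from its expression in
  coordinates, where openness of preimages is known.\<close>

lemma openin_local_preimage:
  assumes "mfd \<A>" "mfd \<B>" "(U, \<kappa>) \<in> \<A>" "(V, \<mu>) \<in> \<B>" "openin (mtop \<A>) N" "N \<subseteq> U" "h ` N \<subseteq> V"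
    and sm: "smooth_on (\<kappa> ` N) (\<mu> \<circ> h \<circ> inv_into U \<kappa>)" and "openin (mtop \<B>) N'"
  shows "openin (mtop \<A>) {q \<in> N. h q \<in> N'}"
proof -
  have inj: "inj_on \<kappa> U" "inj_on \<mu> V" using assms chart_inj by blast+
  have "open (\<mu> ` (V \<inter> N'))"
    using assms(2,4,9) openin_mtop[OF assms(2)] by blast
  then have "open (\<kappa> ` N \<inter> (\<mu> \<circ> h \<circ> inv_into U \<kappa>) -` (\<mu> ` (V \<inter> N')))"
    by (rule continuous_open_preimage[OF smooth_on_continuous[OF sm] open_chart_image[OF assms(1,3,5,6)]])
  from openin_chart_preimage[OF assms(1,3) this]
  have "openin (mtop \<A>) {q \<in> U. \<kappa> q \<in> \<kappa> ` N \<inter> (\<mu> \<circ> h \<circ> inv_into U \<kappa>) -` (\<mu> ` (V \<inter> N'))}" .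
  also have "{q \<in> U. \<kappa> q \<in> \<kappa> ` N \<inter> (\<mu> \<circ> h \<circ> inv_into U \<kappa>) -` (\<mu> ` (V \<inter> N'))} = {q \<in> N. h q \<in> N'}"
    (is "?l = ?r")
  proof (intro equalityI subsetI)
    fix q assume q: "q \<in> ?l"
    then have "q \<in> N" using inj(1) assms(6) by (auto simp: inj_on_def)
    moreover have "\<mu> (h q) \<in> \<mu> ` (V \<inter> N')"
      using q inj(1) \<open>q \<in> N\<close> assms(6) by auto
    then obtain r where "r \<in> V" "r \<in> N'" "\<mu> (h q) = \<mu> r" by blast
    ultimately show "q \<in> ?r" using inj(2) assms(7) by (auto simp: inj_on_def image_subset_iff)
  next
    fix q assume q: "q \<in> ?r"
    then have "inv_into U \<kappa> (\<kappa> q) = q" using inj(1) assms(6) by auto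
    then show "q \<in> ?l" using q assms(6,7) by auto
  qed
  finally show ?thesis .
qed

text \<open>The charts that witness \<open>smooth_at\<close> can be exchanged for any others around
  the two points: compose with transition maps on both sides and shrink the neighbourhood.\<close>

lemma smooth_at_charts:
  assumes AB: "mfd \<A>" "mfd \<B>" and h: "smooth_at \<A> \<B> h p"
    and U: "(U, \<kappa>) \<in> \<A>" "p \<in> U" and V: "(V, \<mu>) \<in> \<B>" "h p \<in> V"
  obtains N where "openin (mtop \<A>) N" "p \<in> N" "N \<subseteq> U" "h ` N \<subseteq> V"
    "smooth_on (\<kappa> ` N) (\<mu> \<circ> h \<circ> inv_into U \<kappa>)"
proof -
  obtain U0 \<kappa>0 V0 \<mu>0 N0 where 0: "(U0, \<kappa>0) \<in> \<A>" "(V0, \<mu>0) \<in> \<B>" "openin (mtop \<A>) N0" "p \<in> N0"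
    "N0 \<subseteq> U0" "h ` N0 \<subseteq> V0" "smooth_on (\<kappa>0 ` N0) (\<mu>0 \<circ> h \<circ> inv_into U0 \<kappa>0)"
    using h unfolding smooth_at_def by blast
  define N where "N = {q \<in> N0. h q \<in> V} \<inter> U"
  have N: "openin (mtop \<A>) N"
    unfolding N_def by (intro openin_Int openin_local_preimage[OF AB 0(1,2,3,5,6,7)] chart_openin[OF AB(2) V(1)]
        chart_openin[OF AB(1) U(1)])
  have inj: "inj_on \<kappa> U" "inj_on \<kappa>0 U0" "inj_on \<mu> V" "inj_on \<mu>0 V0"
    using AB U V 0 chart_inj by blast+
  have op: "open (\<kappa> ` N)" "open (\<kappa>0 ` N0)" "open (\<mu>0 ` (V0 \<inter> V))"
    using open_chart_image[OF AB(1) U(1) N] open_chart_image[OF AB(1) 0(1,3,5)]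
      chart_transition(1)[OF AB(2) 0(2) V(1)] by (auto simp: N_def)
  have 1: "smooth_on (\<kappa> ` N) (\<kappa>0 \<circ> inv_into U \<kappa>)"
    using chart_transition(2)[OF AB(1) U(1) 0(1)] by (rule smooth_on_mono) (use 0 in \<open>auto simp: N_def\<close>)
  have 2: "smooth_on (\<kappa> ` N) (\<lambda>y. (\<mu>0 \<circ> h \<circ> inv_into U0 \<kappa>0) ((\<kappa>0 \<circ> inv_into U \<kappa>) y))"
    by (rule smooth_on_compose[OF mfd_finite_dim[OF AB(1)] op(1,2) 1 0(7)])
       (use inj in \<open>auto simp: N_def\<close>)
  have "smooth_on (\<kappa> ` N) (\<lambda>y. (\<mu> \<circ> inv_into V0 \<mu>0) ((\<mu>0 \<circ> h \<circ> inv_into U0 \<kappa>0) ((\<kappa>0 \<circ> inv_into U \<kappa>) y)))"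
    by (rule smooth_on_compose[OF mfd_finite_dim[OF AB(2)] op(1,3) 2 chart_transition(2)[OF AB(2) 0(2) V(1)]])
       (use inj 0 in \<open>auto simp: N_def image_subset_iff\<close>)
  also have "?this \<longleftrightarrow> smooth_on (\<kappa> ` N) (\<mu> \<circ> h \<circ> inv_into U \<kappa>)"
  proof (rule smooth_on_cong[OF op(1)])
    fix y assume "y \<in> \<kappa> ` N"
    then obtain q where q: "q \<in> N" "y = \<kappa> q" by blast
    then have "q \<in> U" "q \<in> N0" "q \<in> U0" "h q \<in> V0" using 0 by (auto simp: N_def)
    then show "(\<mu> \<circ> inv_into V0 \<mu>0) ((\<mu>0 \<circ> h \<circ> inv_into U0 \<kappa>0) ((\<kappa>0 \<circ> inv_into U \<kappa>) y)) =
        (\<mu> \<circ> h \<circ> inv_into U \<kappa>) y"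
      using inj q by simp
  qed
  finally show thesis
    using N that 0(4) U(2) V(2) by (auto simp: N_def)
qed

lemma smooth_at_compose:
  assumes ABC: "mfd \<A>" "mfd \<B>" "mfd \<C>"
    and h: "smooth_at \<A> \<B> h p" and k: "smooth_at \<B> \<C> k (h p)"
  shows "smooth_at \<A> \<C> (\<lambda>q. k (h q)) p"
proof -
  obtain V \<mu> W \<nu> N' where k': "(V, \<mu>) \<in> \<B>" "(W, \<nu>) \<in> \<C>" "openin (mtop \<B>) N'" "h p \<in> N'"
    "N' \<subseteq> V" "k ` N' \<subseteq> W" "smooth_on (\<mu> ` N') (\<nu> \<circ> k \<circ> inv_into V \<mu>)"
    using k unfolding smooth_at_def by blast
  obtain U \<kappa> where U: "(U, \<kappa>) \<in> \<A>" "p \<in> U"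
    using smooth_at_pts[OF ABC(1) h] pts_chart by metis
  have "h p \<in> V" using k' by auto
  obtain N where N: "openin (mtop \<A>) N" "p \<in> N" "N \<subseteq> U" "h ` N \<subseteq> V"
    "smooth_on (\<kappa> ` N) (\<mu> \<circ> h \<circ> inv_into U \<kappa>)"
    using smooth_at_charts[OF ABC(1,2) h U k'(1) \<open>h p \<in> V\<close>] .
  define M where "M = {q \<in> N. h q \<in> N'}"
  have M: "openin (mtop \<A>) M"
    unfolding M_def by (rule openin_local_preimage[OF ABC(1,2) U(1) k'(1) N(1,3,4,5) k'(3)])
  have inj: "inj_on \<kappa> U" "inj_on \<mu> V" using ABC U k' chart_inj by blast+
  have op: "open (\<kappa> ` M)" "open (\<mu> ` N')"
    using open_chart_image[OF ABC(1) U(1) M] open_chart_image[OF ABC(2) k'(1,3,5)] N by (auto simp: M_def)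
  have "smooth_on (\<kappa> ` M) (\<lambda>y. (\<nu> \<circ> k \<circ> inv_into V \<mu>) ((\<mu> \<circ> h \<circ> inv_into U \<kappa>) y))"
    by (rule smooth_on_compose[OF mfd_finite_dim[OF ABC(2)] op smooth_on_mono[OF N(5)] k'(7)])
       (use inj N in \<open>auto simp: M_def subset_iff\<close>)
  also have "?this \<longleftrightarrow> smooth_on (\<kappa> ` M) (\<nu> \<circ> (\<lambda>q. k (h q)) \<circ> inv_into U \<kappa>)"
    by (rule smooth_on_cong[OF op(1)]) (use inj N in \<open>auto simp: M_def subset_iff image_subset_iff\<close>)
  finally show ?thesis
    using N k' by (intro smooth_atI[OF U(1) k'(2) M]) (auto simp: M_def)
qed

lemma smooth_at_cong:
  assumes A: "mfd \<A>" and f: "smooth_at \<A> \<B> f p" and N: "openin (mtop \<A>) N" "p \<in> N"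
    and eq: "\<And>q. q \<in> N \<Longrightarrow> f q = g q"
  shows "smooth_at \<A> \<B> g p"
proof -
  obtain U \<kappa> V \<mu> M where M: "(U, \<kappa>) \<in> \<A>" "(V, \<mu>) \<in> \<B>" "openin (mtop \<A>) M" "p \<in> M"
    "M \<subseteq> U" "f ` M \<subseteq> V" "smooth_on (\<kappa> ` M) (\<mu> \<circ> f \<circ> inv_into U \<kappa>)"
    using f unfolding smooth_at_def by blast
  have NM: "openin (mtop \<A>) (N \<inter> M)" using N M by blast
  have "open (\<kappa> ` (N \<inter> M))"
    using M by (intro open_chart_image[OF A M(1) NM]) auto
  then have "smooth_on (\<kappa> ` (N \<inter> M)) (\<mu> \<circ> f \<circ> inv_into U \<kappa>) \<longleftrightarrow>
      smooth_on (\<kappa> ` (N \<inter> M)) (\<mu> \<circ> g \<circ> inv_into U \<kappa>)"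
    using chart_inj[OF A M(1)] M(5) eq by (intro smooth_on_cong) (auto simp: subset_iff)
  then show ?thesis using M N eq smooth_on_mono[OF M(7), of "\<kappa> ` (N \<inter> M)"]
    by (intro smooth_atI[OF M(1,2) NM]) force+
qed

lemma smooth_at_continuous:
  assumes AB: "mfd \<A>" "mfd \<B>" and h: "smooth_at \<A> \<B> h p" and N': "openin (mtop \<B>) N'" "h p \<in> N'"
  obtains N where "openin (mtop \<A>) N" "p \<in> N" "h ` N \<subseteq> N'"
proof -
  obtain U \<kappa> V \<mu> M where M: "(U, \<kappa>) \<in> \<A>" "(V, \<mu>) \<in> \<B>" "openin (mtop \<A>) M" "p \<in> M"
    "M \<subseteq> U" "h ` M \<subseteq> V" "smooth_on (\<kappa> ` M) (\<mu> \<circ> h \<circ> inv_into U \<kappa>)"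
    using h unfolding smooth_at_def by blast
  show thesis
    using openin_local_preimage[OF AB M(1-3,5-7) N'(1)] M(4) N'(2)
    by (intro that[of "{q \<in> M. h q \<in> N'}"]) auto
qed

text \<open>From here on smoothness is handled pointwise; this is the passage to and from the global
  notion of the definitions.\<close>

lemma smooth_map_iff:
  assumes AB: "mfd \<A>" "mfd \<B>"
  shows "smooth_map \<A> \<B> h \<longleftrightarrow> (\<forall>p\<in>pts \<A>. smooth_at \<A> \<B> h p)"
proof (intro iffI ballI)
  fix p assume h: "smooth_map \<A> \<B> h" and p: "p \<in> pts \<A>"
  have cont: "continuous_map (mtop \<A>) (mtop \<B>) h" using h by (simp add: smooth_map_def)
  have "h p \<in> pts \<B>"
    using cont p AB by (auto simp: continuous_map_def topspace_mtop)
  obtain U \<kappa> V \<mu> where U: "(U, \<kappa>) \<in> \<A>" "p \<in> U" and V: "(V, \<mu>) \<in> \<B>" "h p \<in> V"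
    using pts_chart[OF p] pts_chart[OF \<open>h p \<in> pts \<B>\<close>] by blast
  have "openin (mtop \<A>) (U \<inter> {q \<in> topspace (mtop \<A>). h q \<in> V})"
    by (intro openin_Int chart_openin[OF AB(1) U(1)] openin_continuous_map_preimage[OF cont]
        chart_openin[OF AB(2) V(1)])
  also have "U \<inter> {q \<in> topspace (mtop \<A>). h q \<in> V} = {q \<in> U. h q \<in> V}"
    using chart_subset_pts[OF U(1)] by (auto simp: topspace_mtop[OF AB(1)])
  finally have N: "openin (mtop \<A>) {q \<in> U. h q \<in> V}" .
  show "smooth_at \<A> \<B> h p"
    using h U V by (intro smooth_atI[OF U(1) V(1) N]) (auto simp: smooth_map_def)
next
  assume h: "\<forall>p\<in>pts \<A>. smooth_at \<A> \<B> h p"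
  have "continuous_map (mtop \<A>) (mtop \<B>) h"
    unfolding continuous_map_def
  proof (intro conjI allI impI)
    show "h \<in> topspace (mtop \<A>) \<rightarrow> topspace (mtop \<B>)"
      using h smooth_at_pts[OF AB(1)] by (auto simp: topspace_mtop AB)
    fix W assume W: "openin (mtop \<B>) W"
    have "\<exists>N. openin (mtop \<A>) N \<and> p \<in> N \<and> N \<subseteq> {x \<in> topspace (mtop \<A>). h x \<in> W}"
      if p: "p \<in> {x \<in> topspace (mtop \<A>). h x \<in> W}" for p
    proof -
      have "smooth_at \<A> \<B> h p" "h p \<in> W" using p h AB by (auto simp: topspace_mtop)
      then obtain N where "openin (mtop \<A>) N" "p \<in> N" "h ` N \<subseteq> W"
        using smooth_at_continuous[OF AB _ W] by metis
      then show ?thesis using openin_subset by (intro exI[of _ N]) blast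
    qed
    then show "openin (mtop \<A>) {x \<in> topspace (mtop \<A>). h x \<in> W}"
      by (subst openin_subopen) blast
  qed
  moreover have "smooth_on (\<kappa> ` {p \<in> U. h p \<in> V}) (\<mu> \<circ> h \<circ> inv_into U \<kappa>)"
    if U: "(U, \<kappa>) \<in> \<A>" and V: "(V, \<mu>) \<in> \<B>" for U \<kappa> V \<mu>
  proof (rule smooth_on_local)
    fix y assume "y \<in> \<kappa> ` {p \<in> U. h p \<in> V}"
    then obtain p where p: "p \<in> U" "h p \<in> V" "y = \<kappa> p" by blast
    then have "smooth_at \<A> \<B> h p" using h chart_subset_pts[OF U] by blast
    then obtain N where N: "openin (mtop \<A>) N" "p \<in> N" "N \<subseteq> U" "h ` N \<subseteq> V"
      "smooth_on (\<kappa> ` N) (\<mu> \<circ> h \<circ> inv_into U \<kappa>)"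
      using smooth_at_charts[of \<A> \<B> h p, OF AB _ U p(1) V p(2)] by metis
    then show "\<exists>S. open S \<and> y \<in> S \<and> smooth_on S (\<mu> \<circ> h \<circ> inv_into U \<kappa>)"
      using open_chart_image[OF AB(1) U N(1,3)] p(3) by (intro exI[of _ "\<kappa> ` N"]) auto
  qed
  ultimately show "smooth_map \<A> \<B> h" unfolding smooth_map_def by blast
qed

lemma smooth_at_model_iff:
  fixes f :: "'e::real_inner \<Rightarrow> 'f::real_inner"
  assumes "finite_dim TYPE('e)"
  shows "smooth_at model model f y \<longleftrightarrow> (\<exists>S. open S \<and> y \<in> S \<and> smooth_on S f)"
  unfolding smooth_at_def by (auto simp: model_def openin_model[unfolded model_def, OF assms])

lemma smooth_at_model_smooth_on:
  fixes f :: "'e::real_inner \<Rightarrow> 'f::real_inner"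
  shows "finite_dim TYPE('e) \<Longrightarrow> smooth_on S f \<Longrightarrow> open S \<Longrightarrow> y \<in> S \<Longrightarrow> smooth_at model model f y"
  using smooth_at_model_iff by blast

lemma smooth_at_chart:
  assumes A: "mfd \<A>" and U: "(U, \<kappa>) \<in> \<A>" "p \<in> U"
  shows "smooth_at \<A> model \<kappa> p"
proof (rule smooth_atI[OF U(1) model_chart chart_openin[OF A U(1)] U(2)])
  have "smooth_on (\<kappa> ` U) (\<lambda>y. y)" by (simp add: smooth_on_linear)
  also have "?this \<longleftrightarrow> smooth_on (\<kappa> ` U) (id \<circ> \<kappa> \<circ> inv_into U \<kappa>)"
    using open_chart_image[OF A U(1) chart_openin[OF A U(1)]]
    by (intro smooth_on_cong) (auto simp: f_inv_into_f)
  finally show "smooth_on (\<kappa> ` U) (id \<circ> \<kappa> \<circ> inv_into U \<kappa>)" .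
qed auto

lemma smooth_at_chart_inv:
  assumes A: "mfd \<A>" and U: "(U, \<kappa>) \<in> \<A>" "p \<in> U"
  shows "smooth_at model \<A> (inv_into U \<kappa>) (\<kappa> p)"
proof -
  have op: "open (\<kappa> ` U)" using open_chart_image[OF A U(1) chart_openin[OF A U(1)]] by simp
  show ?thesis
  proof (rule smooth_atI[OF model_chart U(1), where N = "\<kappa> ` U"])
    have "smooth_on (\<kappa> ` U) (\<lambda>y. y)" by (simp add: smooth_on_linear)
    also have "?this \<longleftrightarrow> smooth_on (\<kappa> ` U) (\<kappa> \<circ> inv_into U \<kappa> \<circ> inv_into UNIV id)"
      using op by (intro smooth_on_cong) (auto simp: f_inv_into_f)
    finally show "smooth_on (id ` \<kappa> ` U) (\<kappa> \<circ> inv_into U \<kappa> \<circ> inv_into UNIV id)" by simp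
  qed (use op U A in \<open>auto simp: openin_model mfd_finite_dim inv_into_into\<close>)
qed

lemma smooth_at_coord:
  fixes f :: "'p \<Rightarrow> 'f::real_inner"
  assumes A: "mfd (\<A> :: ('p, 'e::real_inner) atlas)" and fd: "finite_dim TYPE('f)" and U: "(U, \<kappa>) \<in> \<A>" "p \<in> U"
  shows "smooth_at \<A> model f p \<longleftrightarrow> (\<exists>S. open S \<and> \<kappa> p \<in> S \<and> smooth_on S (f \<circ> inv_into U \<kappa>))"
proof
  assume "smooth_at \<A> model f p"
  then have "smooth_at model model (\<lambda>y. f (inv_into U \<kappa> y)) (\<kappa> p)"
    using chart_inj[OF A U(1)] U
    by (intro smooth_at_compose[OF mfd_model[OF mfd_finite_dim[OF A]] A mfd_model[OF fd] smooth_at_chart_inv[OF A U]])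
       simp
  then show "\<exists>S. open S \<and> \<kappa> p \<in> S \<and> smooth_on S (f \<circ> inv_into U \<kappa>)"
    by (simp add: smooth_at_model_iff[OF mfd_finite_dim[OF A]] comp_def)
next
  assume "\<exists>S. open S \<and> \<kappa> p \<in> S \<and> smooth_on S (f \<circ> inv_into U \<kappa>)"
  then have "smooth_at model model (\<lambda>y. f (inv_into U \<kappa> y)) (\<kappa> p)"
    by (simp add: smooth_at_model_iff[OF mfd_finite_dim[OF A]] comp_def)
  then have "smooth_at \<A> model (\<lambda>q. f (inv_into U \<kappa> (\<kappa> q))) p"
    by (rule smooth_at_compose[OF A mfd_model[OF mfd_finite_dim[OF A]] mfd_model[OF fd] smooth_at_chart[OF A U]])
  then show "smooth_at \<A> model f p"
    by (rule smooth_at_cong[OF A _ chart_openin[OF A U(1)] U(2)]) (simp add: chart_inj[OF A U(1)])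
qed

lemma Cinf_iff:
  assumes A: "mfd \<A>"
  shows "f \<in> Cinf \<A> \<longleftrightarrow> (\<forall>p\<in>pts \<A>. smooth_at \<A> model f p)"
proof
  assume f: "f \<in> Cinf \<A>"
  show "\<forall>p\<in>pts \<A>. smooth_at \<A> model f p"
  proof
    fix p assume "p \<in> pts \<A>"
    then obtain U \<kappa> where U: "(U, \<kappa>) \<in> \<A>" "p \<in> U" using pts_chart by metis
    then have "smooth_on (\<kappa> ` U) (f \<circ> inv_into U \<kappa>)" using f by (auto simp: Cinf_def)
    then show "smooth_at \<A> model f p"
      using open_chart_image[OF A U(1) chart_openin[OF A U(1)]] U
      by (subst smooth_at_coord[OF A finite_dim_real U]) blast
  qed
next
  assume f: "\<forall>p\<in>pts \<A>. smooth_at \<A> model f p"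
  have "smooth_on (\<kappa> ` U) (f \<circ> inv_into U \<kappa>)" if U: "(U, \<kappa>) \<in> \<A>" for U \<kappa>
  proof (rule smooth_on_local)
    fix y assume "y \<in> \<kappa> ` U"
    then obtain p where "p \<in> U" "y = \<kappa> p" by blast
    then show "\<exists>S. open S \<and> y \<in> S \<and> smooth_on S (f \<circ> inv_into U \<kappa>)"
      using f chart_subset_pts[OF U] smooth_at_coord[OF A finite_dim_real U] by blast
  qed
  then show "f \<in> Cinf \<A>" by (auto simp: Cinf_def)
qed

lemma Cinf_smooth_at: "mfd \<A> \<Longrightarrow> f \<in> Cinf \<A> \<Longrightarrow> p \<in> pts \<A> \<Longrightarrow> smooth_at \<A> model f p"
  by (simp add: Cinf_iff)

lemma smooth_at_const:
  assumes A: "mfd \<A>" "p \<in> pts \<A>" "c \<in> pts \<B>"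
  shows "smooth_at \<A> \<B> (\<lambda>_. c) p"
proof -
  obtain U \<kappa> V \<mu> where "(U, \<kappa>) \<in> \<A>" "p \<in> U" "(V, \<mu>) \<in> \<B>" "c \<in> V"
    using pts_chart[OF A(2)] pts_chart[OF A(3)] by blast
  then show ?thesis
    using chart_openin[OF A(1)] by (intro smooth_atI[of U \<kappa> \<A> V \<mu> \<B> U]) (auto simp: comp_def smooth_on_const)
qed

lemma smooth_at_ident: "mfd \<A> \<Longrightarrow> p \<in> pts \<A> \<Longrightarrow> smooth_at \<A> \<A> (\<lambda>q. q) p"
proof -
  assume A: "mfd \<A>" "p \<in> pts \<A>"
  then obtain U \<kappa> where U: "(U, \<kappa>) \<in> \<A>" "p \<in> U" using pts_chart by metis
  have "smooth_on (\<kappa> ` U) (\<lambda>y. y)" by (simp add: smooth_on_linear)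
  also have "?this \<longleftrightarrow> smooth_on (\<kappa> ` U) (\<kappa> \<circ> (\<lambda>q. q) \<circ> inv_into U \<kappa>)"
    using open_chart_image[OF A(1) U(1) chart_openin[OF A(1) U(1)]]
    by (intro smooth_on_cong) (auto simp: f_inv_into_f)
  finally show ?thesis using chart_openin[OF A(1) U(1)] U by (intro smooth_atI[OF U(1) U(1)]) auto
qed

lemma smooth_at_model_map:
  fixes f :: "'p \<Rightarrow> 'f::real_inner" and F :: "'f \<Rightarrow> 'h::real_inner"
  assumes A: "mfd (\<A> :: ('p, 'e::real_inner) atlas)" and fd: "finite_dim TYPE('f)" "finite_dim TYPE('h)"
    and F: "smooth_on S F" "open S" "f p \<in> S"
    and f: "smooth_at \<A> model f p"
  shows "smooth_at \<A> model (\<lambda>q. F (f q)) p"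
  by (rule smooth_at_compose[OF A mfd_model[OF fd(1)] mfd_model[OF fd(2)] f smooth_at_model_smooth_on[OF fd(1) F]])

lemma smooth_at_linear:
  fixes f :: "'p \<Rightarrow> 'f::real_inner" and L :: "'f \<Rightarrow> 'h::real_inner"
  assumes "mfd (\<A> :: ('p, 'e::real_inner) atlas)" "finite_dim TYPE('f)" "finite_dim TYPE('h)"
    and "bounded_linear L" "smooth_at \<A> model f p"
  shows "smooth_at \<A> model (\<lambda>q. L (f q)) p"
  by (rule smooth_at_model_map[OF assms(1-3) smooth_on_linear[OF assms(4)] open_UNIV UNIV_I assms(5)])

text \<open>The assumption on \<open>F\<close> concerns functions on the model space only, so the
  rules for sums, bilinear maps and pairs all carry over from \<open>smooth_on\<close> by this one
  argument.\<close>

lemma smooth_at_map2: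
  fixes f :: "'p \<Rightarrow> 'f::real_inner" and g :: "'p \<Rightarrow> 'h::real_inner" and F :: "'f \<Rightarrow> 'h \<Rightarrow> 'i::real_inner"
  assumes A: "mfd (\<A> :: ('p, 'e::real_inner) atlas)"
    and fd: "finite_dim TYPE('f)" "finite_dim TYPE('h)" "finite_dim TYPE('i)"
    and f: "smooth_at \<A> model f p" and g: "smooth_at \<A> model g p"
    and F: "\<And>S (u :: 'e \<Rightarrow> 'f) v. open S \<Longrightarrow> smooth_on S u \<Longrightarrow> smooth_on S v \<Longrightarrow> smooth_on S (\<lambda>x. F (u x) (v x))"
  shows "smooth_at \<A> model (\<lambda>q. F (f q) (g q)) p"
proof -
  obtain U \<kappa> where U: "(U, \<kappa>) \<in> \<A>" "p \<in> U"
    using smooth_at_pts[OF A f] pts_chart by metis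
  obtain S T where ST: "open S" "\<kappa> p \<in> S" "smooth_on S (f \<circ> inv_into U \<kappa>)"
      "open T" "\<kappa> p \<in> T" "smooth_on T (g \<circ> inv_into U \<kappa>)"
    using f g unfolding smooth_at_coord[OF A fd(1) U] smooth_at_coord[OF A fd(2) U] by blast
  have "smooth_on (S \<inter> T) (\<lambda>x. F ((f \<circ> inv_into U \<kappa>) x) ((g \<circ> inv_into U \<kappa>) x))"
    by (intro F open_Int ST smooth_on_mono[OF ST(3)] smooth_on_mono[OF ST(6)]) auto
  then show ?thesis
    unfolding smooth_at_coord[OF A fd(3) U] using ST by (intro exI[of _ "S \<inter> T"]) (simp add: comp_def open_Int)
qed

lemma smooth_at_bilinear:
  fixes f :: "'p \<Rightarrow> 'f::real_inner" and g :: "'p \<Rightarrow> 'h::real_inner" and B :: "'f \<Rightarrow> 'h \<Rightarrow> 'i::real_inner"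
  assumes A: "mfd (\<A> :: ('p, 'e::real_inner) atlas)"
    and fd: "finite_dim TYPE('f)" "finite_dim TYPE('h)" "finite_dim TYPE('i)"
    and B: "bounded_bilinear B" and f: "smooth_at \<A> model f p" and g: "smooth_at \<A> model g p"
  shows "smooth_at \<A> model (\<lambda>q. B (f q) (g q)) p"
  by (rule smooth_at_map2[OF A fd f g]) (rule smooth_on_bilinear[OF B])

lemma smooth_at_add:
  fixes f g :: "'p \<Rightarrow> 'f::real_inner"
  assumes A: "mfd (\<A> :: ('p, 'e::real_inner) atlas)"
    and fd: "finite_dim TYPE('f)" and f: "smooth_at \<A> model f p" and g: "smooth_at \<A> model g p"
  shows "smooth_at \<A> model (\<lambda>q. f q + g q) p"
  by (rule smooth_at_map2[OF A fd fd fd f g]) (rule smooth_on_add)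

lemma smooth_at_sum:
  fixes f :: "'i \<Rightarrow> 'p \<Rightarrow> 'f::real_inner"
  assumes A: "mfd (\<A> :: ('p, 'e::real_inner) atlas)" "p \<in> pts \<A>"
    and fd: "finite_dim TYPE('f)" and f: "\<And>i. i \<in> I \<Longrightarrow> smooth_at \<A> model (f i) p"
  shows "smooth_at \<A> model (\<lambda>q. \<Sum>i\<in>I. f i q) p"
  using f by (induction I rule: infinite_finite_induct)
    (simp_all add: smooth_at_add[OF A(1) fd] smooth_at_const[OF A] pts_model)

lemma smooth_at_model_Pair:
  fixes f :: "'p \<Rightarrow> 'f::real_inner" and g :: "'p \<Rightarrow> 'h::real_inner"
  assumes A: "mfd (\<A> :: ('p, 'e::real_inner) atlas)"
    and fd: "finite_dim TYPE('f)" "finite_dim TYPE('h)"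
    and f: "smooth_at \<A> model f p" and g: "smooth_at \<A> model g p"
  shows "smooth_at \<A> model (\<lambda>q. (f q, g q)) p"
  by (rule smooth_at_map2[OF A fd finite_dim_prod[OF fd] f g]) (rule smooth_on_Pair)

subsection \<open>Products\<close>

lemma prod_chart: "(U, \<kappa>) \<in> \<A> \<Longrightarrow> (V, \<mu>) \<in> \<B> \<Longrightarrow> (U \<times> V, \<lambda>(p, q). (\<kappa> p, \<mu> q)) \<in> prod_atlas \<A> \<B>"
  unfolding prod_atlas_def by blast

lemma pts_prod: "pts (prod_atlas \<A> \<B>) = pts \<A> \<times> pts \<B>"
proof (intro equalityI subsetI)
  fix z assume "z \<in> pts \<A> \<times> pts \<B>"
  then obtain U \<kappa> V \<mu> where "(U, \<kappa>) \<in> \<A>" "fst z \<in> U" "(V, \<mu>) \<in> \<B>" "snd z \<in> V"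
    using pts_chart[of "fst z" \<A>] pts_chart[of "snd z" \<B>] by auto
  then show "z \<in> pts (prod_atlas \<A> \<B>)"
    using chart_subset_pts[OF prod_chart[of U \<kappa> \<A> V \<mu> \<B>]] by (cases z) auto
qed (auto simp: pts_def prod_atlas_def)

lemma inv_into_prod:
  assumes "inj_on \<kappa> U" "inj_on \<mu> V" "y \<in> \<kappa> ` U" "z \<in> \<mu> ` V"
  shows "inv_into (U \<times> V) (\<lambda>(p, q). (\<kappa> p, \<mu> q)) (y, z) = (inv_into U \<kappa> y, inv_into V \<mu> z)"
  by (rule inv_into_f_eq) (use assms in \<open>auto simp: inj_on_def f_inv_into_f inv_into_into\<close>)

lemma mfd_prod:
  assumes A: "mfd (\<A> :: ('p, 'e::real_inner) atlas)" and B: "mfd (\<B> :: ('q, 'f::real_inner) atlas)"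
  shows "mfd (prod_atlas \<A> \<B>)"
proof -
  have "inj_on c W" if "(W, c) \<in> prod_atlas \<A> \<B>" for W c
    using that chart_inj[OF A] chart_inj[OF B] by (fastforce simp: prod_atlas_def inj_on_def)
  moreover have "open (c ` (W \<inter> W')) \<and> smooth_on (c ` (W \<inter> W')) (c' \<circ> inv_into W c)"
    if W: "(W, c) \<in> prod_atlas \<A> \<B>" and W': "(W', c') \<in> prod_atlas \<A> \<B>" for W c W' c'
  proof -
    obtain U \<kappa> V \<mu> where c: "W = U \<times> V" "c = (\<lambda>(p, q). (\<kappa> p, \<mu> q))" "(U, \<kappa>) \<in> \<A>" "(V, \<mu>) \<in> \<B>"
      using W unfolding prod_atlas_def by blast
    obtain U' \<kappa>' V' \<mu>' where c': "W' = U' \<times> V'" "c' = (\<lambda>(p, q). (\<kappa>' p, \<mu>' q))" "(U', \<kappa>') \<in> \<A>" "(V', \<mu>') \<in> \<B>"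
      using W' unfolding prod_atlas_def by blast
    have im: "c ` (W \<inter> W') = \<kappa> ` (U \<inter> U') \<times> \<mu> ` (V \<inter> V')"
      unfolding c c' by force
    note trA = chart_transition[OF A c(3) c'(3)] and trB = chart_transition[OF B c(4) c'(4)]
    have op: "open (c ` (W \<inter> W'))" unfolding im by (intro open_Times trA trB)
    have "smooth_on (c ` (W \<inter> W')) (\<lambda>z. ((\<kappa>' \<circ> inv_into U \<kappa>) (fst z), (\<mu>' \<circ> inv_into V \<mu>) (snd z)))"
      by (intro smooth_on_Pair[OF op] smooth_on_compose[OF mfd_finite_dim[OF A] op trA(1) smooth_on_linear trA(2)]
          smooth_on_compose[OF mfd_finite_dim[OF B] op trB(1) smooth_on_linear trB(2)]
          bounded_linear_fst bounded_linear_snd) (auto simp: im)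
    also have "?this \<longleftrightarrow> smooth_on (c ` (W \<inter> W')) (c' \<circ> inv_into W c)"
    proof (rule smooth_on_cong[OF op])
      fix z assume "z \<in> c ` (W \<inter> W')"
      then have "fst z \<in> \<kappa> ` U" "snd z \<in> \<mu> ` V" by (auto simp: im)
      from inv_into_prod[OF chart_inj[OF A c(3)] chart_inj[OF B c(4)] this]
      show "((\<kappa>' \<circ> inv_into U \<kappa>) (fst z), (\<mu>' \<circ> inv_into V \<mu>) (snd z)) = (c' \<circ> inv_into W c) z"
        by (simp add: c c')
    qed
    finally show ?thesis using op by blast
  qed
  ultimately show ?thesis
    using finite_dim_prod[OF mfd_finite_dim[OF A] mfd_finite_dim[OF B]]
    by (auto simp: mfd_def is_atlas_def)
qed

lemma smooth_at_Pair:
  assumes A: "mfd \<A>" and B: "mfd \<B>" and C: "mfd \<C>"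
    and f: "smooth_at \<A> \<B> f p" and g: "smooth_at \<A> \<C> g p"
  shows "smooth_at \<A> (prod_atlas \<B> \<C>) (\<lambda>q. (f q, g q)) p"
proof -
  obtain U \<kappa> V \<mu> W \<nu> where U: "(U, \<kappa>) \<in> \<A>" "p \<in> U" and V: "(V, \<mu>) \<in> \<B>" "f p \<in> V" and W: "(W, \<nu>) \<in> \<C>" "g p \<in> W"
    using smooth_at_pts[OF A f] smooth_at_pts[OF A g] pts_chart by metis
  obtain N where N: "openin (mtop \<A>) N" "p \<in> N" "N \<subseteq> U" "f ` N \<subseteq> V"
    "smooth_on (\<kappa> ` N) (\<mu> \<circ> f \<circ> inv_into U \<kappa>)" using smooth_at_charts[OF A B f U V] .
  obtain M where M: "openin (mtop \<A>) M" "p \<in> M" "M \<subseteq> U" "g ` M \<subseteq> W"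
    "smooth_on (\<kappa> ` M) (\<nu> \<circ> g \<circ> inv_into U \<kappa>)" using smooth_at_charts[OF A C g U W] .
  have NM: "openin (mtop \<A>) (N \<inter> M)" using N M by blast
  have "open (\<kappa> ` (N \<inter> M))" using N by (intro open_chart_image[OF A U(1) NM]) auto
  then have "smooth_on (\<kappa> ` (N \<inter> M)) (\<lambda>y. ((\<mu> \<circ> f \<circ> inv_into U \<kappa>) y, (\<nu> \<circ> g \<circ> inv_into U \<kappa>) y))"
    by (intro smooth_on_Pair smooth_on_mono[OF N(5)] smooth_on_mono[OF M(5)]) auto
  then show ?thesis
    using N M by (intro smooth_atI[OF U(1) prod_chart[OF V(1) W(1)] NM]) (auto simp: comp_def)
qed

lemma smooth_at_fst:
  assumes A: "mfd \<A>" and B: "mfd \<B>" and "p \<in> pts (prod_atlas \<A> \<B>)"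
  shows "smooth_at (prod_atlas \<A> \<B>) \<A> fst p" "smooth_at (prod_atlas \<A> \<B>) \<B> snd p"
proof -
  obtain U \<kappa> V \<mu> where UV: "(U, \<kappa>) \<in> \<A>" "fst p \<in> U" "(V, \<mu>) \<in> \<B>" "snd p \<in> V"
    using assms(3) pts_chart[of "fst p" \<A>] pts_chart[of "snd p" \<B>] by (auto simp: pts_prod)
  let ?c = "\<lambda>(p, q). (\<kappa> p, \<mu> q)"
  note c = prod_chart[OF UV(1,3)]
  note o = chart_openin[OF mfd_prod[OF A B] c]
  have op: "open (?c ` (U \<times> V))" using open_chart_image[OF mfd_prod[OF A B] c o] by simp
  have "smooth_on (?c ` (U \<times> V)) fst \<longleftrightarrow> smooth_on (?c ` (U \<times> V)) (\<kappa> \<circ> fst \<circ> inv_into (U \<times> V) ?c)"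
    "smooth_on (?c ` (U \<times> V)) snd \<longleftrightarrow> smooth_on (?c ` (U \<times> V)) (\<mu> \<circ> snd \<circ> inv_into (U \<times> V) ?c)"
    by (intro smooth_on_cong[OF op]; auto simp: inv_into_prod[OF chart_inj[OF A UV(1)] chart_inj[OF B UV(3)]]
        f_inv_into_f)+
  moreover have "p \<in> U \<times> V" using UV by (cases p) auto
  ultimately show "smooth_at (prod_atlas \<A> \<B>) \<A> fst p" "smooth_at (prod_atlas \<A> \<B>) \<B> snd p"
    by (auto intro!: smooth_atI[OF c UV(1) o] smooth_atI[OF c UV(3) o] smooth_on_linear
        bounded_linear_fst bounded_linear_snd simp del: comp_apply)
qed

subsection \<open>Derivatives in a chart\<close>

text \<open>The direction is a vector of the model space and comes last, so that the derivative is a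
  linear map of it. For a fixed direction and varying \<open>f\<close> this is the coordinate form
  of a tangent vector.\<close>

definition chart_deriv :: "'p set \<Rightarrow> ('p \<Rightarrow> 'e::real_normed_vector) \<Rightarrow> 'p \<Rightarrow> ('p \<Rightarrow> 'f::real_normed_vector) \<Rightarrow> 'e \<Rightarrow> 'f" where
  "chart_deriv U \<kappa> p f = frechet_derivative (f \<circ> inv_into U \<kappa>) (at (\<kappa> p))"

lemma smooth_at_differentiable:
  fixes f :: "'p \<Rightarrow> 'f::real_inner"
  assumes "mfd (\<A> :: ('p, 'e::real_inner) atlas)" "finite_dim TYPE('f)" "(U, \<kappa>) \<in> \<A>" "p \<in> U"
    and "smooth_at \<A> model f p"
  shows "(f \<circ> inv_into U \<kappa>) differentiable (at (\<kappa> p))"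
  using assms(5) smooth_on_differentiable unfolding smooth_at_coord[OF assms(1-4)] by blast

lemma chart_deriv_works:
  fixes f :: "'p \<Rightarrow> 'f::real_inner"
  assumes "mfd (\<A> :: ('p, 'e::real_inner) atlas)" "finite_dim TYPE('f)" "(U, \<kappa>) \<in> \<A>" "p \<in> U"
    and "smooth_at \<A> model f p"
  shows "((f \<circ> inv_into U \<kappa>) has_derivative chart_deriv U \<kappa> p f) (at (\<kappa> p))"
  unfolding chart_deriv_def using smooth_at_differentiable[OF assms] by (rule has_derivative_frechet)

lemma chart_deriv_linear:
  fixes f :: "'p \<Rightarrow> 'f::real_inner"
  assumes "mfd (\<A> :: ('p, 'e::real_inner) atlas)" "finite_dim TYPE('f)" "(U, \<kappa>) \<in> \<A>" "p \<in> U"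
    and "smooth_at \<A> model f p"
  shows "linear (chart_deriv U \<kappa> p f)"
  using chart_deriv_works[OF assms] by (rule has_derivative_linear)

lemma chart_deriv_eqI: "((f \<circ> inv_into U \<kappa>) has_derivative D) (at (\<kappa> p)) \<Longrightarrow> chart_deriv U \<kappa> p f = D"
  unfolding chart_deriv_def by (metis frechet_derivative_at)

lemma chart_deriv_cong:
  assumes A: "mfd (\<A> :: ('p, 'e::real_inner) atlas)" and U: "(U, \<kappa>) \<in> \<A>" "p \<in> U"
    and N: "openin (mtop \<A>) N" "p \<in> N" and eq: "\<And>q. q \<in> N \<Longrightarrow> f q = g q"
  shows "chart_deriv U \<kappa> p f = chart_deriv U \<kappa> p g"
  unfolding chart_deriv_def
proof (rule frechet_derivative_cong_open[where U = "\<kappa> ` (N \<inter> U)"])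
  have "openin (mtop \<A>) (N \<inter> U)" using N chart_openin[OF A U(1)] by blast
  then show "open (\<kappa> ` (N \<inter> U))" by (intro open_chart_image[OF A U(1)]) auto
  show "(f \<circ> inv_into U \<kappa>) y = (g \<circ> inv_into U \<kappa>) y" if "y \<in> \<kappa> ` (N \<inter> U)" for y
    using that eq chart_inj[OF A U(1)] by auto
qed (use N U in auto)

lemma chart_deriv_const: "chart_deriv U \<kappa> p (\<lambda>_. c) = (\<lambda>_. 0)"
  by (rule chart_deriv_eqI) (simp add: comp_def)

lemma chart_deriv_add:
  fixes f g :: "'p \<Rightarrow> 'f::real_inner"
  assumes A: "mfd (\<A> :: ('p, 'e::real_inner) atlas)" "finite_dim TYPE('f)" "(U, \<kappa>) \<in> \<A>" "p \<in> U"
    and f: "smooth_at \<A> model f p" and g: "smooth_at \<A> model g p"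
  shows "chart_deriv U \<kappa> p (\<lambda>q. f q + g q) w = chart_deriv U \<kappa> p f w + chart_deriv U \<kappa> p g w"
proof -
  have "(((\<lambda>q. f q + g q) \<circ> inv_into U \<kappa>) has_derivative (\<lambda>w. chart_deriv U \<kappa> p f w + chart_deriv U \<kappa> p g w)) (at (\<kappa> p))"
    using has_derivative_add[OF chart_deriv_works[OF A f] chart_deriv_works[OF A g]] by (simp add: comp_def)
  from chart_deriv_eqI[OF this] show ?thesis by simp
qed

lemma chart_deriv_linear_compose:
  fixes f :: "'p \<Rightarrow> 'f::real_inner"
  assumes A: "mfd (\<A> :: ('p, 'e::real_inner) atlas)" "finite_dim TYPE('f)" "(U, \<kappa>) \<in> \<A>" "p \<in> U"
    and L: "bounded_linear L" and f: "smooth_at \<A> model f p"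
  shows "chart_deriv U \<kappa> p (\<lambda>q. L (f q)) w = L (chart_deriv U \<kappa> p f w)"
proof -
  have "(((\<lambda>q. L (f q)) \<circ> inv_into U \<kappa>) has_derivative (\<lambda>w. L (chart_deriv U \<kappa> p f w))) (at (\<kappa> p))"
    using bounded_linear.has_derivative[OF L chart_deriv_works[OF A f]] by (simp add: comp_def)
  from chart_deriv_eqI[OF this] show ?thesis by simp
qed

lemma chart_deriv_bilinear:
  fixes f :: "'p \<Rightarrow> 'f::real_inner" and g :: "'p \<Rightarrow> 'h::real_inner"
  assumes A: "mfd (\<A> :: ('p, 'e::real_inner) atlas)" and U: "(U, \<kappa>) \<in> \<A>" "p \<in> U"
    and fd: "finite_dim TYPE('f)" "finite_dim TYPE('h)"
    and B: "bounded_bilinear B" and f: "smooth_at \<A> model f p" and g: "smooth_at \<A> model g p"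
  shows "chart_deriv U \<kappa> p (\<lambda>q. B (f q) (g q)) w = B (f p) (chart_deriv U \<kappa> p g w) + B (chart_deriv U \<kappa> p f w) (g p)"
proof -
  have "inv_into U \<kappa> (\<kappa> p) = p" using chart_inj[OF A U(1)] U(2) by simp
  then have "(((\<lambda>q. B (f q) (g q)) \<circ> inv_into U \<kappa>) has_derivative
      (\<lambda>w. B (f p) (chart_deriv U \<kappa> p g w) + B (chart_deriv U \<kappa> p f w) (g p))) (at (\<kappa> p))"
    using bounded_bilinear.FDERIV[OF B chart_deriv_works[OF A fd(1) U f] chart_deriv_works[OF A fd(2) U g]]
    by (simp add: comp_def)
  from chart_deriv_eqI[OF this] show ?thesis by simp
qed

lemma chart_deriv_compose:
  fixes f :: "'q \<Rightarrow> 'h::real_inner"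
  assumes A: "mfd (\<A> :: ('p, 'e::real_inner) atlas)" and B: "mfd (\<B> :: ('q, 'f::real_inner) atlas)"
    and fd: "finite_dim TYPE('h)" and U: "(U, \<kappa>) \<in> \<A>" "p \<in> U" and V: "(V, \<mu>) \<in> \<B>" "h p \<in> V"
    and h: "smooth_at \<A> \<B> h p" and f: "smooth_at \<B> model f (h p)"
  shows "chart_deriv U \<kappa> p (\<lambda>q. f (h q)) w = chart_deriv V \<mu> (h p) f (chart_deriv U \<kappa> p (\<lambda>q. \<mu> (h q)) w)"
proof -
  have ip: "inv_into U \<kappa> (\<kappa> p) = p" using chart_inj[OF A U(1)] U(2) by simp
  have \<mu>h: "smooth_at \<A> model (\<lambda>q. \<mu> (h q)) p"
    by (rule smooth_at_compose[OF A B mfd_model[OF mfd_finite_dim[OF B]] h smooth_at_chart[OF B V]])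
  obtain N where N: "openin (mtop \<A>) N" "p \<in> N" "h ` N \<subseteq> V"
    using smooth_at_continuous[OF A B h chart_openin[OF B V(1)] V(2)] .
  have "chart_deriv U \<kappa> p (\<lambda>q. f (h q)) = chart_deriv U \<kappa> p (\<lambda>q. (f \<circ> inv_into V \<mu>) (\<mu> (h q)))"
    using N chart_inj[OF B V(1)] by (intro chart_deriv_cong[OF A U N(1,2)]) auto
  also have "\<dots> = (\<lambda>w. chart_deriv V \<mu> (h p) f (chart_deriv U \<kappa> p (\<lambda>q. \<mu> (h q)) w))"
  proof (rule chart_deriv_eqI)
    have "((f \<circ> inv_into V \<mu>) has_derivative chart_deriv V \<mu> (h p) f) (at (((\<lambda>q. \<mu> (h q)) \<circ> inv_into U \<kappa>) (\<kappa> p)))"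
      using chart_deriv_works[OF B fd V f] ip by simp
    from has_derivative_compose[OF chart_deriv_works[OF A mfd_finite_dim[OF B] U \<mu>h] this]
    show "((\<lambda>q. (f \<circ> inv_into V \<mu>) (\<mu> (h q))) \<circ> inv_into U \<kappa> has_derivative
        (\<lambda>w. chart_deriv V \<mu> (h p) f (chart_deriv U \<kappa> p (\<lambda>q. \<mu> (h q)) w))) (at (\<kappa> p))"
      by (simp add: comp_def)
  qed
  finally show ?thesis by simp
qed

lemma smooth_at_chart_deriv:
  fixes f :: "'p \<Rightarrow> 'f::real_inner"
  assumes A: "mfd (\<A> :: ('p, 'e::real_inner) atlas)" "finite_dim TYPE('f)" "(U, \<kappa>) \<in> \<A>" "p \<in> U"
    and f: "smooth_at \<A> model f p"
  shows "smooth_at \<A> model (\<lambda>q. chart_deriv U \<kappa> q f w) p"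
proof -
  obtain S where S: "open S" "\<kappa> p \<in> S" "smooth_on S (f \<circ> inv_into U \<kappa>)"
    using f smooth_at_coord[OF A] by blast
  have "smooth_at \<A> model (\<lambda>q. (\<lambda>y. frechet_derivative (f \<circ> inv_into U \<kappa>) (at y) w) (\<kappa> q)) p"
    by (rule smooth_at_model_map[OF A(1) mfd_finite_dim[OF A(1)] A(2) smooth_on_frechet[OF S(3)] S(1,2) smooth_at_chart[OF A(1,3,4)]])
  then show ?thesis by (simp add: chart_deriv_def)
qed

lemma chart_deriv_commute:
  fixes f :: "'p \<Rightarrow> real"
  assumes A: "mfd (\<A> :: ('p, 'e::real_inner) atlas)" and U: "(U, \<kappa>) \<in> \<A>" "p \<in> U"
    and f: "smooth_at \<A> model f p"
  shows "chart_deriv U \<kappa> p (\<lambda>q. chart_deriv U \<kappa> q f v) u = chart_deriv U \<kappa> p (\<lambda>q. chart_deriv U \<kappa> q f u) v"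
proof -
  obtain S where S: "open S" "\<kappa> p \<in> S" "smooth_on S (f \<circ> inv_into U \<kappa>)"
    using f smooth_at_coord[OF A finite_dim_real U] by blast
  have op: "open (\<kappa> ` U)" using open_chart_image[OF A U(1) chart_openin[OF A U(1)]] by simp
  have "chart_deriv U \<kappa> p (\<lambda>q. chart_deriv U \<kappa> q f v) =
      frechet_derivative (\<lambda>y. frechet_derivative (f \<circ> inv_into U \<kappa>) (at y) v) (at (\<kappa> p))" for v
    unfolding chart_deriv_def using U
    by (intro frechet_derivative_cong_open[OF op]) (auto simp: f_inv_into_f)
  then show ?thesis using mixed_derivatives_commute[OF S] by simp
qed

lemma chart_deriv_chart:
  assumes A: "mfd (\<A> :: ('p, 'e::real_inner) atlas)" and U: "(U, \<kappa>) \<in> \<A>" "p \<in> U"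
  shows "chart_deriv U \<kappa> p \<kappa> = (\<lambda>w. w)"
proof (rule chart_deriv_eqI)
  have "open (\<kappa> ` U)" using open_chart_image[OF A U(1) chart_openin[OF A U(1)]] by simp
  then show "((\<kappa> \<circ> inv_into U \<kappa>) has_derivative (\<lambda>w. w)) (at (\<kappa> p))"
    using U(2) by (intro has_derivative_transform_within_open[OF has_derivative_ident])
      (auto simp: f_inv_into_f)
qed

text \<open>The chain rule for the two inclusions of slices, whose coordinate derivatives are
  \<open>(0, w)\<close> and \<open>(u, 0)\<close>. Partial derivatives thereby become directional
  derivatives in one product chart.\<close>

lemma chart_deriv_prod_slice:
  fixes S :: "'p \<times> 'q \<Rightarrow> 'h::real_inner"
  assumes A: "mfd (\<A> :: ('p, 'e::real_inner) atlas)" and B: "mfd (\<B> :: ('q, 'f::real_inner) atlas)"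
    and fd: "finite_dim TYPE('h)" and U: "(U, \<kappa>) \<in> \<A>" "p \<in> U" and V: "(V, \<mu>) \<in> \<B>" "r \<in> V"
    and S: "smooth_at (prod_atlas \<A> \<B>) model S (p, r)"
  shows "chart_deriv V \<mu> r (\<lambda>h. S (p, h)) w = chart_deriv (U \<times> V) (\<lambda>(p, q). (\<kappa> p, \<mu> q)) (p, r) S (0, w)"
    and "chart_deriv U \<kappa> p (\<lambda>k. S (k, r)) u = chart_deriv (U \<times> V) (\<lambda>(p, q). (\<kappa> p, \<mu> q)) (p, r) S (u, 0)"
proof -
  let ?c = "\<lambda>(p, q). (\<kappa> p, \<mu> q)"
  note AB = mfd_prod[OF A B] and c = prod_chart[OF U(1) V(1)]
  have pr: "p \<in> pts \<A>" "r \<in> pts \<B>" "(p, r) \<in> U \<times> V" using U V chart_subset_pts by blast+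
  have fr: "smooth_at \<A> model \<kappa> p" "smooth_at \<B> model \<mu> r"
    by (rule smooth_at_chart[OF A U] smooth_at_chart[OF B V])+
  have "chart_deriv V \<mu> r (\<lambda>h. S (p, h)) w = chart_deriv (U \<times> V) ?c (p, r) S (chart_deriv V \<mu> r (\<lambda>h. ?c (p, h)) w)"
    by (rule chart_deriv_compose[where h = "\<lambda>h. (p, h)", OF B AB fd V c pr(3) _ S])
       (intro smooth_at_Pair smooth_at_const smooth_at_ident A B pr)
  also have "chart_deriv V \<mu> r (\<lambda>h. ?c (p, h)) w = (0, w)"
  proof -
    have "(((\<lambda>h. ?c (p, h)) \<circ> inv_into V \<mu>) has_derivative (\<lambda>w. (0, chart_deriv V \<mu> r \<mu> w))) (at (\<mu> r))"
      using has_derivative_Pair[OF has_derivative_const chart_deriv_works[OF B mfd_finite_dim[OF B] V fr(2)]]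
      by (simp add: comp_def)
    from chart_deriv_eqI[OF this] show ?thesis by (simp add: chart_deriv_chart[OF B V])
  qed
  finally show "chart_deriv V \<mu> r (\<lambda>h. S (p, h)) w = chart_deriv (U \<times> V) ?c (p, r) S (0, w)" .
  have "chart_deriv U \<kappa> p (\<lambda>k. S (k, r)) u = chart_deriv (U \<times> V) ?c (p, r) S (chart_deriv U \<kappa> p (\<lambda>k. ?c (k, r)) u)"
    by (rule chart_deriv_compose[where h = "\<lambda>k. (k, r)", OF A AB fd U c pr(3) _ S])
       (intro smooth_at_Pair smooth_at_const smooth_at_ident A B pr)
  also have "chart_deriv U \<kappa> p (\<lambda>k. ?c (k, r)) u = (u, 0)"
  proof -
    have "((\<lambda>k. ?c (k, r)) \<circ> inv_into U \<kappa> has_derivative (\<lambda>w. (chart_deriv U \<kappa> p \<kappa> w, 0))) (at (\<kappa> p))"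
      using has_derivative_Pair[OF chart_deriv_works[OF A mfd_finite_dim[OF A] U fr(1)] has_derivative_const]
      by (simp add: comp_def)
    from chart_deriv_eqI[OF this] show ?thesis by (simp add: chart_deriv_chart[OF A U])
  qed
  finally show "chart_deriv U \<kappa> p (\<lambda>k. S (k, r)) u = chart_deriv (U \<times> V) ?c (p, r) S (u, 0)" .
qed

text \<open>Near \<open>p\<close> the derivative along the second factor is the derivative of
  \<open>S\<close> in the constant direction \<open>(0, w)\<close> of a product chart, and this
  depends smoothly on the point.\<close>

lemma smooth_at_chart_deriv_param:
  fixes S :: "'p \<times> 'q \<Rightarrow> 'h::real_inner"
  assumes A: "mfd (\<A> :: ('p, 'e::real_inner) atlas)" and B: "mfd (\<B> :: ('q, 'f::real_inner) atlas)"
    and fd: "finite_dim TYPE('h)" and V: "(V, \<mu>) \<in> \<B>" "r \<in> V"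
    and S: "smooth_at (prod_atlas \<A> \<B>) model S (p, r)"
  shows "smooth_at \<A> model (\<lambda>q. chart_deriv V \<mu> r (\<lambda>h. S (q, h)) w) p"
proof -
  note AB = mfd_prod[OF A B]
  have pr: "p \<in> pts \<A>" "r \<in> pts \<B>" using smooth_at_pts[OF AB S] by (auto simp: pts_prod)
  then obtain U \<kappa> where U: "(U, \<kappa>) \<in> \<A>" "p \<in> U" using pts_chart by metis
  let ?c = "\<lambda>(p, q). (\<kappa> p, \<mu> q)"
  have pair: "smooth_at \<A> (prod_atlas \<A> \<B>) (\<lambda>q. (q, r)) p"
    by (intro smooth_at_Pair smooth_at_const smooth_at_ident A B pr)
  have "smooth_at (prod_atlas \<A> \<B>) model (\<lambda>z. chart_deriv (U \<times> V) ?c z S (0, w)) (p, r)"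
    using U V by (intro smooth_at_chart_deriv[OF AB fd prod_chart[OF U(1) V(1)] _ S]) auto
  from smooth_at_compose[OF A AB mfd_model[OF fd] pair this]
  have sm: "smooth_at \<A> model (\<lambda>q. chart_deriv (U \<times> V) ?c (q, r) S (0, w)) p" .
  obtain N where N: "openin (mtop (prod_atlas \<A> \<B>)) N" "(p, r) \<in> N"
    "\<And>z. z \<in> N \<Longrightarrow> smooth_at (prod_atlas \<A> \<B>) model S z"
    using smooth_at_open[OF S] by blast
  obtain M where M: "openin (mtop \<A>) M" "p \<in> M" "(\<lambda>q. (q, r)) ` M \<subseteq> N"
    using smooth_at_continuous[OF A AB pair N(1,2)] .
  show ?thesis
  proof (rule smooth_at_cong[OF A sm])
    show "openin (mtop \<A>) (M \<inter> U)" using M chart_openin[OF A U(1)] by blast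
    show "chart_deriv (U \<times> V) ?c (q, r) S (0, w) = chart_deriv V \<mu> r (\<lambda>h. S (q, h)) w" if "q \<in> M \<inter> U" for q
      using chart_deriv_prod_slice(1)[OF A B fd U(1) _ V N(3)] that M(3) by auto
  qed (use M U in auto)
qed

text \<open>In product coordinates the diagonal has derivative \<open>(w, w)\<close>, the sum of
  \<open>(w, 0)\<close> and \<open>(0, w)\<close>. This serves as a Leibniz rule for group
  expressions in which the variable occurs twice.\<close>

lemma chart_deriv_diagonal:
  fixes S :: "'p \<times> 'p \<Rightarrow> 'h::real_inner"
  assumes A: "mfd (\<A> :: ('p, 'e::real_inner) atlas)"
    and fd: "finite_dim TYPE('h)" and U: "(U, \<kappa>) \<in> \<A>" "p \<in> U"
    and S: "smooth_at (prod_atlas \<A> \<A>) model S (p, p)"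
  shows "chart_deriv U \<kappa> p (\<lambda>q. S (q, q)) w = chart_deriv U \<kappa> p (\<lambda>q. S (q, p)) w + chart_deriv U \<kappa> p (\<lambda>q. S (p, q)) w"
proof -
  let ?c = "\<lambda>(p, q). (\<kappa> p, \<kappa> q)"
  note AA = mfd_prod[OF A A] and c = prod_chart[OF U(1) U(1)]
  have pp: "p \<in> pts \<A>" "(p, p) \<in> U \<times> U" using U chart_subset_pts by blast+
  note \<kappa> = smooth_at_chart[OF A U]
  have "chart_deriv U \<kappa> p (\<lambda>q. S (q, q)) w = chart_deriv (U \<times> U) ?c (p, p) S (chart_deriv U \<kappa> p (\<lambda>q. ?c (q, q)) w)"
    by (rule chart_deriv_compose[where h = "\<lambda>q. (q, q)", OF A AA fd U c pp(2) _ S])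
       (intro smooth_at_Pair smooth_at_ident A pp)
  also have "chart_deriv U \<kappa> p (\<lambda>q. ?c (q, q)) w = (w, 0) + (0, w)"
  proof -
    have "((\<lambda>q. ?c (q, q)) \<circ> inv_into U \<kappa> has_derivative (\<lambda>w. (chart_deriv U \<kappa> p \<kappa> w, chart_deriv U \<kappa> p \<kappa> w))) (at (\<kappa> p))"
      using has_derivative_Pair[OF chart_deriv_works[OF A mfd_finite_dim[OF A] U \<kappa>] chart_deriv_works[OF A mfd_finite_dim[OF A] U \<kappa>]]
      by (simp add: comp_def)
    from chart_deriv_eqI[OF this] show ?thesis by (simp add: chart_deriv_chart[OF A U])
  qed
  also have "chart_deriv (U \<times> U) ?c (p, p) S ((w, 0) + (0, w)) =
      chart_deriv (U \<times> U) ?c (p, p) S (w, 0) + chart_deriv (U \<times> U) ?c (p, p) S (0, w)"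
    by (rule linear_add[OF chart_deriv_linear[OF AA fd c pp(2) S]])
  finally show ?thesis by (simp add: chart_deriv_prod_slice[OF A A fd U U S])
qed

text \<open>Both iterated derivatives are second derivatives of \<open>S\<close> in one product
  chart, in directions \<open>(u, 0)\<close> and \<open>(0, w)\<close>.\<close>

lemma chart_deriv_slices_commute:
  fixes S :: "'p \<times> 'q \<Rightarrow> real"
  assumes A: "mfd (\<A> :: ('p, 'e::real_inner) atlas)" and B: "mfd (\<B> :: ('q, 'f::real_inner) atlas)"
    and U: "(U, \<kappa>) \<in> \<A>" "p \<in> U" and V: "(V, \<mu>) \<in> \<B>" "r \<in> V"
    and S: "smooth_at (prod_atlas \<A> \<B>) model S (p, r)"
  shows "chart_deriv U \<kappa> p (\<lambda>k. chart_deriv V \<mu> r (\<lambda>h. S (k, h)) w) u = chart_deriv V \<mu> r (\<lambda>h. chart_deriv U \<kappa> p (\<lambda>k. S (k, h)) u) w"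
proof -
  let ?c = "\<lambda>(p, q). (\<kappa> p, \<mu> q)"
  note AB = mfd_prod[OF A B] and c = prod_chart[OF U(1) V(1)]
  have pr: "p \<in> pts \<A>" "r \<in> pts \<B>" "(p, r) \<in> U \<times> V" using U V chart_subset_pts by blast+
  have pairs: "smooth_at \<A> (prod_atlas \<A> \<B>) (\<lambda>q. (q, r)) p" "smooth_at \<B> (prod_atlas \<A> \<B>) (\<lambda>q. (p, q)) r"
    by (intro smooth_at_Pair smooth_at_const smooth_at_ident A B pr)+
  obtain N where N: "openin (mtop (prod_atlas \<A> \<B>)) N" "(p, r) \<in> N"
    "\<And>z. z \<in> N \<Longrightarrow> smooth_at (prod_atlas \<A> \<B>) model S z"
    using smooth_at_open[OF S] by blast
  obtain M1 where M1: "openin (mtop \<A>) M1" "p \<in> M1" "(\<lambda>q. (q, r)) ` M1 \<subseteq> N"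
    using smooth_at_continuous[OF A AB pairs(1) N(1,2)] .
  obtain M2 where M2: "openin (mtop \<B>) M2" "r \<in> M2" "(\<lambda>q. (p, q)) ` M2 \<subseteq> N"
    using smooth_at_continuous[OF B AB pairs(2) N(1,2)] .
  have sdd: "smooth_at (prod_atlas \<A> \<B>) model (\<lambda>z. chart_deriv (U \<times> V) ?c z S x) (p, r)" for x
    by (rule smooth_at_chart_deriv[OF AB finite_dim_real c pr(3) S])
  have "chart_deriv U \<kappa> p (\<lambda>k. chart_deriv V \<mu> r (\<lambda>h. S (k, h)) w) u = chart_deriv U \<kappa> p (\<lambda>k. chart_deriv (U \<times> V) ?c (k, r) S (0, w)) u"
  proof (rule fun_cong[OF chart_deriv_cong[OF A U]])
    show "openin (mtop \<A>) (M1 \<inter> U)" using M1 chart_openin[OF A U(1)] by blast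
    show "chart_deriv V \<mu> r (\<lambda>h. S (q, h)) w = chart_deriv (U \<times> V) ?c (q, r) S (0, w)" if "q \<in> M1 \<inter> U" for q
      using chart_deriv_prod_slice(1)[OF A B finite_dim_real U(1) _ V N(3)] that M1(3) by auto
  qed (use M1 U in auto)
  also have "\<dots> = chart_deriv (U \<times> V) ?c (p, r) (\<lambda>z. chart_deriv (U \<times> V) ?c z S (0, w)) (u, 0)"
    by (rule chart_deriv_prod_slice(2)[OF A B finite_dim_real U V sdd])
  also have "\<dots> = chart_deriv (U \<times> V) ?c (p, r) (\<lambda>z. chart_deriv (U \<times> V) ?c z S (u, 0)) (0, w)"
    by (rule chart_deriv_commute[OF AB c pr(3) S])
  also have "\<dots> = chart_deriv V \<mu> r (\<lambda>h. chart_deriv (U \<times> V) ?c (p, h) S (u, 0)) w"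
    by (rule chart_deriv_prod_slice(1)[OF A B finite_dim_real U V sdd, symmetric])
  also have "\<dots> = chart_deriv V \<mu> r (\<lambda>h. chart_deriv U \<kappa> p (\<lambda>k. S (k, h)) u) w"
  proof (rule fun_cong[OF chart_deriv_cong[OF B V]])
    show "openin (mtop \<B>) (M2 \<inter> V)" using M2 chart_openin[OF B V(1)] by blast
    show "chart_deriv (U \<times> V) ?c (p, q) S (u, 0) = chart_deriv U \<kappa> p (\<lambda>k. S (k, q)) u" if "q \<in> M2 \<inter> V" for q
      using chart_deriv_prod_slice(2)[OF A B finite_dim_real U V(1) _ N(3)] that M2(3) by auto
  qed (use M2 V in auto)
  finally show ?thesis .
qed

subsection \<open>Tangent vectors\<close>

lemma Cinf_const: "mfd \<A> \<Longrightarrow> (\<lambda>_. c) \<in> Cinf \<A>"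
  by (simp add: Cinf_iff smooth_at_const pts_model)

lemma Cinf_add: "mfd \<A> \<Longrightarrow> f \<in> Cinf \<A> \<Longrightarrow> g \<in> Cinf \<A> \<Longrightarrow> (\<lambda>q. f q + g q) \<in> Cinf \<A>"
  by (simp add: Cinf_iff smooth_at_add finite_dim_real)

lemma Cinf_mult: "mfd \<A> \<Longrightarrow> f \<in> Cinf \<A> \<Longrightarrow> g \<in> Cinf \<A> \<Longrightarrow> (\<lambda>q. f q * g q) \<in> Cinf \<A>"
  by (simp add: Cinf_iff smooth_at_bilinear finite_dim_real bounded_bilinear_mult)

lemma Cinf_sum: "mfd \<A> \<Longrightarrow> (\<And>i. i \<in> I \<Longrightarrow> f i \<in> Cinf \<A>) \<Longrightarrow> (\<lambda>q. \<Sum>i\<in>I. f i q) \<in> Cinf \<A>"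
  by (simp add: Cinf_iff smooth_at_sum finite_dim_real)

lemma Cinf_compose:
  assumes "mfd \<A>" "mfd \<B>" "f \<in> Cinf \<B>" "\<And>p. p \<in> pts \<A> \<Longrightarrow> smooth_at \<A> \<B> h p"
  shows "(\<lambda>q. f (h q)) \<in> Cinf \<A>"
  unfolding Cinf_iff[OF assms(1)]
proof
  fix p assume "p \<in> pts \<A>"
  from assms(4)[OF this] smooth_at_pts[OF assms(1)] assms(3)
  show "smooth_at \<A> model (\<lambda>q. f (h q)) p"
    by (intro smooth_at_compose[OF assms(1,2) mfd_model[OF finite_dim_real]]) (auto simp: Cinf_iff[OF assms(2)])
qed

text \<open>The closed set keeps products with functions that are smooth only on \<open>N\<close> smooth everywhere.\<close>

definition bump :: "('p, 'e::real_inner) atlas \<Rightarrow> 'p set \<Rightarrow> 'p \<Rightarrow> ('p \<Rightarrow> real) \<Rightarrow> bool" where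
  "bump \<A> N p \<beta> \<longleftrightarrow> \<beta> \<in> Cinf \<A> \<and> \<beta> p = 1 \<and>
     (\<exists>C. closedin (mtop \<A>) C \<and> C \<subseteq> N \<and> (\<forall>q. q \<notin> C \<longrightarrow> \<beta> q = 0))"

text \<open>The support is placed in the preimage of a closed coordinate ball. That ball is compact,
  hence so is its image in the manifold, and the Hausdorff property makes the image closed. Without
  closedness the extension by 0 could fail to be smooth at the boundary of the chart domain.\<close>

lemma bump_exists:
  fixes \<A> :: "('p, 'e::real_inner) atlas"
  assumes A: "mfd \<A>" and H: "Hausdorff_space (mtop \<A>)" and N: "openin (mtop \<A>) N" "p \<in> N"
  shows "\<exists>\<beta>. bump \<A> N p \<beta>"
proof -
  have "p \<in> pts \<A>" using N openin_subset topspace_mtop[OF A] by blast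
  then obtain U \<kappa> where U: "(U, \<kappa>) \<in> \<A>" "p \<in> U" using pts_chart by metis
  note fd = mfd_finite_dim[OF A] and inj = chart_inj[OF A U(1)]
  have NU: "openin (mtop \<A>) (N \<inter> U)" using N chart_openin[OF A U(1)] by blast
  have "open (\<kappa> ` (N \<inter> U))" by (rule open_chart_image[OF A U(1) NU]) simp
  moreover have "\<kappa> p \<in> \<kappa> ` (N \<inter> U)" using N U by blast
  ultimately obtain r where r: "r > 0" "cball (\<kappa> p) r \<subseteq> \<kappa> ` (N \<inter> U)"
    by (meson open_contains_cball)
  define C where "C = inv_into U \<kappa> ` cball (\<kappa> p) r"
  have CN: "C \<subseteq> N \<inter> U"
  proof
    fix q assume "q \<in> C"
    then obtain q' where "q' \<in> N \<inter> U" "q = inv_into U \<kappa> (\<kappa> q')" using r(2) by (auto simp: C_def)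
    then show "q \<in> N \<inter> U" using inj by simp
  qed
  have Ceq: "q \<in> C \<longleftrightarrow> \<kappa> q \<in> cball (\<kappa> p) r" if "q \<in> U" for q
  proof
    assume "q \<in> C"
    then obtain y where y: "y \<in> cball (\<kappa> p) r" "q = inv_into U \<kappa> y" by (auto simp: C_def)
    then have "y \<in> \<kappa> ` U" using r(2) by blast
    then show "\<kappa> q \<in> cball (\<kappa> p) r" using y by (simp add: f_inv_into_f)
  next
    assume "\<kappa> q \<in> cball (\<kappa> p) r"
    then show "q \<in> C" using that inj by (auto simp: C_def image_iff intro!: bexI[of _ "\<kappa> q"])
  qed
  have "continuous_map (top_of_set (\<kappa> ` U)) (mtop \<A>) (inv_into U \<kappa>)"
    unfolding continuous_map_def
  proof (intro conjI allI impI)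
    show "inv_into U \<kappa> \<in> topspace (top_of_set (\<kappa> ` U)) \<rightarrow> topspace (mtop \<A>)"
      using chart_subset_pts[OF U(1)] by (auto simp: topspace_mtop[OF A] inj)
    fix W assume W: "openin (mtop \<A>) W"
    have "{y \<in> topspace (top_of_set (\<kappa> ` U)). inv_into U \<kappa> y \<in> W} = \<kappa> ` (W \<inter> U)"
      using inj by (auto simp: image_iff)
    moreover have "openin (mtop \<A>) (W \<inter> U)" using W chart_openin[OF A U(1)] by blast
    then have "open (\<kappa> ` (W \<inter> U))" by (rule open_chart_image[OF A U(1)]) simp
    ultimately show "openin (top_of_set (\<kappa> ` U)) {y \<in> topspace (top_of_set (\<kappa> ` U)). inv_into U \<kappa> y \<in> W}"
      by (metis (no_types, lifting) image_mono inf_le2 open_subset)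
  qed
  moreover have "compactin (top_of_set (\<kappa> ` U)) (cball (\<kappa> p) r)"
    using r(2) finite_dim_compact_cball[OF fd] by (auto simp: compactin_subtopology)
  ultimately have "compactin (mtop \<A>) C" unfolding C_def using image_compactin by blast
  then have C: "closedin (mtop \<A>) C" using H compactin_imp_closedin by blast
  obtain g where g: "smooth_on UNIV g" "g (\<kappa> p) = 1" "\<And>y. r \<le> dist (\<kappa> p) y \<Longrightarrow> g y = (0::real)"
    using smooth_bump_exists[OF r(1), of "\<kappa> p"] by blast
  define \<beta> where "\<beta> q = (if q \<in> U then g (\<kappa> q) else 0)" for q
  have 0: "\<beta> q = 0" if "q \<notin> C" for q
    using that Ceq[of q] g(3)[of "\<kappa> q"] by (auto simp: \<beta>_def)
  have "smooth_at \<A> model \<beta> q" if q: "q \<in> pts \<A>" for q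
  proof (cases "q \<in> U")
    case True
    have "smooth_at \<A> model (\<lambda>q. g (\<kappa> q)) q"
      by (rule smooth_at_model_map[OF A fd finite_dim_real g(1) open_UNIV UNIV_I smooth_at_chart[OF A U(1) True]])
    then show ?thesis
      by (rule smooth_at_cong[OF A _ chart_openin[OF A U(1)] True]) (simp add: \<beta>_def)
  next
    case False
    show ?thesis
    proof (rule smooth_at_cong[OF A smooth_at_const[OF A q, of 0]])
      show "openin (mtop \<A>) (topspace (mtop \<A>) - C)" using C by blast
      show "q \<in> topspace (mtop \<A>) - C" using False q CN by (auto simp: topspace_mtop[OF A])
    qed (auto simp: 0 pts_model)
  qed
  moreover have "\<beta> p = 1" using g(2) U(2) by (simp add: \<beta>_def)
  ultimately have b: "bump \<A> N p \<beta>" using C CN 0 by (auto simp: bump_def Cinf_iff[OF A] intro!: exI[of _ C])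
  show ?thesis by (rule exI[of _ \<beta>], rule b)
qed

lemma bump_smooth_at:
  fixes f g :: "'p \<Rightarrow> 'f::real_inner"
  assumes A: "mfd (\<A> :: ('p, 'e::real_inner) atlas)" and fd: "finite_dim TYPE('f)" 
    and b: "bump \<A> N p \<beta>" and f: "\<And>q. q \<in> N \<Longrightarrow> q \<in> pts \<A> \<Longrightarrow> smooth_at \<A> model f q" and q: "q \<in> pts \<A>"
  shows "smooth_at \<A> model (\<lambda>q. \<beta> q *\<^sub>R f q) q"
proof -
  obtain C where C: "closedin (mtop \<A>) C" "C \<subseteq> N" "\<And>q. q \<notin> C \<Longrightarrow> \<beta> q = 0" and \<beta>: "\<beta> \<in> Cinf \<A>"
    using b by (auto simp: bump_def)
  show ?thesis
  proof (cases "q \<in> N")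
    case True
    then show ?thesis using \<beta> f q
      by (intro smooth_at_bilinear[OF A finite_dim_real fd fd bounded_bilinear_scaleR]) (auto simp: Cinf_iff[OF A])
  next
    case False
    show ?thesis
    proof (rule smooth_at_cong[OF A smooth_at_const[OF A q, of 0]])
      show "openin (mtop \<A>) (topspace (mtop \<A>) - C)" using C by blast
      show "q \<in> topspace (mtop \<A>) - C" using False q C by (auto simp: topspace_mtop[OF A])
    qed (auto simp: C pts_model)
  qed
qed

section \<open>Derivations and their coordinate form\<close>

lemma
  assumes "v \<in> tangent \<A> p" "f \<in> Cinf \<A>"
  shows tangent_add: "g \<in> Cinf \<A> \<Longrightarrow> v (\<lambda>q. f q + g q) = v f + v g"
    and tangent_mult: "g \<in> Cinf \<A> \<Longrightarrow> v (\<lambda>q. f q * g q) = f p * v g + g p * v f"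
    and tangent_scale: "v (\<lambda>q. c * f q) = c * v f"
  using assms by (auto simp: tangent_def)

lemma tangent_off_Cinf: "v \<in> tangent \<A> p \<Longrightarrow> f \<notin> Cinf \<A> \<Longrightarrow> v f = 0"
  by (auto simp: tangent_def)

lemma tangent_sum:
  assumes A: "mfd \<A>" and v: "v \<in> tangent \<A> p" and f: "\<And>i. i \<in> I \<Longrightarrow> f i \<in> Cinf \<A>"
  shows "v (\<lambda>q. \<Sum>i\<in>I. f i q) = (\<Sum>i\<in>I. v (f i))"
proof -
  have "v (\<lambda>q. 0 * (\<lambda>_. 0) q) = 0 * v (\<lambda>_. 0)"
    using v Cinf_const[OF A] by (rule tangent_scale)
  then have "v (\<lambda>_. 0) = 0" by simp
  then show ?thesis using f
  proof (induction I rule: infinite_finite_induct)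
    case (insert i I)
    then have "v (\<lambda>q. f i q + (\<Sum>i\<in>I. f i q)) = v (f i) + v (\<lambda>q. \<Sum>i\<in>I. f i q)"
      by (intro tangent_add[OF v] Cinf_sum[OF A]) auto
    with insert show ?case by simp
  qed simp_all
qed

text \<open>Near \<open>p\<close>, Hadamard's lemma writes \<open>f\<close> as a constant plus a sum
  of coordinate functions that vanish at \<open>p\<close> times smooth factors. By the Leibniz rule
  only the values of \<open>v\<close> on the coordinate functions survive, and these are the
  components of \<open>w\<close>.\<close>

lemma tangent_coord:
  assumes A: "mfd (\<A> :: ('p, 'e::real_inner) atlas)" and H: "Hausdorff_space (mtop \<A>)"
    and U: "(U, \<kappa>) \<in> \<A>" "p \<in> U" and v: "v \<in> tangent \<A> p"
  shows "\<exists>w. \<forall>f\<in>Cinf \<A>. v f = chart_deriv U \<kappa> p f w"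
proof -
  note fd = mfd_finite_dim[OF A] and inj = chart_inj[OF A U(1)]
  define e where "e = \<kappa> p"
  have op: "open (\<kappa> ` U)" using open_chart_image[OF A U(1) chart_openin[OF A U(1)]] by simp
  then obtain r where r: "r > 0" "ball e r \<subseteq> \<kappa> ` U"
    using U(2) unfolding e_def by (meson imageI open_contains_ball)
  define N where "N = {q \<in> U. \<kappa> q \<in> ball e r}"
  have N: "openin (mtop \<A>) N" "p \<in> N"
    using openin_chart_preimage[OF A U(1) open_ball] U r by (auto simp: N_def e_def)
  obtain \<beta> where \<beta>: "bump \<A> N p \<beta>" using bump_exists[OF A H N] by blast
  have \<beta>C: "\<beta> \<in> Cinf \<A>" "\<beta> p = 1" and \<beta>0: "\<And>q. q \<notin> N \<Longrightarrow> \<beta> q = 0" using \<beta> by (auto simp: bump_def)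
  have sm: "(\<lambda>q. \<beta> q * g (\<kappa> q)) \<in> Cinf \<A>" if "smooth_on (ball e r) g" for g
  proof -
    have "smooth_at \<A> model (\<lambda>q. \<beta> q *\<^sub>R g (\<kappa> q)) q" if q: "q \<in> pts \<A>" for q
    proof (rule bump_smooth_at[OF A finite_dim_real \<beta> _ q])
      fix q assume "q \<in> N"
      then show "smooth_at \<A> model (\<lambda>q. g (\<kappa> q)) q"
        by (intro smooth_at_model_map[OF A fd finite_dim_real \<open>smooth_on (ball e r) g\<close> open_ball _ smooth_at_chart[OF A U(1)]])
           (auto simp: N_def)
    qed
    then show ?thesis by (simp add: Cinf_iff[OF A])
  qed
  \<comment> \<open>The coordinates centred at \<open>p\<close>, cut off by the bump function so
    that they lie in \<open>Cinf \<A>\<close>.\<close>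
  define x where "x b q = \<beta> q * ((\<kappa> q + - e) \<bullet> b)" for b q
  have x: "x b \<in> Cinf \<A>" "x b p = 0" for b
  proof -
    have "smooth_on (ball e r) (\<lambda>y. (y + - e) \<bullet> b)"
      by (intro smooth_on_linear_compose[OF bounded_linear_inner_left] smooth_on_add open_ball
          smooth_on_const smooth_on_linear bounded_linear_ident)
    from sm[OF this] show "x b \<in> Cinf \<A>" by (simp add: x_def[abs_def])
  qed (simp add: x_def e_def)
  note vmul = tangent_mult[OF v] and vadd = tangent_add[OF v]
  have vconst: "v (\<lambda>_. c) = 0" for c
  proof -
    have "v (\<lambda>q. (\<lambda>_. 1) q * (\<lambda>_. 1) q) = 1 * v (\<lambda>_. 1) + 1 * v (\<lambda>_. 1)"
      using vmul[OF Cinf_const[OF A] Cinf_const[OF A], of 1 1] by simp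
    then have "v (\<lambda>_. 1) = 0" by simp
    moreover have "v (\<lambda>q. c * (\<lambda>_. 1) q) = c * v (\<lambda>_. 1)"
      using v Cinf_const[OF A] by (rule tangent_scale)
    ultimately show ?thesis by simp
  qed
  have "v f = chart_deriv U \<kappa> p f (\<Sum>b\<in>onb. v (x b) *\<^sub>R b)" if f: "f \<in> Cinf \<A>" for f
  proof -
    define F where "F = f \<circ> inv_into U \<kappa>"
    have "smooth_on (\<kappa> ` U) F" using f U by (auto simp: Cinf_def F_def)
    then have "smooth_on (ball e r) F" using r(2) by (rule smooth_on_mono)
    from hadamard[OF fd this] obtain g where g: "\<And>b. smooth_on (ball e r) (g b)"
      "\<And>b. g b e = frechet_derivative F (at e) b"
      "\<And>y. y \<in> ball e r \<Longrightarrow> F y = F e + (\<Sum>b\<in>onb. ((y - e) \<bullet> b) * g b y)" by blast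
    define G where "G b q = \<beta> q * g b (\<kappa> q)" for b q
    have G: "G b \<in> Cinf \<A>" "G b p = chart_deriv U \<kappa> p f b" for b
      using sm[OF g(1)[of b]] g(2)[of b] \<beta>C by (auto simp: G_def[abs_def] chart_deriv_def F_def e_def)
    have Fe: "F e = f p" using inj U by (simp add: F_def e_def)
    define f0 where "f0 q = f q + - f p" for q
    have f0: "f0 \<in> Cinf \<A>" "f0 p = 0" "v f0 = v f"
      using Cinf_add[OF A f Cinf_const[OF A]] vadd[OF f Cinf_const[OF A]] vconst by (simp_all add: f0_def[abs_def] del: add_uminus_conv_diff)
    \<comment> \<open>One factor \<beta> globalises the coordinate functions, the other the Hadamard
      factors. Both leave \<open>v f\<close> unchanged, because \<beta> is 1 and \<open>f0\<close>
      is 0 at \<open>p\<close>.\<close>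
    have key: "\<beta> q * (\<beta> q * f0 q) = (\<Sum>b\<in>onb. x b q * G b q)" for q
    proof (cases "q \<in> N")
      case True
      then have "q \<in> U" "\<kappa> q \<in> ball e r" by (auto simp: N_def)
      with g(3)[of "\<kappa> q"] inj Fe have "f0 q = (\<Sum>b\<in>onb. ((\<kappa> q - e) \<bullet> b) * g b (\<kappa> q))"
        by (simp add: F_def f0_def)
      then show ?thesis by (simp add: x_def G_def sum_distrib_left mult_ac)
    qed (simp add: \<beta>0 x_def)
    have "v f = v (\<lambda>q. \<beta> q * (\<beta> q * f0 q))"
      using f0 \<beta>C by (simp add: vmul Cinf_mult[OF A])
    also have "\<dots> = (\<Sum>b\<in>onb. v (\<lambda>q. x b q * G b q))"
      unfolding key by (rule tangent_sum[OF A v]) (intro Cinf_mult A x G)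
    also have "\<dots> = (\<Sum>b\<in>onb. v (x b) *\<^sub>R chart_deriv U \<kappa> p f b)"
      by (intro sum.cong refl) (simp add: vmul x G)
    also have "\<dots> = chart_deriv U \<kappa> p f (\<Sum>b\<in>onb. v (x b) *\<^sub>R b)"
    proof -
      have "linear (chart_deriv U \<kappa> p f)"
        using U chart_subset_pts[OF U(1)] f by (intro chart_deriv_linear[OF A finite_dim_real U]) (auto simp: Cinf_iff[OF A])
      then show ?thesis by (simp add: linear_sum linear_scale)
    qed
    finally show ?thesis .
  qed
  then show ?thesis by blast
qed

lemma coord_tangent:
  assumes A: "mfd (\<A> :: ('p, 'e::real_inner) atlas)" and U: "(U, \<kappa>) \<in> \<A>" "p \<in> U"
  shows "(\<lambda>f. if f \<in> Cinf \<A> then chart_deriv U \<kappa> p f w else 0) \<in> tangent \<A> p"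
proof -
  have sm: "smooth_at \<A> model f p" if "f \<in> Cinf \<A>" for f
    using that U chart_subset_pts[OF U(1)] by (auto simp: Cinf_iff[OF A])
  have c: "(\<lambda>q. c * f q) \<in> Cinf \<A>" if "f \<in> Cinf \<A>" for c f
    using Cinf_mult[OF A Cinf_const[OF A] that] .
  show ?thesis unfolding tangent_def
    using chart_deriv_linear_compose[OF A finite_dim_real U bounded_linear_mult_right sm]
    by (auto simp: Cinf_add[OF A] Cinf_mult[OF A] c chart_deriv_add[OF A finite_dim_real U sm sm]
        chart_deriv_bilinear[OF A U finite_dim_real finite_dim_real bounded_bilinear_mult sm sm])
qed

lemma push_tangent:
  assumes A: "mfd \<A>" and B: "mfd \<B>" and h: "\<And>q. q \<in> pts \<A> \<Longrightarrow> smooth_at \<A> \<B> h q"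
    and v: "v \<in> tangent \<A> p"
  shows "push \<B> h v \<in> tangent \<B> (h p)"
proof -
  have c: "f \<circ> h \<in> Cinf \<A>" if "f \<in> Cinf \<B>" for f
    using Cinf_compose[OF A B that h] by (simp add: comp_def)
  have s: "(\<lambda>q. c * f q) \<in> Cinf \<B>" if "f \<in> Cinf \<B>" for c f
    using Cinf_mult[OF B Cinf_const[OF B] that] .
  have "v ((\<lambda>q. f q + g q) \<circ> h) = v (f \<circ> h) + v (g \<circ> h)"
    "v ((\<lambda>q. f q * g q) \<circ> h) = f (h p) * v (g \<circ> h) + g (h p) * v (f \<circ> h)"
    "v ((\<lambda>q. a * f q) \<circ> h) = a * v (f \<circ> h)"
    if "f \<in> Cinf \<B>" "g \<in> Cinf \<B>" for f g a
    using v c[OF that(1)] c[OF that(2)] unfolding tangent_def by (simp_all add: comp_def)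
  then show ?thesis
    unfolding tangent_def push_def by (simp add: Cinf_add[OF B] Cinf_mult[OF B] s)
qed

section \<open>Vector bundles and their duals\<close>

text \<open>Weaker than \<open>vector_bundle\<close>, so that the dual bundle is an instance.\<close>

definition is_bundle :: "('m, 'e::real_inner, 'a, 'f::real_inner) vbundle \<Rightarrow> bool" where
  "is_bundle E \<longleftrightarrow> mfd (base E) \<and> Hausdorff_space (mtop (base E)) \<and> finite_dim TYPE('f) \<and>
     proj E ` total E \<subseteq> pts (base E) \<and>
     (\<Union>(W, \<theta>)\<in>trivs E. W) = pts (base E) \<and>
     (\<forall>(W, \<theta>)\<in>trivs E. openin (mtop (base E)) W \<and>
        (\<forall>x\<in>W. bij_betw \<theta> (fib E x) UNIV \<and>
          (\<forall>a\<in>fib E x. \<forall>b\<in>fib E x. fadd E a b \<in> fib E x \<and> \<theta> (fadd E a b) = \<theta> a + \<theta> b) \<and>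
          (\<forall>c. \<forall>a\<in>fib E x. fscale E c a \<in> fib E x \<and> \<theta> (fscale E c a) = c *\<^sub>R \<theta> a))) \<and>
     mfd (total_atlas E)"

lemma vector_bundle_bundle: "vector_bundle E \<Longrightarrow> is_bundle E"
  unfolding vector_bundle_def is_bundle_def
  by (elim conjE, intro conjI smooth_manifold_mfd, simp_all only: smooth_manifold_def)

definition lift :: "('m, 'e, 'a, 'f) vbundle \<Rightarrow> ('a \<Rightarrow> 'f) \<Rightarrow> 'm \<Rightarrow> 'f \<Rightarrow> 'a" where
  "lift E \<theta> x = inv_into (fib E x) \<theta>"

text \<open>Names the trivialisation that \<open>dual_bundle\<close> induces from \<theta>: the
  vector that represents the covector, in the coordinates given by \<theta>, through the inner
  product.\<close>

definition dtriv :: "('m, 'e, 'a, 'f::real_inner) vbundle \<Rightarrow> ('a \<Rightarrow> 'f) \<Rightarrow> 'm \<times> ('a \<Rightarrow> real) \<Rightarrow> 'f" where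
  "dtriv E \<theta> = (\<lambda>(x, \<alpha>). THE w. \<forall>v. w \<bullet> v = \<alpha> (lift E \<theta> x v))"

lemma dual_bundle_simps:
  "base (dual_bundle E) = base E" "total (dual_bundle E) = (SIGMA x:pts (base E). dual_fib E x)"
  "proj (dual_bundle E) = fst"
  "fadd (dual_bundle E) (x, \<alpha>) (y, \<beta>) = (x, \<lambda>a. \<alpha> a + \<beta> a)"
  "fscale (dual_bundle E) c (x, \<alpha>) = (x, \<lambda>a. c * \<alpha> a)"
  "trivs (dual_bundle E) = {(W, dtriv E \<theta>) | W \<theta>. (W, \<theta>) \<in> trivs E}"
  by (simp_all add: dual_bundle_def dtriv_def lift_def)

lemma dual_fib_D:
  assumes "\<alpha> \<in> dual_fib E x"
  shows "a \<in> fib E x \<Longrightarrow> b \<in> fib E x \<Longrightarrow> \<alpha> (fadd E a b) = \<alpha> a + \<alpha> b"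
    and "a \<in> fib E x \<Longrightarrow> \<alpha> (fscale E c a) = c * \<alpha> a"
    and "a \<notin> fib E x \<Longrightarrow> \<alpha> a = 0"
  using assms by (auto simp: dual_fib_def)

lemma fib_D: "a \<in> fib E x \<Longrightarrow> a \<in> total E" "a \<in> fib E x \<Longrightarrow> proj E a = x"
  by (auto simp: fib_def)

lemma fib_dual: "x \<in> pts (base E) \<Longrightarrow> fib (dual_bundle E) x = {x} \<times> dual_fib E x"
  by (auto simp: fib_def dual_bundle_simps)

lemma sections_smooth_at:
  "mfd (base E) \<Longrightarrow> mfd (total_atlas E) \<Longrightarrow> X \<in> sections E \<Longrightarrow> x \<in> pts (base E) \<Longrightarrow>
    smooth_at (base E) (total_atlas E) X x"
  by (simp add: sections_def smooth_map_iff)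

locale vb =
  fixes E :: "('m, 'e::real_inner, 'a, 'f::real_inner) vbundle"
  assumes bdl: "is_bundle E"
begin

abbreviation "M \<equiv> base E"
abbreviation "T \<equiv> total_atlas E"
abbreviation "D \<equiv> dual_bundle E"

lemma mfd_base: "mfd M" and hausdorff_base: "Hausdorff_space (mtop M)" and finite_dim_fibre: "finite_dim TYPE('f)" and mfd_total: "mfd T"
  and proj_pts: "a \<in> total E \<Longrightarrow> proj E a \<in> pts M"
  using bdl by (auto simp: is_bundle_def)

lemma triv_exists: "x \<in> pts M \<Longrightarrow> \<exists>W \<theta>. (W, \<theta>) \<in> trivs E \<and> x \<in> W"
proof -
  assume "x \<in> pts M"
  moreover have "(\<Union>(W, \<theta>)\<in>trivs E. W) = pts M" using bdl unfolding is_bundle_def by blast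
  ultimately have "x \<in> (\<Union>(W, \<theta>)\<in>trivs E. W)" by simp
  then show ?thesis by auto
qed

lemma triv_open: "(W, \<theta>) \<in> trivs E \<Longrightarrow> openin (mtop M) W"
  using bdl by (auto simp: is_bundle_def)

lemma triv_pts: "(W, \<theta>) \<in> trivs E \<Longrightarrow> W \<subseteq> pts M"
  using bdl unfolding is_bundle_def by blast

lemma triv_props:
  assumes "(W, \<theta>) \<in> trivs E" "x \<in> W"
  shows "bij_betw \<theta> (fib E x) UNIV"
    and "a \<in> fib E x \<Longrightarrow> b \<in> fib E x \<Longrightarrow> fadd E a b \<in> fib E x"
    and "a \<in> fib E x \<Longrightarrow> b \<in> fib E x \<Longrightarrow> \<theta> (fadd E a b) = \<theta> a + \<theta> b"
    and "a \<in> fib E x \<Longrightarrow> fscale E c a \<in> fib E x"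
    and "a \<in> fib E x \<Longrightarrow> \<theta> (fscale E c a) = c *\<^sub>R \<theta> a"
proof -
  have "\<forall>x\<in>W. bij_betw \<theta> (fib E x) UNIV \<and>
          (\<forall>a\<in>fib E x. \<forall>b\<in>fib E x. fadd E a b \<in> fib E x \<and> \<theta> (fadd E a b) = \<theta> a + \<theta> b) \<and>
          (\<forall>c. \<forall>a\<in>fib E x. fscale E c a \<in> fib E x \<and> \<theta> (fscale E c a) = c *\<^sub>R \<theta> a)"
    using bdl assms(1) unfolding is_bundle_def by blast
  then show "bij_betw \<theta> (fib E x) UNIV"
    "a \<in> fib E x \<Longrightarrow> b \<in> fib E x \<Longrightarrow> fadd E a b \<in> fib E x"
    "a \<in> fib E x \<Longrightarrow> b \<in> fib E x \<Longrightarrow> \<theta> (fadd E a b) = \<theta> a + \<theta> b"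
    "a \<in> fib E x \<Longrightarrow> fscale E c a \<in> fib E x"
    "a \<in> fib E x \<Longrightarrow> \<theta> (fscale E c a) = c *\<^sub>R \<theta> a"
    using assms(2) by auto
qed

lemma triv_inj:
  assumes "(W, \<theta>) \<in> trivs E" "x \<in> W" "a \<in> fib E x" "b \<in> fib E x" "\<theta> a = \<theta> b"
  shows "a = b"
  using triv_props(1)[OF assms(1,2)] assms(3-5) by (auto simp: bij_betw_def inj_on_def)

lemma lift_fib: "(W, \<theta>) \<in> trivs E \<Longrightarrow> x \<in> W \<Longrightarrow> lift E \<theta> x v \<in> fib E x"
  using triv_props(1)[of W \<theta> x] unfolding lift_def bij_betw_def by (metis UNIV_I inv_into_into)

lemma triv_lift: "(W, \<theta>) \<in> trivs E \<Longrightarrow> x \<in> W \<Longrightarrow> \<theta> (lift E \<theta> x v) = v"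
  using triv_props(1)[of W \<theta> x] unfolding lift_def bij_betw_def by (metis UNIV_I f_inv_into_f)

lemma lift_triv: "(W, \<theta>) \<in> trivs E \<Longrightarrow> x \<in> W \<Longrightarrow> a \<in> fib E x \<Longrightarrow> lift E \<theta> x (\<theta> a) = a"
  by (meson lift_fib triv_inj triv_lift)

lemma
  assumes W: "(W, \<theta>) \<in> trivs E" "x \<in> W"
  shows lift_add: "lift E \<theta> x (v + w) = fadd E (lift E \<theta> x v) (lift E \<theta> x w)"
    and lift_scale: "lift E \<theta> x (c *\<^sub>R v) = fscale E c (lift E \<theta> x v)"
  by (rule triv_inj[OF W]; simp add: lift_fib[OF W] triv_lift[OF W] triv_props[OF W])+

text \<open>All trivialisations share the zero of a fibre, so that sections can be extended by
  zero.\<close>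

lemma lift_zero_unique:
  assumes "(W, \<theta>) \<in> trivs E" "x \<in> W" "(W', \<theta>') \<in> trivs E" "x \<in> W'"
  shows "lift E \<theta> x 0 = lift E \<theta>' x 0"
proof -
  let ?z = "lift E \<theta> x 0"
  have z: "?z \<in> fib E x" using assms by (simp add: lift_fib)
  \<comment> \<open>The bundle record has no zero vector; it is characterised by being its own
    multiple by 0, which every trivialisation must map to 0.\<close>
  have "fscale E 0 ?z = ?z"
    using assms z by (intro triv_inj[OF assms(1,2)]) (auto simp: triv_props triv_lift)
  then have "\<theta>' ?z = 0" using triv_props(5)[OF assms(3,4) z, of 0] by simp
  then show ?thesis using lift_triv[OF assms(3,4) z] by simp
qed

lemma total_chart:
  "(U, \<kappa>) \<in> M \<Longrightarrow> (W, \<theta>) \<in> trivs E \<Longrightarrow>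
    ({a \<in> total E. proj E a \<in> U \<inter> W}, \<lambda>a. (\<kappa> (proj E a), \<theta> a)) \<in> T"
  unfolding total_atlas_def by blast

lemma pts_total: "pts T = total E"
proof (intro equalityI subsetI)
  show "a \<in> total E" if "a \<in> pts T" for a
    using that by (auto simp: pts_def total_atlas_def)
  fix a assume a: "a \<in> total E"
  obtain U \<kappa> W \<theta> where U: "(U, \<kappa>) \<in> M" "proj E a \<in> U" and W: "(W, \<theta>) \<in> trivs E" "proj E a \<in> W"
    using proj_pts[OF a] pts_chart triv_exists by metis
  show "a \<in> pts T" using chart_subset_pts[OF total_chart[OF U(1) W(1)]] a U(2) W(2) by auto
qed

lemma
  assumes a: "a \<in> total E" and W: "(W, \<theta>) \<in> trivs E" "proj E a \<in> W"
  shows smooth_at_proj: "smooth_at T M (proj E) a"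
    and smooth_at_triv: "smooth_at T model \<theta> a"
proof -
  obtain U \<kappa> where U: "(U, \<kappa>) \<in> M" "proj E a \<in> U" using proj_pts[OF a] pts_chart by metis
  let ?D = "{a \<in> total E. proj E a \<in> U \<inter> W}" and ?c = "\<lambda>a. (\<kappa> (proj E a), \<theta> a)"
  have aD: "a \<in> ?D" using a U W by simp
  note c = total_chart[OF U(1) W(1)] and fM = mfd_finite_dim[OF mfd_base]
  have sm: "smooth_at T model ?c a" by (rule smooth_at_chart[OF mfd_total c aD])
  show "smooth_at T model \<theta> a"
    using smooth_at_linear[OF mfd_total finite_dim_prod[OF fM finite_dim_fibre] finite_dim_fibre bounded_linear_snd sm] by simp
  have "smooth_at T model (\<lambda>a. \<kappa> (proj E a)) a"
    using smooth_at_linear[OF mfd_total finite_dim_prod[OF fM finite_dim_fibre] fM bounded_linear_fst sm] by simp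
  from smooth_at_compose[OF mfd_total mfd_model[OF fM] mfd_base this smooth_at_chart_inv[OF mfd_base U]]
  have "smooth_at T M (\<lambda>a. inv_into U \<kappa> (\<kappa> (proj E a))) a" .
  then show "smooth_at T M (proj E) a"
    by (rule smooth_at_cong[OF mfd_total _ chart_openin[OF mfd_total c] aD]) (simp add: chart_inj[OF mfd_base U(1)])
qed

lemma smooth_at_proj': "a \<in> total E \<Longrightarrow> smooth_at T M (proj E) a"
  using smooth_at_proj triv_exists[OF proj_pts] by blast

text \<open>Charts of the total space pair a base chart with a trivialisation, so \<open>h\<close>
  is recovered from its two components by an inverse chart. The set \<open>N\<close> is needed
  because the components do not reveal whether \<open>h q\<close> belongs to
  \<open>total E\<close>.\<close>

lemma smooth_at_into_total:
  fixes \<A> :: "('p, 'h::real_inner) atlas"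
  assumes A: "mfd \<A>" and W: "(W, \<theta>) \<in> trivs E" "proj E (h p) \<in> W"
    and ph: "smooth_at \<A> M (\<lambda>q. proj E (h q)) p" and th: "smooth_at \<A> model (\<lambda>q. \<theta> (h q)) p"
    and N: "openin (mtop \<A>) N" "p \<in> N" "\<And>q. q \<in> N \<Longrightarrow> h q \<in> total E"
  shows "smooth_at \<A> T h p"
proof -
  note fM = mfd_finite_dim[OF mfd_base]
  obtain U \<kappa> where U: "(U, \<kappa>) \<in> M" "proj E (h p) \<in> U"
    using proj_pts[OF N(3)[OF N(2)]] pts_chart by metis
  let ?D = "{a \<in> total E. proj E a \<in> U \<inter> W}" and ?c = "\<lambda>a. (\<kappa> (proj E a), \<theta> a)"
  note c = total_chart[OF U(1) W(1)]
  have pD: "h p \<in> ?D" using N U W by simp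
  have "smooth_at \<A> model (\<lambda>q. \<kappa> (proj E (h q))) p"
    by (rule smooth_at_compose[OF A mfd_base mfd_model[OF fM] ph smooth_at_chart[OF mfd_base U]])
  from smooth_at_model_Pair[OF A fM finite_dim_fibre this th]
  have "smooth_at \<A> model (\<lambda>q. ?c (h q)) p" .
  from smooth_at_compose[OF A mfd_model[OF finite_dim_prod[OF fM finite_dim_fibre]] mfd_total this smooth_at_chart_inv[OF mfd_total c pD]]
  have sm: "smooth_at \<A> T (\<lambda>q. inv_into ?D ?c (?c (h q))) p" .
  have "openin (mtop M) (U \<inter> W)" using chart_openin[OF mfd_base U(1)] triv_open[OF W(1)] by blast
  then obtain N' where N': "openin (mtop \<A>) N'" "p \<in> N'" "(\<lambda>q. proj E (h q)) ` N' \<subseteq> U \<inter> W"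
    using smooth_at_continuous[OF A mfd_base ph] U W by blast
  show ?thesis
  proof (rule smooth_at_cong[OF A sm])
    show "openin (mtop \<A>) (N \<inter> N')" using N N' by blast
    show "inv_into ?D ?c (?c (h q)) = h q" if "q \<in> N \<inter> N'" for q
      using that N(3) N'(3) by (intro inv_into_f_f[OF chart_inj[OF mfd_total c]]) auto
  qed (use N N' in auto)
qed

lemma smooth_at_lift:
  fixes \<A> :: "('p, 'h::real_inner) atlas"
  assumes A: "mfd \<A>" and W: "(W, \<theta>) \<in> trivs E" "f p \<in> W"
    and f: "smooth_at \<A> M f p" and g: "smooth_at \<A> model g p"
  shows "smooth_at \<A> T (\<lambda>q. lift E \<theta> (f q) (g q)) p"
proof -
  obtain N where N: "openin (mtop \<A>) N" "p \<in> N" "f ` N \<subseteq> W"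
    using smooth_at_continuous[OF A mfd_base f triv_open[OF W(1)] W(2)] .
  have l: "lift E \<theta> (f q) (g q) \<in> fib E (f q)" "\<theta> (lift E \<theta> (f q) (g q)) = g q" if "q \<in> N" for q
    using N(3) that W(1) by (auto intro!: lift_fib triv_lift)
  show ?thesis
  proof (rule smooth_at_into_total[OF A W(1) _ _ _ N(1,2)])
    show "smooth_at \<A> M (\<lambda>q. proj E (lift E \<theta> (f q) (g q))) p"
      by (rule smooth_at_cong[OF A f N(1,2)]) (use l fib_D in fastforce)
    show "smooth_at \<A> model (\<lambda>q. \<theta> (lift E \<theta> (f q) (g q))) p"
      by (rule smooth_at_cong[OF A g N(1,2)]) (simp add: l)
    show "proj E (lift E \<theta> (f p) (g p)) \<in> W" using l(1)[OF N(2)] W(2) fib_D by fastforce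
    show "lift E \<theta> (f q) (g q) \<in> total E" if "q \<in> N" for q using l(1)[OF that] fib_D by fastforce
  qed
qed

text \<open>Points over different base points are separated by the base, points of one fibre by a
  common chart. Derived from \<open>is_bundle\<close>, it holds for the dual bundle too, where
  \<open>tangent_coord\<close> requires it.\<close>

lemma hausdorff_total: "Hausdorff_space (mtop T)"
  unfolding Hausdorff_space_def
proof (intro allI impI, elim conjE)
  fix a b assume ab: "a \<in> topspace (mtop T)" "b \<in> topspace (mtop T)" "a \<noteq> b"
  then have t: "a \<in> total E" "b \<in> total E" by (simp_all add: topspace_mtop[OF mfd_total] pts_total)
  show "\<exists>U V. openin (mtop T) U \<and> openin (mtop T) V \<and> a \<in> U \<and> b \<in> V \<and> disjnt U V"
  proof (cases "proj E a = proj E b")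
    case False
    then obtain S S' where S: "openin (mtop M) S" "openin (mtop M) S'" "proj E a \<in> S" "proj E b \<in> S'" "disjnt S S'"
      using hausdorff_base proj_pts[OF t(1)] proj_pts[OF t(2)]
      unfolding Hausdorff_space_def by (metis topspace_mtop[OF mfd_base])
    obtain N where N: "openin (mtop T) N" "a \<in> N" "proj E ` N \<subseteq> S"
      using smooth_at_continuous[OF mfd_total mfd_base smooth_at_proj'[OF t(1)] S(1,3)] .
    obtain N' where N': "openin (mtop T) N'" "b \<in> N'" "proj E ` N' \<subseteq> S'"
      using smooth_at_continuous[OF mfd_total mfd_base smooth_at_proj'[OF t(2)] S(2,4)] .
    have "disjnt N N'" using N(3) N'(3) S(5) by (fastforce simp: disjnt_def)
    then show ?thesis using N N' by blast
  next
    case True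
    obtain U \<kappa> W \<theta> where U: "(U, \<kappa>) \<in> M" "proj E a \<in> U" and W: "(W, \<theta>) \<in> trivs E" "proj E a \<in> W"
      using proj_pts[OF t(1)] pts_chart triv_exists by metis
    let ?D = "{a \<in> total E. proj E a \<in> U \<inter> W}" and ?c = "\<lambda>a. (\<kappa> (proj E a), \<theta> a)"
    note c = total_chart[OF U(1) W(1)]
    have D: "a \<in> ?D" "b \<in> ?D" using t U W True by auto
    then have "?c a \<noteq> ?c b" using chart_inj[OF mfd_total c] ab(3) unfolding inj_on_def by blast
    then obtain S S' where "open S" "open S'" "?c a \<in> S" "?c b \<in> S'" "S \<inter> S' = {}"
      using hausdorff[of "?c a" "?c b"] by blast
    then show ?thesis
      using D openin_chart_preimage[OF mfd_total c, of S] openin_chart_preimage[OF mfd_total c, of S']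
      by (intro exI[of _ "{q \<in> ?D. ?c q \<in> S}"] exI[of _ "{q \<in> ?D. ?c q \<in> S'}"]) (auto simp: disjnt_def)
  qed
qed

lemma section_fib: "X \<in> sections E \<Longrightarrow> x \<in> pts M \<Longrightarrow> X x \<in> fib E x"
  using smooth_at_pts[OF mfd_base sections_smooth_at[OF mfd_base mfd_total]] by (auto simp: sections_def fib_def pts_total)

lemma section_smooth_at: "X \<in> sections E \<Longrightarrow> x \<in> pts M \<Longrightarrow> smooth_at M T X x"
  by (rule sections_smooth_at[OF mfd_base mfd_total])

text \<open>Take the section that is constant in a trivialisation, multiply it by a bump function
  and extend it by zero.\<close>

lemma section_through:
  assumes x: "x \<in> pts M" and a: "a \<in> fib E x"
  shows "\<exists>X\<in>sections E. X x = a"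
proof -
  obtain W \<theta> where W: "(W, \<theta>) \<in> trivs E" "x \<in> W" using triv_exists[OF x] by blast
  obtain \<beta> where \<beta>: "bump M W x \<beta>" using bump_exists[OF mfd_base hausdorff_base triv_open[OF W(1)] W(2)] by blast
  then obtain C where C: "closedin (mtop M) C" "C \<subseteq> W" "\<And>y. y \<notin> C \<Longrightarrow> \<beta> y = 0"
    and \<beta>C: "\<beta> \<in> Cinf M" "\<beta> x = 1" by (auto simp: bump_def)
  \<comment> \<open>The zero of the fibre over \<open>y\<close>; by \<open>lift_zero_unique\<close>
    the trivialisation that is picked does not matter.\<close>
  define z where "z y = (SOME z. \<exists>W' \<theta>'. (W', \<theta>') \<in> trivs E \<and> y \<in> W' \<and> z = lift E \<theta>' y 0)" for y
  have z: "z y = lift E \<theta>' y 0" if "(W', \<theta>') \<in> trivs E" "y \<in> W'" for W' \<theta>' y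
  proof -
    have "\<exists>W \<theta>. (W, \<theta>) \<in> trivs E \<and> y \<in> W \<and> z y = lift E \<theta> y 0"
      unfolding z_def by (rule someI_ex) (use that in blast)
    then show ?thesis using lift_zero_unique that by metis
  qed
  define X where "X = (\<lambda>y\<in>pts M. if y \<in> W then lift E \<theta> y (\<beta> y *\<^sub>R \<theta> a) else z y)"
  \<comment> \<open>Off the support \<open>C\<close>, inside \<open>W\<close> or not, the section is
    zero in every trivialisation. Near a point outside \<open>W\<close> it is therefore a smooth
    local zero section.\<close>
  have Xz: "X y = lift E \<theta>' y 0" if "(W', \<theta>') \<in> trivs E" "y \<in> W'" "y \<notin> C" for W' \<theta>' y
    using that triv_pts C(3)[OF that(3)] z[OF that(1,2)] lift_zero_unique[OF W(1) _ that(1,2)] by (auto simp: X_def)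
  have "smooth_at M T X y" if y: "y \<in> pts M" for y
  proof (cases "y \<in> W")
    case True
    have "smooth_at M model (\<lambda>y. \<beta> y *\<^sub>R \<theta> a) y"
      using \<beta>C(1) y by (intro smooth_at_bilinear[OF mfd_base finite_dim_real finite_dim_fibre finite_dim_fibre bounded_bilinear_scaleR] smooth_at_const[OF mfd_base])
        (auto simp: Cinf_iff[OF mfd_base] pts_model)
    from smooth_at_lift[OF mfd_base W(1) True smooth_at_ident[OF mfd_base y] this]
    show ?thesis
      by (rule smooth_at_cong[OF mfd_base _ triv_open[OF W(1)] True]) (use triv_pts[OF W(1)] in \<open>auto simp: X_def\<close>)
  next
    case False
    obtain W' \<theta>' where W': "(W', \<theta>') \<in> trivs E" "y \<in> W'" using triv_exists[OF y] by blast
    have "smooth_at M T (\<lambda>y. lift E \<theta>' y 0) y"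
      by (intro smooth_at_lift[OF mfd_base W' smooth_at_ident[OF mfd_base y]] smooth_at_const[OF mfd_base y]) (simp add: pts_model)
    then show ?thesis
    proof (rule smooth_at_cong[OF mfd_base])
      show "openin (mtop M) (W' - C)" using C triv_open[OF W'(1)] by blast
      show "y \<in> W' - C" using False W' C by auto
      show "lift E \<theta>' q 0 = X q" if "q \<in> W' - C" for q using Xz[OF W'(1)] that by auto
    qed
  qed
  moreover have "proj E (X y) = y" if y: "y \<in> pts M" for y
  proof -
    obtain W' \<theta>' where W': "(W', \<theta>') \<in> trivs E" "y \<in> W'" using triv_exists[OF y] by blast
    have "X y \<in> fib E y"
      using y lift_fib[OF W(1)] lift_fib[OF W'] by (simp add: X_def z[OF W'])
    then show ?thesis by (rule fib_D)
  qed
  ultimately have "X \<in> sections E"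
    by (simp add: sections_def smooth_map_iff[OF mfd_base mfd_total]) (simp add: X_def)
  moreover have "X x = a" using W x \<beta>C(2) a lift_triv by (simp add: X_def)
  ultimately show ?thesis by blast
qed

subsection \<open>The dual bundle\<close>

text \<open>The sum shows that the vector described by \<open>THE\<close> in \<open>dtriv\<close>
  exists, and nondegeneracy of the inner product makes it unique. The sum form is the one from which
  smoothness is read off.\<close>

lemma dtriv_eq:
  assumes W: "(W, \<theta>) \<in> trivs E" "x \<in> W" and \<alpha>: "\<alpha> \<in> dual_fib E x"
  shows "dtriv E \<theta> (x, \<alpha>) = (\<Sum>b\<in>onb. \<alpha> (lift E \<theta> x b) *\<^sub>R b)"
    and "dtriv E \<theta> (x, \<alpha>) \<bullet> v = \<alpha> (lift E \<theta> x v)"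
proof -
  define l where "l v = \<alpha> (lift E \<theta> x v)" for v
  have "linear l"
    using dual_fib_D[OF \<alpha>] lift_fib[OF W] by (intro linearI) (simp_all add: l_def lift_add[OF W] lift_scale[OF W])
  then have l: "(\<Sum>b\<in>onb. l b *\<^sub>R b) \<bullet> v = l v" for v
    unfolding linear_onb_expand[OF finite_dim_fibre \<open>linear l\<close>, of v] inner_sum_left
    by (intro sum.cong refl) (simp add: inner_commute)
  have "dtriv E \<theta> (x, \<alpha>) = (THE w. \<forall>v. w \<bullet> v = l v)" by (simp add: dtriv_def l_def)
  also have "\<dots> = (\<Sum>b\<in>onb. l b *\<^sub>R b)"
  proof (rule the_equality)
    show "w = (\<Sum>b\<in>onb. l b *\<^sub>R b)" if "\<forall>v. w \<bullet> v = l v" for w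
      using that l by (metis vector_eq_rdot)
  qed (simp add: l)
  finally show "dtriv E \<theta> (x, \<alpha>) = (\<Sum>b\<in>onb. \<alpha> (lift E \<theta> x b) *\<^sub>R b)" by (simp add: l_def)
  with l show "dtriv E \<theta> (x, \<alpha>) \<bullet> v = \<alpha> (lift E \<theta> x v)" by (simp add: l_def)
qed

lemma dtriv_pairing:
  assumes W: "(W, \<theta>) \<in> trivs E" "x \<in> W" and \<alpha>: "\<alpha> \<in> dual_fib E x" and a: "a \<in> fib E x"
  shows "\<alpha> a = dtriv E \<theta> (x, \<alpha>) \<bullet> \<theta> a"
  by (simp add: dtriv_eq(2)[OF W \<alpha>] lift_triv[OF W a])

lemma dtriv_inverse:
  assumes W: "(W, \<theta>) \<in> trivs E" "x \<in> W"
  defines "\<alpha> w \<equiv> \<lambda>a. if a \<in> fib E x then w \<bullet> \<theta> a else 0"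
  shows "\<alpha> w \<in> dual_fib E x" and "dtriv E \<theta> (x, \<alpha> w) = w"
proof -
  show d: "\<alpha> w \<in> dual_fib E x"
    using triv_props[OF W] by (auto simp: dual_fib_def \<alpha>_def inner_add_right)
  have "dtriv E \<theta> (x, \<alpha> w) \<bullet> v = w \<bullet> v" for v
    unfolding dtriv_eq(2)[OF W d] using lift_fib[OF W] triv_lift[OF W] by (simp add: \<alpha>_def)
  then show "dtriv E \<theta> (x, \<alpha> w) = w" by (metis vector_eq_rdot)
qed

lemma dtriv_inj:
  assumes W: "(W, \<theta>) \<in> trivs E" "x \<in> W" and d: "\<alpha> \<in> dual_fib E x" "\<beta> \<in> dual_fib E x"
    and eq: "dtriv E \<theta> (x, \<alpha>) = dtriv E \<theta> (x, \<beta>)"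
  shows "\<alpha> = \<beta>"
proof
  show "\<alpha> a = \<beta> a" for a
    using dtriv_pairing[OF W d(1)] dtriv_pairing[OF W d(2)] dual_fib_D(3)[OF d(1)] dual_fib_D(3)[OF d(2)] eq
    by (cases "a \<in> fib E x") auto
qed

text \<open>Everything proved in the locale becomes available for the dual. The substance is the
  smoothness of the transition maps; the fibrewise laws are those of representing vectors.\<close>

lemma dual_bundle_bundle: "is_bundle D"
proof -
  have fibD: "fib D x = {x} \<times> dual_fib E x" if "x \<in> pts M" for x using fib_dual that .
  have triv: "openin (mtop M) W \<and> (\<forall>x\<in>W. bij_betw (dtriv E \<theta>) (fib D x) UNIV \<and>
      (\<forall>a\<in>fib D x. \<forall>b\<in>fib D x. fadd D a b \<in> fib D x \<and> dtriv E \<theta> (fadd D a b) = dtriv E \<theta> a + dtriv E \<theta> b) \<and>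
      (\<forall>c. \<forall>a\<in>fib D x. fscale D c a \<in> fib D x \<and> dtriv E \<theta> (fscale D c a) = c *\<^sub>R dtriv E \<theta> a))"
    if W: "(W, \<theta>) \<in> trivs E" for W \<theta>
  proof (intro conjI ballI allI triv_open[OF W])
    fix x assume x: "x \<in> W"
    have fx: "fib D x = {x} \<times> dual_fib E x" using fibD triv_pts[OF W] x by blast
    show "bij_betw (dtriv E \<theta>) (fib D x) UNIV"
      unfolding bij_betw_def fx
    proof
      show "inj_on (dtriv E \<theta>) ({x} \<times> dual_fib E x)"
        using dtriv_inj[OF W x] by (auto simp: inj_on_def)
      show "dtriv E \<theta> ` ({x} \<times> dual_fib E x) = UNIV"
        using dtriv_inverse[OF W x] by (auto simp: image_iff) metis
    qed
    fix a assume "a \<in> fib D x"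
    then obtain \<alpha> where \<alpha>: "a = (x, \<alpha>)" "\<alpha> \<in> dual_fib E x" by (auto simp: fx)
    have sc: "(\<lambda>a. c * \<alpha> a) \<in> dual_fib E x" for c
      using \<alpha>(2) by (auto simp: dual_fib_def algebra_simps)
    show "fscale D c a \<in> fib D x" "dtriv E \<theta> (fscale D c a) = c *\<^sub>R dtriv E \<theta> a" for c
      using sc by (simp_all add: \<alpha> fx dual_bundle_simps dtriv_eq(1)[OF W x] scaleR_sum_right)
    fix b assume "b \<in> fib D x"
    then obtain \<beta> where \<beta>: "b = (x, \<beta>)" "\<beta> \<in> dual_fib E x" by (auto simp: fx)
    have ad: "(\<lambda>a. \<alpha> a + \<beta> a) \<in> dual_fib E x"
      using \<alpha>(2) \<beta>(2) by (auto simp: dual_fib_def algebra_simps)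
    then show "fadd D a b \<in> fib D x" "dtriv E \<theta> (fadd D a b) = dtriv E \<theta> a + dtriv E \<theta> b"
      using \<alpha>(2) \<beta>(2) by (simp_all add: \<alpha>(1) \<beta>(1) fx dual_bundle_simps dtriv_eq(1)[OF W x] scaleR_add_left sum.distrib)
  qed
  have fM: "finite_dim TYPE('e)" by (rule mfd_finite_dim[OF mfd_base])
  define ch where "ch U \<kappa> W \<theta> = ({a \<in> total D. fst a \<in> U \<inter> W}, \<lambda>a. (\<kappa> (fst a), dtriv E \<theta> a))"
    for U and \<kappa> :: "'m \<Rightarrow> 'e" and W \<theta>
  have atl: "total_atlas D = {ch U \<kappa> W \<theta> | U \<kappa> W \<theta>. (U, \<kappa>) \<in> M \<and> (W, \<theta>) \<in> trivs E}"
    unfolding total_atlas_def ch_def dual_bundle_simps by blast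
  have tot: "a \<in> total D \<longleftrightarrow> fst a \<in> pts M \<and> snd a \<in> dual_fib E (fst a)" for a
    by (cases a) (auto simp: dual_bundle_simps)
  have inj: "inj_on (\<lambda>a. (\<kappa> (fst a), dtriv E \<theta> a)) {a \<in> total D. fst a \<in> U \<inter> W}"
    if U: "(U, \<kappa>) \<in> M" and W: "(W, \<theta>) \<in> trivs E" for U \<kappa> W \<theta>
  proof (rule inj_onI)
    fix a b assume ab: "a \<in> {a \<in> total D. fst a \<in> U \<inter> W}" "b \<in> {a \<in> total D. fst a \<in> U \<inter> W}"
      "(\<kappa> (fst a), dtriv E \<theta> a) = (\<kappa> (fst b), dtriv E \<theta> b)"
    then have f: "fst a = fst b" using chart_inj[OF mfd_base U] by (auto simp: inj_on_def)
    have "a = (fst a, snd a)" "b = (fst a, snd b)" using f by (auto simp: prod_eq_iff)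
    then have "dtriv E \<theta> (fst a, snd a) = dtriv E \<theta> (fst a, snd b)" using ab(3) by simp
    moreover have "snd a \<in> dual_fib E (fst a)" "snd b \<in> dual_fib E (fst a)" "fst a \<in> W"
      using ab(1,2) unfolding f by (auto simp: tot f[symmetric]) 
    ultimately have "snd a = snd b" using dtriv_inj[OF W] by blast
    with f show "a = b" by (simp add: prod_eq_iff)
  qed
  have main: "open (c ` (S \<inter> S')) \<and> smooth_on (c ` (S \<inter> S')) (c' \<circ> inv_into S c)"
    if S: "(S, c) = ch U \<kappa> W \<theta>" and S': "(S', c') = ch U' \<kappa>' W' \<theta>'"
      and U: "(U, \<kappa>) \<in> M" and W: "(W, \<theta>) \<in> trivs E" and U': "(U', \<kappa>') \<in> M" and W': "(W', \<theta>') \<in> trivs E"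
    for U \<kappa> W \<theta> U' \<kappa>' W' \<theta>' S c S' c'
  proof -
    have S: "S = {a \<in> total D. fst a \<in> U \<inter> W}" "c = (\<lambda>a. (\<kappa> (fst a), dtriv E \<theta> a))"
      and S': "S' = {a \<in> total D. fst a \<in> U' \<inter> W'}" "c' = (\<lambda>a. (\<kappa>' (fst a), dtriv E \<theta>' a))"
      using S S' by (auto simp: ch_def)
    define R where "R = U \<inter> W \<inter> (U' \<inter> W')"
    have R: "openin (mtop M) R"
      unfolding R_def by (intro openin_Int chart_openin[OF mfd_base U] chart_openin[OF mfd_base U'] triv_open[OF W] triv_open[OF W'])
    have im: "c ` (S \<inter> S') = \<kappa> ` R \<times> UNIV"
    proof (intro equalityI subsetI)
      fix y assume "y \<in> \<kappa> ` R \<times> (UNIV :: 'f set)"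
      then obtain x w where x: "x \<in> R" "y = (\<kappa> x, w)" by auto
      let ?\<alpha> = "\<lambda>a. if a \<in> fib E x then w \<bullet> \<theta> a else 0"
      have "x \<in> W" "x \<in> pts M" using x triv_pts[OF W] by (auto simp: R_def)
      then have "(x, ?\<alpha>) \<in> S \<inter> S'" "c (x, ?\<alpha>) = y"
        using dtriv_inverse[OF W \<open>x \<in> W\<close>] x by (auto simp: S S' tot R_def)
      then show "y \<in> c ` (S \<inter> S')" by blast
    qed (auto simp: S S' R_def)
    have oR: "open (\<kappa> ` R)" by (rule open_chart_image[OF mfd_base U R]) (auto simp: R_def)
    then have op: "open (c ` (S \<inter> S'))" by (simp add: im open_Times)
    \<comment> \<open>The expected transition map. In the fibre it is the transpose of the
      transition from \<theta>' to \<theta>: each new coordinate pairs the old representing vector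
      with a vector of the \<theta>'-frame read through \<theta>.\<close>
    define F where "F y = (\<kappa>' (inv_into U \<kappa> (fst y)),
      \<Sum>b\<in>onb. (snd y \<bullet> \<theta> (lift E \<theta>' (inv_into U \<kappa> (fst y)) b)) *\<^sub>R b)" for y :: "'e \<times> 'f"
    have "smooth_on (c ` (S \<inter> S')) F"
    proof (rule smooth_on_local)
      fix y assume "y \<in> c ` (S \<inter> S')"
      then obtain x w where x: "x \<in> R" "y = (\<kappa> x, w)" by (auto simp: im)
      then have xx: "x \<in> U" "x \<in> U'" "x \<in> W" "x \<in> W'" "inv_into U \<kappa> (\<kappa> x) = x"
        using chart_inj[OF mfd_base U] by (auto simp: R_def)
      note fp = finite_dim_prod[OF fM finite_dim_fibre] and st = mfd_model[OF finite_dim_prod[OF fM finite_dim_fibre]]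
      have k: "smooth_at model M (\<lambda>y. inv_into U \<kappa> (fst y)) y"
        using smooth_at_compose[OF st mfd_model[OF fM] mfd_base smooth_at_model_smooth_on[OF fp smooth_on_linear[OF bounded_linear_fst] open_UNIV UNIV_I]]
          smooth_at_chart_inv[OF mfd_base U xx(1)] x(2) by simp
      have 1: "smooth_at model model (\<lambda>y. \<kappa>' (inv_into U \<kappa> (fst y))) y"
        by (rule smooth_at_compose[OF st mfd_base mfd_model[OF fM] k]) (use smooth_at_chart[OF mfd_base U' xx(2)] x xx in simp)
      have l: "smooth_at model T (\<lambda>y. lift E \<theta>' (inv_into U \<kappa> (fst y)) b) y" for b
        by (rule smooth_at_lift[OF st W' _ k smooth_at_const[OF st]]) (use x xx in \<open>auto simp: pts_model\<close>)
      have "smooth_at T model \<theta> (lift E \<theta>' (inv_into U \<kappa> (fst y)) b)" for b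
        using lift_fib[OF W' xx(4), of b] x xx fib_D by (intro smooth_at_triv[OF _ W]) fastforce+
      from smooth_at_compose[OF st mfd_total mfd_model[OF finite_dim_fibre] l this]
      have 2: "smooth_at model model (\<lambda>y. \<theta> (lift E \<theta>' (inv_into U \<kappa> (fst y)) b)) y" for b .
      have 3: "smooth_at model model (\<lambda>y. (snd y \<bullet> \<theta> (lift E \<theta>' (inv_into U \<kappa> (fst y)) b)) *\<^sub>R b) y" for b
        by (intro smooth_at_bilinear[OF st finite_dim_real finite_dim_fibre finite_dim_fibre bounded_bilinear_scaleR] smooth_at_const[OF st]
            smooth_at_bilinear[OF st finite_dim_fibre finite_dim_fibre finite_dim_real bounded_bilinear_inner _ 2]
            smooth_at_model_smooth_on[OF fp smooth_on_linear[OF bounded_linear_snd] open_UNIV UNIV_I]) (auto simp: pts_model)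
      have "smooth_at model model F y" unfolding F_def
        by (intro smooth_at_model_Pair[OF st fM finite_dim_fibre 1] smooth_at_sum[OF st _ finite_dim_fibre 3]) (simp add: pts_model)
      then show "\<exists>V. open V \<and> y \<in> V \<and> smooth_on V F"
        by (simp add: smooth_at_model_iff[OF fp])
    qed
    also have "?this \<longleftrightarrow> smooth_on (c ` (S \<inter> S')) (c' \<circ> inv_into S c)"
    proof (rule smooth_on_cong[OF op])
      fix y assume "y \<in> c ` (S \<inter> S')"
      then obtain a where a: "a \<in> S" "a \<in> S'" "y = c a" by blast
      have "inv_into S c y = a" unfolding a(3)
        by (rule inv_into_f_f) (use a inj[OF U W] in \<open>simp_all only: S\<close>)
      moreover obtain x \<alpha> where x: "a = (x, \<alpha>)" by (cases a)
      then have xx: "x \<in> U" "x \<in> W" "x \<in> U'" "x \<in> W'" "\<alpha> \<in> dual_fib E x" "inv_into U \<kappa> (\<kappa> x) = x"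
        using a chart_inj[OF mfd_base U] by (auto simp: S S' tot)
      have "dtriv E \<theta>' (x, \<alpha>) = (\<Sum>b\<in>onb. (dtriv E \<theta> (x, \<alpha>) \<bullet> \<theta> (lift E \<theta>' x b)) *\<^sub>R b)"
        unfolding dtriv_eq(1)[OF W' xx(4,5)]
        by (intro sum.cong refl arg_cong2[of _ _ _ _ scaleR] dtriv_pairing[OF W xx(2,5)] lift_fib[OF W' xx(4)])
      ultimately show "F y = (c' \<circ> inv_into S c) y"
        using x xx a by (simp add: F_def S S')
    qed
    finally show ?thesis using op by blast
  qed
  have "is_atlas (total_atlas D)"
    unfolding is_atlas_def
  proof (intro conjI ballI, safe)
    fix S c assume "(S, c) \<in> total_atlas D"
    then show "inj_on c S" using inj by (auto simp: atl ch_def)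
    fix S' c' assume "(S', c') \<in> total_atlas D"
    with \<open>(S, c) \<in> total_atlas D\<close> show "open (c ` (S \<inter> S'))" "smooth_on (c ` (S \<inter> S')) (c' \<circ> inv_into S c)"
      using main unfolding atl by blast+
  qed
  then have "mfd (total_atlas D)" using finite_dim_prod[OF fM finite_dim_fibre] by (simp add: mfd_def)
  moreover have "(\<Union>(W, \<theta>)\<in>trivs D. W) = pts M"
    using triv_pts triv_exists by (fastforce simp: dual_bundle_simps)
  ultimately show ?thesis
    unfolding is_bundle_def
  proof (intro conjI ballI)
    fix Z assume "Z \<in> trivs D"
    then obtain W \<theta> where Z: "Z = (W, dtriv E \<theta>)" "(W, \<theta>) \<in> trivs E" by (auto simp: dual_bundle_simps)
    show "case Z of (W, \<theta>) \<Rightarrow> openin (mtop (base D)) W \<and> (\<forall>x\<in>W. bij_betw \<theta> (fib D x) UNIV \<and>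
        (\<forall>a\<in>fib D x. \<forall>b\<in>fib D x. fadd D a b \<in> fib D x \<and> \<theta> (fadd D a b) = \<theta> a + \<theta> b) \<and>
        (\<forall>c. \<forall>a\<in>fib D x. fscale D c a \<in> fib D x \<and> \<theta> (fscale D c a) = c *\<^sub>R \<theta> a))"
      unfolding Z(1) prod.case dual_bundle_simps(1) by (rule triv[OF Z(2)])
  qed (use mfd_base hausdorff_base finite_dim_fibre in \<open>auto simp: dual_bundle_simps\<close>)
qed

lemma dual_vb: "vb D"
  by unfold_locales (rule dual_bundle_bundle)

text \<open>The locale facts for the dual bundle, translated once into statements about
  \<open>fst\<close> and \<open>dtriv\<close>.\<close>

lemma
  shows mfd_dual: "mfd (total_atlas D)"
    and hausdorff_dual: "Hausdorff_space (mtop (total_atlas D))"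
    and pts_dual: "pts (total_atlas D) = total D"
    and smooth_at_fst_dual: "p \<in> total D \<Longrightarrow> smooth_at (total_atlas D) M fst p"
    and smooth_at_dtriv: "p \<in> total D \<Longrightarrow> (W, \<theta>) \<in> trivs E \<Longrightarrow> fst p \<in> W \<Longrightarrow>
      smooth_at (total_atlas D) model (dtriv E \<theta>) p"
    and dual_chart: "(U, \<kappa>) \<in> M \<Longrightarrow> (W, \<theta>) \<in> trivs E \<Longrightarrow>
      ({a \<in> total D. fst a \<in> U \<inter> W}, \<lambda>a. (\<kappa> (fst a), dtriv E \<theta> a)) \<in> total_atlas D"
proof -
  interpret D: vb D by (rule dual_vb)
  have t: "(W, dtriv E \<theta>) \<in> trivs D" if "(W, \<theta>) \<in> trivs E" for W \<theta>
    using that by (auto simp: dual_bundle_simps)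
  show "mfd (total_atlas D)" by (rule D.mfd_total)
  show "Hausdorff_space (mtop (total_atlas D))" by (rule D.hausdorff_total)
  show "pts (total_atlas D) = total D" by (rule D.pts_total)
  show "p \<in> total D \<Longrightarrow> smooth_at (total_atlas D) M fst p"
    using D.smooth_at_proj'[of p] by (simp add: dual_bundle_simps)
  show "p \<in> total D \<Longrightarrow> (W, \<theta>) \<in> trivs E \<Longrightarrow> fst p \<in> W \<Longrightarrow>
      smooth_at (total_atlas D) model (dtriv E \<theta>) p"
    using D.smooth_at_triv[of p W "dtriv E \<theta>"] t by (simp add: dual_bundle_simps)
  show "(U, \<kappa>) \<in> M \<Longrightarrow> (W, \<theta>) \<in> trivs E \<Longrightarrow>
      ({a \<in> total D. fst a \<in> U \<inter> W}, \<lambda>a. (\<kappa> (fst a), dtriv E \<theta> a)) \<in> total_atlas D"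
    using D.total_chart[of U \<kappa> W "dtriv E \<theta>"] t by (simp add: dual_bundle_simps)
qed

lemma total_D: "p \<in> total D \<longleftrightarrow> fst p \<in> pts M \<and> snd p \<in> dual_fib E (fst p)"
  by (cases p) (auto simp: dual_bundle_simps)

lemma dual_section:
  assumes "\<beta> \<in> sections D" "x \<in> pts M"
  shows "smooth_at M (total_atlas D) \<beta> x" "fst (\<beta> x) = x" "\<beta> x \<in> total D" "snd (\<beta> x) \<in> dual_fib E x"
proof -
  interpret D: vb D by (rule dual_vb)
  show "smooth_at M (total_atlas D) \<beta> x"
    using D.section_smooth_at[OF assms(1)] assms(2) by (simp add: dual_bundle_simps)
  have f: "\<beta> x \<in> fib D x" using D.section_fib[OF assms(1)] assms(2) by (simp add: dual_bundle_simps)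
  then show "fst (\<beta> x) = x" "\<beta> x \<in> total D" by (auto simp: fib_def dual_bundle_simps)
  then show "snd (\<beta> x) \<in> dual_fib E x" by (simp add: total_D)
qed

lemma dual_section_through:
  assumes "x \<in> pts M" "\<alpha> \<in> dual_fib E x"
  shows "\<exists>\<beta>\<in>sections D. \<beta> x = (x, \<alpha>)"
proof -
  interpret D: vb D by (rule dual_vb)
  show ?thesis using assms by (intro D.section_through) (simp_all add: dual_bundle_simps fib_dual)
qed

section \<open>Fibrewise linear functions and the tangent vectors they detect\<close>

lemma hat_triv:
  assumes X: "X \<in> sections E" and W: "(W, \<theta>) \<in> trivs E" and p: "p \<in> total D" "fst p \<in> W"
  shows "hat X p = dtriv E \<theta> p \<bullet> \<theta> (X (fst p))"
  using dtriv_pairing[OF W p(2)] section_fib[OF X] p(1) by (cases p) (auto simp: hat_def total_D)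

lemma hat_dual_triv:
  assumes \<beta>: "\<beta> \<in> sections D" and W: "(W, \<theta>) \<in> trivs E" and a: "a \<in> fib E x" "x \<in> W"
  shows "hat_dual E \<beta> a = dtriv E \<theta> (\<beta> x) \<bullet> \<theta> a"
proof -
  have x: "x \<in> pts M" using triv_pts[OF W] a(2) by blast
  note s = dual_section[OF \<beta> x]
  have "\<beta> x = (x, snd (\<beta> x))" using s(2) by (simp add: prod_eq_iff)
  then show ?thesis using dtriv_pairing[OF W a(2) s(4) a(1)] fib_D[OF a(1)] by (simp add: hat_dual_def)
qed

lemma section_triv_smooth_at:
  assumes X: "X \<in> sections E" and W: "(W, \<theta>) \<in> trivs E" "x \<in> W"
  shows "smooth_at M model (\<lambda>y. \<theta> (X y)) x"
proof -
  have x: "x \<in> pts M" using triv_pts W by blast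
  have a: "X x \<in> total E" "proj E (X x) \<in> W"
    using fib_D[OF section_fib[OF X x]] W(2) by auto
  show ?thesis
    by (rule smooth_at_compose[OF mfd_base mfd_total mfd_model[OF finite_dim_fibre] section_smooth_at[OF X x] smooth_at_triv[OF a(1) W(1) a(2)]])
qed

lemma hat_Cinf:
  assumes X: "X \<in> sections E"
  shows "hat X \<in> Cinf (total_atlas D)"
  unfolding Cinf_iff[OF mfd_dual]
proof
  fix p assume "p \<in> pts (total_atlas D)"
  then have p: "p \<in> total D" by (simp add: pts_dual)
  then obtain W \<theta> where W: "(W, \<theta>) \<in> trivs E" "fst p \<in> W" using triv_exists total_D by metis
  obtain N where N: "openin (mtop (total_atlas D)) N" "p \<in> N" "fst ` N \<subseteq> W"
    using smooth_at_continuous[OF mfd_dual mfd_base smooth_at_fst_dual[OF p] triv_open[OF W(1)] W(2)] .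
  have "smooth_at (total_atlas D) model (\<lambda>p. dtriv E \<theta> p \<bullet> \<theta> (X (fst p))) p"
    by (intro smooth_at_bilinear[OF mfd_dual finite_dim_fibre finite_dim_fibre finite_dim_real bounded_bilinear_inner] smooth_at_dtriv[OF p W]
        smooth_at_compose[OF mfd_dual mfd_base mfd_model[OF finite_dim_fibre] smooth_at_fst_dual[OF p]] section_triv_smooth_at[OF X W])
  then show "smooth_at (total_atlas D) model (hat X) p"
  proof (rule smooth_at_cong[OF mfd_dual _ N(1,2)])
    fix q assume "q \<in> N"
    then have "q \<in> total D" "fst q \<in> W" using N(3) openin_subset[OF N(1)] by (auto simp: topspace_mtop[OF mfd_dual] pts_dual)
    then show "dtriv E \<theta> q \<bullet> \<theta> (X (fst q)) = hat X q" using hat_triv[OF X W(1)] by simp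
  qed
qed

lemma hat_dual_Cinf:
  assumes \<beta>: "\<beta> \<in> sections D"
  shows "hat_dual E \<beta> \<in> Cinf T"
  unfolding Cinf_iff[OF mfd_total]
proof
  fix a assume "a \<in> pts T"
  then have a: "a \<in> total E" by (simp add: pts_total)
  then obtain W \<theta> where W: "(W, \<theta>) \<in> trivs E" "proj E a \<in> W" using triv_exists proj_pts by metis
  obtain N where N: "openin (mtop T) N" "a \<in> N" "proj E ` N \<subseteq> W"
    using smooth_at_continuous[OF mfd_total mfd_base smooth_at_proj[OF a W] triv_open[OF W(1)] W(2)] .
  note s = dual_section[OF \<beta> proj_pts[OF a]]
  have "smooth_at T model (\<lambda>a. dtriv E \<theta> (\<beta> (proj E a)) \<bullet> \<theta> a) a"
    using s(2) W(2)
    by (intro smooth_at_bilinear[OF mfd_total finite_dim_fibre finite_dim_fibre finite_dim_real bounded_bilinear_inner] smooth_at_triv[OF a W]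
        smooth_at_compose[OF mfd_total mfd_dual mfd_model[OF finite_dim_fibre] smooth_at_compose[OF mfd_total mfd_base mfd_dual smooth_at_proj[OF a W] s(1)]
          smooth_at_dtriv[OF s(3) W(1)]]) simp
  then show "smooth_at T model (hat_dual E \<beta>) a"
  proof (rule smooth_at_cong[OF mfd_total _ N(1,2)])
    fix q assume q: "q \<in> N"
    then have "q \<in> total E" "proj E q \<in> W" using N(3) openin_subset[OF N(1)] by (auto simp: topspace_mtop[OF mfd_total] pts_total)
    then show "dtriv E \<theta> (\<beta> (proj E q)) \<bullet> \<theta> q = hat_dual E \<beta> q"
      using hat_dual_triv[OF \<beta> W(1), of q] by (simp add: fib_def)
  qed
qed

text \<open>In a chart of the dual bundle, the base coordinates and the functions \<open>hat Y\<close> with \<open>Y\<close>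
  ranging over sections through all points of one fibre separate tangent vectors.\<close>

lemma tangent_dual_eq_zero:
  assumes p: "p \<in> total D" and v: "v \<in> tangent (total_atlas D) p"
    and base: "\<And>f. f \<in> Cinf M \<Longrightarrow> v (f \<circ> fst) = 0"
    and hats: "\<And>a. a \<in> fib E (fst p) \<Longrightarrow> \<exists>Y\<in>sections E. Y (fst p) = a \<and> v (hat Y) = 0"
    and K: "K \<in> Cinf (total_atlas D)"
  shows "v K = 0"
proof -
  define x where "x = fst p"
  have x: "x \<in> pts M" using p by (simp add: x_def total_D)
  obtain U \<kappa> W \<theta> where U: "(U, \<kappa>) \<in> M" "x \<in> U" and W: "(W, \<theta>) \<in> trivs E" "x \<in> W"
    using x pts_chart triv_exists by metis
  let ?S = "{a \<in> total D. fst a \<in> U \<inter> W}" and ?c = "\<lambda>a. (\<kappa> (fst a), dtriv E \<theta> a)"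
  note fM = mfd_finite_dim[OF mfd_base] and fp = finite_dim_prod[OF mfd_finite_dim[OF mfd_base] finite_dim_fibre]
  note c = dual_chart[OF U(1) W(1)]
  have pS: "p \<in> ?S" using p U W by (simp add: x_def)
  obtain w where w: "\<And>f. f \<in> Cinf (total_atlas D) \<Longrightarrow> v f = chart_deriv ?S ?c p f w"
    using tangent_coord[OF mfd_dual hausdorff_dual c pS v] by blast
  note cs = smooth_at_chart[OF mfd_dual c pS]
  have dc: "chart_deriv ?S ?c p ?c w' = w'" for w' using chart_deriv_chart[OF mfd_dual c pS] by simp
  have d1: "chart_deriv ?S ?c p (\<lambda>a. \<kappa> (fst a)) w' = fst w'" for w'
    using chart_deriv_linear_compose[OF mfd_dual fp c pS bounded_linear_fst cs, of w'] unfolding dc fst_conv .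
  have d2: "chart_deriv ?S ?c p (dtriv E \<theta>) w' = snd w'" for w'
    using chart_deriv_linear_compose[OF mfd_dual fp c pS bounded_linear_snd cs, of w'] unfolding dc snd_conv .
  have fstS: "smooth_at (total_atlas D) M fst p" by (rule smooth_at_fst_dual[OF p])
  have w1: "fst w = 0"
  proof -
    obtain \<beta> where \<beta>: "bump M U x \<beta>" using bump_exists[OF mfd_base hausdorff_base chart_openin[OF mfd_base U(1)] U(2)] by blast
    \<comment> \<open>A linear function of the base coordinates whose derivative in direction
      \<open>fst w\<close> is the square of the norm of \<open>fst w\<close>. After cutting off it
      is a function on the base, so its derivative along \<open>v\<close> vanishes.\<close>
    define g where "g y = (\<kappa> y + - \<kappa> x) \<bullet> fst w" for y
    have sub: "smooth_at M model (\<lambda>y. \<kappa> y + - \<kappa> x) y" if "y \<in> U" for y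
      using that chart_subset_pts[OF U(1)]
      by (intro smooth_at_add[OF mfd_base fM] smooth_at_chart[OF mfd_base U(1)] smooth_at_const[OF mfd_base]) (auto simp: pts_model)
    have g: "smooth_at M model g y" if "y \<in> U" for y
      unfolding g_def[abs_def]
      by (rule smooth_at_linear[OF mfd_base fM finite_dim_real bounded_linear_inner_left sub[OF that]])
    define f where "f y = \<beta> y *\<^sub>R g y" for y
    have f: "f \<in> Cinf M"
      unfolding Cinf_iff[OF mfd_base] f_def[abs_def] using bump_smooth_at[OF mfd_base finite_dim_real \<beta> g] by blast
    have \<beta>C: "\<beta> \<in> Cinf M" "\<beta> x = 1" using \<beta> by (auto simp: bump_def)
    have gx: "g x = 0" by (simp add: g_def)
    have dg: "chart_deriv U \<kappa> x g (fst w) = fst w \<bullet> fst w"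
      unfolding g_def[abs_def] chart_deriv_linear_compose[OF mfd_base fM U bounded_linear_inner_left sub[OF U(2)]]
      using chart_deriv_add[OF mfd_base fM U smooth_at_chart[OF mfd_base U] smooth_at_const[OF mfd_base x, of "- \<kappa> x" model], of "fst w"]
      by (simp add: pts_model chart_deriv_chart[OF mfd_base U] chart_deriv_const)
    have "f \<circ> fst \<in> Cinf (total_atlas D)"
      using Cinf_compose[OF mfd_dual mfd_base f smooth_at_fst_dual] by (simp add: comp_def pts_dual)
    then have "0 = chart_deriv ?S ?c p (\<lambda>a. f (fst a)) w" using base[OF f] w by (simp add: comp_def)
    also have "\<dots> = chart_deriv U \<kappa> (fst p) f (chart_deriv ?S ?c p (\<lambda>a. \<kappa> (fst a)) w)"
      using U f x by (intro chart_deriv_compose[OF mfd_dual mfd_base finite_dim_real c pS U(1) _ fstS])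
        (auto simp: x_def Cinf_iff[OF mfd_base])
    also have "\<dots> = chart_deriv U \<kappa> x f (fst w)" unfolding d1 x_def ..
    also have "\<dots> = fst w \<bullet> fst w"
      unfolding f_def[abs_def]
      using chart_deriv_bilinear[OF mfd_base U finite_dim_real finite_dim_real bounded_bilinear_scaleR Cinf_smooth_at[OF mfd_base \<beta>C(1) x] g[OF U(2)]]
      by (simp add: gx \<beta>C dg)
    finally show ?thesis by simp
  qed
  have w2: "snd w \<bullet> \<theta> a = 0" if a: "a \<in> fib E x" for a
  proof -
    obtain Y where Y: "Y \<in> sections E" "Y x = a" "v (hat Y) = 0"
      using hats a unfolding x_def by blast
    have sY: "smooth_at M model (\<lambda>y. \<theta> (Y y)) (fst p)"
      using section_triv_smooth_at[OF Y(1) W] by (simp add: x_def)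
    then have sYf: "smooth_at (total_atlas D) model (\<lambda>q. \<theta> (Y (fst q))) p"
      by (rule smooth_at_compose[OF mfd_dual mfd_base mfd_model[OF finite_dim_fibre] fstS])
    \<comment> \<open>Since \<open>fst w\<close> is 0, the variation of \<open>Y\<close> along the
      base does not contribute, and only its value \<open>a\<close> enters. So one section through
      each \<open>a\<close> suffices.\<close>
    have "chart_deriv ?S ?c p (\<lambda>q. \<theta> (Y (fst q))) w = chart_deriv U \<kappa> (fst p) (\<lambda>y. \<theta> (Y y)) (chart_deriv ?S ?c p (\<lambda>a. \<kappa> (fst a)) w)"
      using U by (intro chart_deriv_compose[OF mfd_dual mfd_base finite_dim_fibre c pS U(1) _ fstS sY]) (simp add: x_def)
    also have "\<dots> = 0"
      unfolding d1 w1 using linear_0[OF chart_deriv_linear[OF mfd_base finite_dim_fibre U]] sY by (simp add: x_def)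
    finally have 0: "chart_deriv ?S ?c p (\<lambda>q. \<theta> (Y (fst q))) w = 0" .
    have "0 = chart_deriv ?S ?c p (hat Y) w" using w[OF hat_Cinf[OF Y(1)]] Y(3) by simp
    also have "\<dots> = chart_deriv ?S ?c p (\<lambda>q. dtriv E \<theta> q \<bullet> \<theta> (Y (fst q))) w"
      by (rule fun_cong[OF chart_deriv_cong[OF mfd_dual c pS chart_openin[OF mfd_dual c] pS]]) (auto intro: hat_triv[OF Y(1) W(1)])
    also have "\<dots> = snd w \<bullet> \<theta> a"
      using chart_deriv_bilinear[OF mfd_dual c pS finite_dim_fibre finite_dim_fibre bounded_bilinear_inner smooth_at_dtriv[OF p W(1)] sYf, of w] W(2)
      unfolding 0 d2 by (simp add: Y(2) x_def[symmetric])
    finally show ?thesis by simp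
  qed
  \<comment> \<open>Taking for \<open>a\<close> the vector with coordinates \<open>snd w\<close>
    gives that \<open>snd w\<close> is orthogonal to itself.\<close>
  from w2[OF lift_fib[OF W, of "snd w"]] have "snd w = 0" by (simp add: triv_lift[OF W])
  with w1 have "w = 0" by (simp add: prod_eq_iff)
  moreover have "linear (chart_deriv ?S ?c p K)"
    using K p by (intro chart_deriv_linear[OF mfd_dual finite_dim_real c pS]) (simp add: Cinf_iff[OF mfd_dual] pts_dual)
  ultimately show ?thesis using w[OF K] linear_0 by auto
qed

end

section \<open>Actions by complete lifts\<close>

lemma smooth_at_map_prod:
  assumes "mfd \<X>" "mfd \<A>" "mfd \<B>" "mfd \<C>" and F: "smooth_map (prod_atlas \<A> \<B>) \<C> (\<lambda>(a, b). F a b)"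
    and fg: "smooth_at \<X> \<A> f p" "smooth_at \<X> \<B> g p"
  shows "smooth_at \<X> \<C> (\<lambda>q. F (f q) (g q)) p"
proof -
  have "(f p, g p) \<in> pts (prod_atlas \<A> \<B>)"
    using smooth_at_pts[OF assms(1) fg(1)] smooth_at_pts[OF assms(1) fg(2)] by (simp add: pts_prod)
  then have "smooth_at (prod_atlas \<A> \<B>) \<C> (\<lambda>(a, b). F a b) (f p, g p)"
    using F by (simp add: smooth_map_iff[OF mfd_prod[OF assms(2,3)] assms(4)])
  from smooth_at_compose[OF assms(1) mfd_prod[OF assms(2,3)] assms(4) smooth_at_Pair[OF assms(1-3) fg] this]
  show ?thesis by simp
qed

lemma openin_pts: "mfd \<A> \<Longrightarrow> openin (mtop \<A>) (pts \<A>)"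
  using openin_topspace[of "mtop \<A>"] by (simp add: topspace_mtop)

lemma Cinf_cong:
  assumes A: "mfd \<A>" and "f \<in> Cinf \<A>" "\<And>q. q \<in> pts \<A> \<Longrightarrow> f q = g q"
  shows "g \<in> Cinf \<A>"
  unfolding Cinf_iff[OF A]
proof
  show "smooth_at \<A> model g p" if "p \<in> pts \<A>" for p
    by (rule smooth_at_cong[OF A Cinf_smooth_at[OF assms(1,2) that] openin_pts[OF A] that]) (rule assms(3))
qed

text \<open>Functions are total, so equality on the manifold is not equality in the logic. In
  coordinate form \<open>v\<close> depends only on the values near \<open>p\<close>.\<close>

lemma tangent_cong:
  assumes A: "mfd (\<A> :: ('p, 'e::real_inner) atlas)" and H: "Hausdorff_space (mtop \<A>)" and p: "p \<in> pts \<A>"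
    and v: "v \<in> tangent \<A> p"
    and f: "f \<in> Cinf \<A>" and eq: "\<And>q. q \<in> pts \<A> \<Longrightarrow> f q = g q"
  shows "v f = v g"
proof -
  obtain U \<kappa> where U: "(U, \<kappa>) \<in> \<A>" "p \<in> U" using pts_chart[OF p] by blast
  obtain w where w: "\<And>f. f \<in> Cinf \<A> \<Longrightarrow> v f = chart_deriv U \<kappa> p f w"
    using tangent_coord[OF A H U v] by blast
  have g: "g \<in> Cinf \<A>" by (rule Cinf_cong[OF A f eq])
  show ?thesis
    unfolding w[OF f] w[OF g]
    by (rule fun_cong[OF chart_deriv_cong[OF A U openin_pts[OF A] p]]) (rule eq)
qed

text \<open>The Leibniz rule in \<open>tangent\<close> is for scalar functions; the coordinate form
  extends it to vector-valued factors.\<close>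

lemma tangent_inner:
  fixes B b :: "'p \<Rightarrow> 'f::real_inner"
  assumes A: "mfd (\<A> :: ('p, 'e::real_inner) atlas)" and H: "Hausdorff_space (mtop \<A>)" and p: "p \<in> pts \<A>"
    and fd: "finite_dim TYPE('f)" and v: "v \<in> tangent \<A> p"
    and B: "\<And>q. q \<in> pts \<A> \<Longrightarrow> smooth_at \<A> model B q" and b: "\<And>q. q \<in> pts \<A> \<Longrightarrow> smooth_at \<A> model b q"
  shows "v (\<lambda>q. B q \<bullet> b q) = v (\<lambda>q. B p \<bullet> b q) + v (\<lambda>q. B q \<bullet> b p)"
proof -
  obtain U \<kappa> where U: "(U, \<kappa>) \<in> \<A>" "p \<in> U" using pts_chart[OF p] by blast
  obtain w where w: "\<And>f. f \<in> Cinf \<A> \<Longrightarrow> v f = chart_deriv U \<kappa> p f w"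
    using tangent_coord[OF A H U v] by blast
  have "(\<lambda>q. B q \<bullet> b q) \<in> Cinf \<A>" "(\<lambda>q. B p \<bullet> b q) \<in> Cinf \<A>" "(\<lambda>q. B q \<bullet> b p) \<in> Cinf \<A>"
    using B b
    by (auto simp: Cinf_iff[OF A] intro!: smooth_at_bilinear[OF A fd fd finite_dim_real bounded_bilinear_inner]
        smooth_at_linear[OF A fd finite_dim_real bounded_linear_inner_left]
        smooth_at_linear[OF A fd finite_dim_real bounded_linear_inner_right])
  then show ?thesis
    using chart_deriv_bilinear[OF A U fd fd bounded_bilinear_inner B[OF p] b[OF p]]
      chart_deriv_linear_compose[OF A fd U bounded_linear_inner_right b[OF p]]
      chart_deriv_linear_compose[OF A fd U bounded_linear_inner_left B[OF p]]
    by (simp add: w)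
qed

lemma tangent_diff:
  assumes "v \<in> tangent \<A> p" "w \<in> tangent \<A> p"
  shows "(\<lambda>f. v f - w f) \<in> tangent \<A> p"
  using assms by (auto simp: tangent_def algebra_simps)

text \<open>Coordinate directions are tangent vectors by \<open>coord_tangent\<close>, so
  \<open>f\<close> is constant on coordinate balls. Its level sets are then open and closed.\<close>

lemma Cinf_eq_if_tangent_zero:
  assumes A: "mfd (\<A> :: ('p, 'e::real_inner) atlas)" and conn: "connected_space (mtop \<A>)"
    and f: "f \<in> Cinf \<A>" and zero: "\<And>p v. p \<in> pts \<A> \<Longrightarrow> v \<in> tangent \<A> p \<Longrightarrow> v f = 0"
    and pq: "p \<in> pts \<A>" "q \<in> pts \<A>"
  shows "f p = f q"
proof -
  have loc: "\<exists>N. openin (mtop \<A>) N \<and> p \<in> N \<and> (\<forall>q\<in>N. f q = f p)" if p: "p \<in> pts \<A>" for p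
  proof -
    obtain U \<kappa> where U: "(U, \<kappa>) \<in> \<A>" "p \<in> U" using pts_chart[OF p] by blast
    have "open (\<kappa> ` U)" using open_chart_image[OF A U(1) chart_openin[OF A U(1)]] by simp
    moreover have "\<kappa> p \<in> \<kappa> ` U" using U by blast
    ultimately obtain r where r: "r > 0" "ball (\<kappa> p) r \<subseteq> \<kappa> ` U"
      by (meson open_contains_ball)
    let ?F = "f \<circ> inv_into U \<kappa>"
    have "(?F has_derivative (\<lambda>_. 0)) (at y within ball (\<kappa> p) r)" if y: "y \<in> ball (\<kappa> p) r" for y
    proof -
      obtain q where q: "q \<in> U" "y = \<kappa> q" using y r by blast
      have qp: "q \<in> pts \<A>" using q chart_subset_pts[OF U(1)] by blast
      have "chart_deriv U \<kappa> q f w = 0" for w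
        using zero[OF qp coord_tangent[OF A U(1) q(1)]] f by simp
      then have "chart_deriv U \<kappa> q f = (\<lambda>_. 0)" by auto
      then have "(?F has_derivative (\<lambda>_. 0)) (at y)"
        using chart_deriv_works[OF A finite_dim_real U(1) q(1) Cinf_smooth_at[OF A f qp]] q by simp
      then show ?thesis by (rule has_derivative_at_withinI)
    qed
    from has_derivative_zero_constant[OF convex_ball this]
    obtain c where c: "\<And>y. y \<in> ball (\<kappa> p) r \<Longrightarrow> ?F y = c" by blast
    have "f q = c" if "q \<in> U" "\<kappa> q \<in> ball (\<kappa> p) r" for q
      using c[OF that(2)] chart_inj[OF A U(1)] that(1) by simp
    then show ?thesis
      using openin_chart_preimage[OF A U(1) open_ball, of "\<kappa> p" r] U r(1)
      by (intro exI[of _ "{q \<in> U. \<kappa> q \<in> ball (\<kappa> p) r}"]) auto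
  qed
  \<comment> \<open>Stated for an arbitrary predicate, so that it covers both a level set and its
    complement.\<close>
  have op: "openin (mtop \<A>) {q \<in> pts \<A>. R (f q)}" for R
  proof (subst openin_subopen, intro ballI)
    fix x assume x: "x \<in> {q \<in> pts \<A>. R (f q)}"
    then obtain N where "openin (mtop \<A>) N" "x \<in> N" "\<forall>q\<in>N. f q = f x" using loc by blast
    then show "\<exists>T. openin (mtop \<A>) T \<and> x \<in> T \<and> T \<subseteq> {q \<in> pts \<A>. R (f q)}"
      using x openin_subset[of "mtop \<A>" N] topspace_mtop[OF A] by (intro exI[of _ N]) fastforce
  qed
  show ?thesis
  proof (rule ccontr)
    assume "f p \<noteq> f q"
    then have "\<exists>E1 E2. openin (mtop \<A>) E1 \<and> openin (mtop \<A>) E2 \<and> topspace (mtop \<A>) \<subseteq> E1 \<union> E2 \<and>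
        E1 \<inter> E2 = {} \<and> E1 \<noteq> {} \<and> E2 \<noteq> {}"
      using pq by (intro exI[of _ "{x \<in> pts \<A>. f x = f p}"] exI[of _ "{x \<in> pts \<A>. f x \<noteq> f p}"] conjI op)
        (auto simp: topspace_mtop[OF A])
    then show False using conn unfolding connected_space_def by contradiction
  qed
qed

locale lift_action = vb E
  for E :: "('m, 'e::real_inner, 'a, 'f::real_inner) vbundle" +
  fixes br :: "('m \<Rightarrow> 'a) \<Rightarrow> ('m \<Rightarrow> 'a) \<Rightarrow> 'm \<Rightarrow> 'a"
    and \<rho> :: "'a \<Rightarrow> ('m \<Rightarrow> real) \<Rightarrow> real"
    and G :: "('g, 'b) monoid_scheme" (structure)
    and \<G> :: "('g, 'k::real_inner) atlas"
    and \<Phi> :: "'g \<Rightarrow> 'a \<Rightarrow> 'a"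
    and \<phi> :: "'g \<Rightarrow> 'm \<Rightarrow> 'm"
    and \<psi> :: "'g lie_vec \<Rightarrow> 'm \<Rightarrow> 'a"
    and P :: "('m \<times> ('a \<Rightarrow> real) \<Rightarrow> real) \<Rightarrow> ('m \<times> ('a \<Rightarrow> real) \<Rightarrow> real) \<Rightarrow> 'm \<times> ('a \<Rightarrow> real) \<Rightarrow> real"
  assumes algebroid: "lie_algebroid E br \<rho>"
    and lie_group: "lie_group G \<G>"
    and action: "bundle_action G \<G> E \<Phi> \<phi>"
    and lifts: "by_complete_lifts G \<G> E br \<rho> \<Phi> \<psi>"
    and poisson: "linear_poisson E br \<rho> P"
begin

sublocale group G
  using lie_group by (simp add: lie_group_def)

abbreviation "\<gg> \<equiv> lie_alg G \<G>"
text \<open>With the group element last, \<open>orb p\<close> is the orbit map whose push-forward is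
  the infinitesimal generator of the dual action at \<open>p\<close>.\<close>

abbreviation "orb p \<equiv> (\<lambda>g. dual_action G E \<Phi> \<phi> g p)"

section \<open>The action, its dual and the smoothness of their orbit maps\<close>

lemma mfd_group: "mfd \<G>" and hausdorff_group: "Hausdorff_space (mtop \<G>)" and pts_group: "pts \<G> = carrier G"
  using lie_group by (auto simp: lie_group_def smooth_manifold_mfd) (auto simp: smooth_manifold_def)

lemma one_pts: "\<one> \<in> pts \<G>"
  by (simp add: pts_group)

lemma smooth_at_group_mult:
  assumes "mfd \<X>" "smooth_at \<X> \<G> f p" "smooth_at \<X> \<G> g p"
  shows "smooth_at \<X> \<G> (\<lambda>q. f q \<otimes> g q) p"
  by (rule smooth_at_map_prod[OF assms(1) mfd_group mfd_group mfd_group _ assms(2,3)]) (use lie_group in \<open>simp add: lie_group_def\<close>)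

lemma smooth_at_group_inv:
  assumes "mfd \<X>" "smooth_at \<X> \<G> f p"
  shows "smooth_at \<X> \<G> (\<lambda>q. inv (f q)) p"
proof -
  have "smooth_at \<G> \<G> (\<lambda>g. inv g) (f p)"
    using lie_group smooth_at_pts[OF assms] by (auto simp: lie_group_def smooth_map_iff[OF mfd_group mfd_group])
  from smooth_at_compose[OF assms(1) mfd_group mfd_group assms(2) this] show ?thesis .
qed

lemma smooth_at_bundle_action:
  assumes "mfd \<X>" "smooth_at \<X> \<G> f p" "smooth_at \<X> T a p"
  shows "smooth_at \<X> T (\<lambda>q. \<Phi> (f q) (a q)) p"
  by (rule smooth_at_map_prod[OF assms(1) mfd_group mfd_total mfd_total _ assms(2,3)])
     (use action in \<open>simp add: bundle_action_def smooth_action_def\<close>)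

lemma smooth_at_base_action:
  assumes "mfd \<X>" "smooth_at \<X> \<G> f p" "smooth_at \<X> M x p"
  shows "smooth_at \<X> M (\<lambda>q. \<phi> (f q) (x q)) p"
  by (rule smooth_at_map_prod[OF assms(1) mfd_group mfd_base mfd_base _ assms(2,3)])
     (use action in \<open>simp add: bundle_action_def smooth_action_def\<close>)

lemma orbit_Cinf:
  assumes "F \<in> Cinf T" "a \<in> total E"
  shows "(\<lambda>g. F (\<Phi> g a)) \<in> Cinf \<G>"
proof (rule Cinf_compose[OF mfd_group mfd_total assms(1)])
  show "smooth_at \<G> T (\<lambda>g. \<Phi> g a) g" if "g \<in> pts \<G>" for g
    by (rule smooth_at_bundle_action[OF mfd_group smooth_at_ident[OF mfd_group that] smooth_at_const[OF mfd_group that]])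
       (simp add: assms(2) pts_total)
qed

lemma base_action_pts:
  assumes "g \<in> carrier G" "x \<in> pts M"
  shows "\<phi> g x \<in> pts M"
  using smooth_at_pts[OF mfd_group smooth_at_base_action[OF mfd_group smooth_at_ident[OF mfd_group] smooth_at_const[OF mfd_group]], of g x] assms
  by (simp add: pts_group)

lemma base_action:
  "x \<in> pts M \<Longrightarrow> \<phi> \<one> x = x"
  "g \<in> carrier G \<Longrightarrow> h \<in> carrier G \<Longrightarrow> x \<in> pts M \<Longrightarrow> \<phi> (g \<otimes> h) x = \<phi> g (\<phi> h x)"
  "a \<in> total E \<Longrightarrow> \<Phi> \<one> a = a"
  "g \<in> carrier G \<Longrightarrow> h \<in> carrier G \<Longrightarrow> a \<in> total E \<Longrightarrow> \<Phi> (g \<otimes> h) a = \<Phi> g (\<Phi> h a)"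
  using action by (auto simp: bundle_action_def smooth_action_def pts_total)

lemma base_action_inv: "g \<in> carrier G \<Longrightarrow> x \<in> pts M \<Longrightarrow> \<phi> (inv g) (\<phi> g x) = x"
  using base_action(2)[of "inv g" g x] by (simp add: base_action)

lemma action_fib:
  assumes "g \<in> carrier G" "a \<in> fib E x"
  shows "\<Phi> g a \<in> fib E (\<phi> g x)"
proof -
  have a: "a \<in> total E" "proj E a = x" using assms(2) by (auto simp: fib_def)
  have "\<Phi> g a \<in> total E"
    using smooth_at_pts[OF mfd_group smooth_at_bundle_action[OF mfd_group smooth_at_ident[OF mfd_group] smooth_at_const[OF mfd_group]], of g a] assms(1) a
    by (simp add: pts_group pts_total)
  then show ?thesis using action assms(1) a by (simp add: fib_def bundle_action_def)
qed

lemma fib_pts: "a \<in> fib E x \<Longrightarrow> x \<in> pts M"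
  using proj_pts by (auto simp: fib_def)

lemma action_inv_fib: "g \<in> carrier G \<Longrightarrow> x \<in> pts M \<Longrightarrow> b \<in> fib E (\<phi> g x) \<Longrightarrow> \<Phi> (inv g) b \<in> fib E x"
  using action_fib[of "inv g" b "\<phi> g x"] by (simp add: base_action_inv)

lemma action_inv: "g \<in> carrier G \<Longrightarrow> b \<in> fib E y \<Longrightarrow> \<Phi> g (\<Phi> (inv g) b) = b"
  using base_action(4)[of g "inv g" b] by (simp add: base_action fib_def)

lemma action_linear:
  assumes "g \<in> carrier G" "a \<in> fib E x" "b \<in> fib E x"
  shows "\<Phi> g (fadd E a b) = fadd E (\<Phi> g a) (\<Phi> g b)" "\<Phi> g (fscale E c a) = fscale E c (\<Phi> g a)"
  using action assms fib_pts[OF assms(2)] unfolding bundle_action_def by blast+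

lemma orb_total:
  assumes "p \<in> total D" "g \<in> carrier G"
  shows "orb p g \<in> total D"
proof -
  obtain x \<alpha> where p: "p = (x, \<alpha>)" by (cases p)
  then have x: "x \<in> pts M" "\<alpha> \<in> dual_fib E x" using assms(1) by (auto simp: total_D)
  obtain W \<theta> where W: "(W, \<theta>) \<in> trivs E" "\<phi> g x \<in> W"
    using triv_exists[OF base_action_pts[OF assms(2) x(1)]] by blast
  have "(\<lambda>b. if b \<in> fib E (\<phi> g x) then \<alpha> (\<Phi> (inv g) b) else 0) \<in> dual_fib E (\<phi> g x)"
    using assms(2) x action_inv_fib[OF assms(2) x(1)] triv_props(2,4)[OF W]
    by (auto simp: dual_fib_def action_linear[of "inv g"])
  then show ?thesis using base_action_pts[OF assms(2) x(1)] by (simp add: p dual_action_def total_D)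
qed

lemma hat_orb:
  assumes "p \<in> total D" "g \<in> carrier G" "Y \<in> sections E"
  shows "hat Y (orb p g) = snd p (\<Phi> (inv g) (Y (\<phi> g (fst p))))"
  using assms section_fib[OF assms(3) base_action_pts[OF assms(2)], of "fst p"]
  by (cases p) (auto simp: dual_action_def hat_def total_D)

lemma fst_orb: "fst (orb p g) = \<phi> g (fst p)"
  by (cases p) (simp add: dual_action_def)

lemma orb_one: "p \<in> total D \<Longrightarrow> orb p \<one> = p"
  by (cases p) (auto simp: dual_action_def total_D base_action fib_def dual_fib_def fun_eq_iff)

lemma orb_mult:
  assumes p: "p \<in> total D" and g: "g \<in> carrier G" "h \<in> carrier G"
  shows "orb p (g \<otimes> h) = orb (orb p h) g"
proof -
  obtain x \<alpha> where p': "p = (x, \<alpha>)" by (cases p)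
  then have x: "x \<in> pts M" using p by (auto simp: total_D)
  have "\<Phi> (inv (g \<otimes> h)) b = \<Phi> (inv h) (\<Phi> (inv g) b)" if "b \<in> fib E y" for b y
    using base_action(4)[of "inv h" "inv g" b] that g by (simp add: inv_mult_group fib_D)
  then show ?thesis
    using base_action(2)[OF g x] action_inv_fib[OF g(1) base_action_pts[OF g(2) x]]
    by (auto simp: p' dual_action_def fun_eq_iff)
qed

text \<open>A covector is linear on one fibre and zero off it, hence in general not smooth on the
  total space. For maps into that fibre it is an inner product with fixed coordinates.\<close>

lemma smooth_at_covector:
  fixes \<X> :: "('p, 'h::real_inner) atlas"
  assumes X: "mfd \<X>" and \<alpha>: "\<alpha> \<in> dual_fib E x" and h: "smooth_at \<X> T h p"
    and N: "openin (mtop \<X>) N" "p \<in> N" "\<And>q. q \<in> N \<Longrightarrow> h q \<in> fib E x"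
  shows "smooth_at \<X> model (\<lambda>q. \<alpha> (h q)) p"
proof -
  have x: "x \<in> pts M" using fib_pts N by blast
  obtain W \<theta> where W: "(W, \<theta>) \<in> trivs E" "x \<in> W" using triv_exists[OF x] by blast
  have "smooth_at T model \<theta> (h p)" using N(3)[OF N(2)] W by (intro smooth_at_triv[OF _ W(1)]) (auto simp: fib_def)
  from smooth_at_compose[OF X mfd_total mfd_model[OF finite_dim_fibre] h this]
  have "smooth_at \<X> model (\<lambda>q. dtriv E \<theta> (x, \<alpha>) \<bullet> \<theta> (h q)) p"
    by (rule smooth_at_linear[OF X finite_dim_fibre finite_dim_real bounded_linear_inner_right])
  then show ?thesis
    by (rule smooth_at_cong[OF X _ N(1,2)]) (simp add: dtriv_pairing[OF W \<alpha> N(3)])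
qed

text \<open>Smoothness of the dual action has to be derived from that of \<Phi>. The fibre
  coordinates of \<open>orb p h\<close> are values of the fixed covector \<alpha> on frame vectors
  over \<open>\<phi> h x\<close> brought back to the fibre over \<open>x\<close> by the inverse of
  \<open>h\<close>.\<close>

lemma smooth_at_orb:
  assumes p: "p \<in> total D" and g: "g \<in> pts \<G>"
  shows "smooth_at \<G> (total_atlas D) (orb p) g"
proof -
  interpret D: vb D by (rule dual_vb)
  obtain x \<alpha> where p': "p = (x, \<alpha>)" by (cases p)
  have x: "x \<in> pts M" "\<alpha> \<in> dual_fib E x" and gc: "g \<in> carrier G" using p g by (auto simp: p' total_D pts_group)
  obtain W \<theta> where W: "(W, \<theta>) \<in> trivs E" "\<phi> g x \<in> W"
    using triv_exists[OF base_action_pts[OF gc x(1)]] by blast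
  have sb: "smooth_at \<G> M (\<lambda>g. \<phi> g x) g"
    by (intro smooth_at_base_action[OF mfd_group] smooth_at_ident[OF mfd_group g] smooth_at_const[OF mfd_group g x(1)])
  obtain N where N: "openin (mtop \<G>) N" "g \<in> N" "(\<lambda>g. \<phi> g x) ` N \<subseteq> W"
    using smooth_at_continuous[OF mfd_group mfd_base sb triv_open[OF W(1)] W(2)] .
  have NG: "h \<in> carrier G" if "h \<in> N" for h using openin_subset[OF N(1)] that by (auto simp: topspace_mtop[OF mfd_group] pts_group)
  have NW: "\<phi> h x \<in> W" if "h \<in> N" for h using N(3) that by blast
  have sl: "smooth_at \<G> T (\<lambda>h. \<Phi> (inv h) (lift E \<theta> (\<phi> h x) b)) g" for b
    by (intro smooth_at_bundle_action[OF mfd_group] smooth_at_group_inv[OF mfd_group] smooth_at_ident[OF mfd_group g]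
        smooth_at_lift[OF mfd_group W(1) W(2) sb] smooth_at_const[OF mfd_group g]) (simp add: pts_model)
  have lf: "\<Phi> (inv h) (lift E \<theta> (\<phi> h x) b) \<in> fib E x" if "h \<in> N" for h b
    by (intro action_inv_fib NG that x lift_fib[OF W(1)] NW)
  have "smooth_at \<G> model (\<lambda>h. \<Sum>b\<in>onb. \<alpha> (\<Phi> (inv h) (lift E \<theta> (\<phi> h x) b)) *\<^sub>R b) g"
    by (intro smooth_at_sum[OF mfd_group g finite_dim_fibre] smooth_at_linear[OF mfd_group finite_dim_real finite_dim_fibre bounded_linear_scaleR_left]
        smooth_at_covector[OF mfd_group x(2) sl N(1,2)] lf)
  then have th: "smooth_at \<G> model (\<lambda>h. dtriv E \<theta> (orb p h)) g"
  proof (rule smooth_at_cong[OF mfd_group _ N(1,2)])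
    fix h assume h: "h \<in> N"
    obtain \<beta> where \<beta>: "orb p h = (\<phi> h x, \<beta>)" "\<beta> = (\<lambda>b. if b \<in> fib E (\<phi> h x) then \<alpha> (\<Phi> (inv h) b) else 0)"
      by (simp add: p' dual_action_def)
    have d: "\<beta> \<in> dual_fib E (\<phi> h x)" using orb_total[OF p NG[OF h]] \<beta>(1) by (simp add: total_D)
    show "(\<Sum>b\<in>onb. \<alpha> (\<Phi> (inv h) (lift E \<theta> (\<phi> h x) b)) *\<^sub>R b) = dtriv E \<theta> (orb p h)"
      unfolding \<beta>(1) dtriv_eq(1)[OF W(1) NW[OF h] d] by (simp add: \<beta>(2) lift_fib[OF W(1) NW[OF h]])
  qed
  show ?thesis
  proof (rule D.smooth_at_into_total[OF mfd_group _ _ _ th N(1,2)])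
    show "(W, dtriv E \<theta>) \<in> trivs D" using W(1) by (auto simp: dual_bundle_simps)
    show "proj D (orb p g) \<in> W" using W(2) by (simp add: dual_bundle_simps fst_orb p')
    show "smooth_at \<G> (base D) (\<lambda>q. proj D (orb p q)) g" using sb by (simp add: dual_bundle_simps fst_orb p')
    show "orb p q \<in> total D" if "q \<in> N" for q by (rule orb_total[OF p NG[OF that]])
  qed
qed

section \<open>Infinitesimal generators on functions from the base and on fibrewise linear
  functions\<close>

lemma lie_algD: "\<xi> \<in> \<gg> \<Longrightarrow> \<xi> \<in> tangent \<G> \<one>"
  by (simp add: lie_alg_def)

lemma psi_section: "\<xi> \<in> \<gg> \<Longrightarrow> \<psi> \<xi> \<in> sections E"
  using lifts by (simp add: by_complete_lifts_def lie_anti_morphism_def)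

text \<open>The generator on \<open>E\<close> is a complete lift, hence projects to the anchor of
  \<open>\<psi> \<xi>\<close>; and \<Phi> covers \<phi>, so it also projects to the generator on the
  base.\<close>

lemma anchor_psi:
  assumes \<xi>: "\<xi> \<in> \<gg>" and x: "x \<in> pts M" and f: "f \<in> Cinf M"
  shows "\<rho> (\<psi> \<xi> x) f = \<xi> (\<lambda>g. f (\<phi> g x))"
proof -
  obtain W \<theta> where W: "(W, \<theta>) \<in> trivs E" "x \<in> W" using triv_exists[OF x] by blast
  \<comment> \<open>Projectability is evaluated at some vector over \<open>x\<close>; the zero
    vector serves as one.\<close>
  define a where "a = lift E \<theta> x 0"
  have a: "a \<in> fib E x" "a \<in> total E" "proj E a = x" using lift_fib[OF W] by (auto simp: a_def fib_def)
  have fp: "f \<circ> proj E \<in> Cinf T"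
    using Cinf_compose[OF mfd_total mfd_base f smooth_at_proj'] by (simp add: comp_def pts_total)
  have "push M (proj E) (inf_gen T \<Phi> \<xi> a) = \<rho> (\<psi> \<xi> x)"
    using lifts \<xi> a by (auto simp: by_complete_lifts_def complete_lift_def)
  from fun_cong[OF this, of f, symmetric]
  have "\<rho> (\<psi> \<xi> x) f = \<xi> ((f \<circ> proj E) \<circ> (\<lambda>g. \<Phi> g a))"
    using f fp by (simp add: push_def inf_gen_def)
  also have "\<dots> = \<xi> (\<lambda>g. f (\<phi> g x))"
  proof (rule tangent_cong[OF mfd_group hausdorff_group one_pts lie_algD[OF \<xi>]])
    show "(f \<circ> proj E) \<circ> (\<lambda>g. \<Phi> g a) \<in> Cinf \<G>"
      unfolding comp_def[of "f \<circ> proj E"] by (rule orbit_Cinf[OF fp a(2)])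
    show "((f \<circ> proj E) \<circ> (\<lambda>g. \<Phi> g a)) g = f (\<phi> g x)" if "g \<in> pts \<G>" for g
      using action_fib[OF _ a(1), of g] that by (simp add: pts_group fib_def)
  qed
  finally show ?thesis .
qed

lemma br_section: "X \<in> sections E \<Longrightarrow> Y \<in> sections E \<Longrightarrow> br X Y \<in> sections E"
  using algebroid unfolding lie_algebroid_def by blast

text \<open>For a section \<open>\<beta>\<close> of the dual bundle through \<open>p\<close>, the pairing of \<open>\<beta>\<close> with \<open>Y\<close> along the base
  orbit is the pairing of \<open>\<beta>\<close> transported by \<open>\<Phi>\<close> with \<open>Y\<close> transported back to the fibre of \<open>p\<close>;
  differentiating this product leaves the Lie derivative of \<open>\<beta>\<close> as the difference of two known terms.
  The section \<open>Y\<close> is the one that \<open>section_of\<close> selects for the value \<open>a\<close>.\<close>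

lemma derivative_hat_orb:
  assumes \<xi>: "\<xi> \<in> \<gg>" and p: "p \<in> total D" and a: "a \<in> fib E (fst p)"
  shows "\<exists>Y\<in>sections E. Y (fst p) = a \<and> \<xi> (\<lambda>g. hat Y (orb p g)) = snd p (br (\<psi> \<xi>) Y (fst p))"
proof -
  define x where "x = fst p"
  define \<alpha> where "\<alpha> = snd p"
  have x: "x \<in> pts M" "\<alpha> \<in> dual_fib E x" using p by (auto simp: x_def \<alpha>_def total_D)
  obtain \<beta> where \<beta>: "\<beta> \<in> sections D" "\<beta> x = (x, \<alpha>)" using dual_section_through[OF x] by blast
  define Y where "Y = (SOME Y. Y \<in> sections E \<and> Y x = a)"
  have "\<exists>Y. Y \<in> sections E \<and> Y x = a" using section_through[OF x(1)] a by (auto simp: x_def)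
  from someI_ex[OF this] have Y: "Y \<in> sections E" "Y x = a" by (simp_all add: Y_def)
  note v = lie_algD[OF \<xi>]
  define X where "X = \<psi> \<xi>"
  have X: "X \<in> sections E" using psi_section[OF \<xi>] by (simp add: X_def)
  have a': "a \<in> fib E x" "a \<in> total E" "proj E a = x" using a by (auto simp: x_def fib_def)
  obtain W \<theta> where W: "(W, \<theta>) \<in> trivs E" "x \<in> W" using triv_exists[OF x(1)] by blast

  define f where "f y = snd (\<beta> y) (Y y)" for y
  have f: "f \<in> Cinf M"
  proof (rule Cinf_cong[OF mfd_base])
    show "(\<lambda>y. hat Y (\<beta> y)) \<in> Cinf M"
      using Cinf_compose[OF mfd_base mfd_dual hat_Cinf[OF Y(1)]] dual_section(1)[OF \<beta>(1)] by blast
    show "hat Y (\<beta> y) = f y" if "y \<in> pts M" for y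
      using dual_section(2)[OF \<beta>(1) that] by (simp add: hat_def f_def split_beta)
  qed
  have fx: "\<rho> (X x) f = \<xi> (\<lambda>g. f (\<phi> g x))" unfolding X_def by (rule anchor_psi[OF \<xi> x(1) f])

  have "inf_gen T \<Phi> \<xi> a (hat_dual E \<beta>) = hat_dual E (lie_deriv E br \<rho> X \<beta>) a"
    using lifts \<xi> \<beta>(1) a' by (auto simp: by_complete_lifts_def complete_lift_def X_def)
  also have "\<dots> = lie_deriv_form br \<rho> X (form_of \<beta>) [Y] x"
    using a' x(1) by (simp add: hat_dual_def lie_deriv_def section_of_def Y_def)
  \<comment> \<open>Cartan's formula on a form of degree one: the two terms with the anchor of
    \<open>Y\<close> applied to the pairing of \<beta> with \<open>X\<close> cancel.\<close>
  also have "\<dots> = \<rho> (X x) f - \<alpha> (br X Y x)"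
  proof -
    have [simp]: "{..<Suc 0} = {0}" "{..<Suc (Suc 0)} = {0, 1}" by auto
    show ?thesis
      by (simp add: lie_deriv_form_def contract_def dA_def form_of_def omit_def f_def[abs_def] \<beta>(2))
  qed
  finally have Va: "inf_gen T \<Phi> \<xi> a (hat_dual E \<beta>) = \<rho> (X x) f - \<alpha> (br X Y x)" .
  have Va': "inf_gen T \<Phi> \<xi> a (hat_dual E \<beta>) = \<xi> (\<lambda>g. hat_dual E \<beta> (\<Phi> g a))"
    using hat_dual_Cinf[OF \<beta>(1)] by (simp add: inf_gen_def push_def comp_def)

  \<comment> \<open>Coordinates, in the fixed fibre over \<open>x\<close>, of \<open>Y\<close>
    brought back along the orbit. \<open>B\<close> below represents the covector of \<beta> pulled
    back by \<Phi> to the same fibre, so that \<open>B g \<bullet> b g\<close> is the pairing of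
    \<beta> with \<open>Y\<close> at \<open>\<phi> g x\<close>.\<close>
  define b where "b g = \<theta> (\<Phi> (inv g) (Y (\<phi> g x)))" for g
  define B where "B g = (\<Sum>c\<in>onb. hat_dual E \<beta> (\<Phi> g (lift E \<theta> x c)) *\<^sub>R c)" for g
  have bk: "\<Phi> (inv g) (Y (\<phi> g x)) \<in> fib E x" if "g \<in> carrier G" for g
    by (intro action_inv_fib[OF that x(1)] section_fib[OF Y(1)] base_action_pts[OF that x(1)])
  have bs: "smooth_at \<G> model b g" if g: "g \<in> pts \<G>" for g
  proof -
    have gc: "g \<in> carrier G" using g by (simp add: pts_group)
    have sb: "smooth_at \<G> M (\<lambda>g. \<phi> g x) g"
      by (intro smooth_at_base_action[OF mfd_group] smooth_at_ident[OF mfd_group g] smooth_at_const[OF mfd_group g x(1)])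
    have "smooth_at \<G> T (\<lambda>g. Y (\<phi> g x)) g"
      by (rule smooth_at_compose[OF mfd_group mfd_base mfd_total sb section_smooth_at[OF Y(1) base_action_pts[OF gc x(1)]]])
    then have "smooth_at \<G> T (\<lambda>g. \<Phi> (inv g) (Y (\<phi> g x))) g"
      by (intro smooth_at_bundle_action[OF mfd_group] smooth_at_group_inv[OF mfd_group] smooth_at_ident[OF mfd_group g])
    moreover have "smooth_at T model \<theta> (\<Phi> (inv g) (Y (\<phi> g x)))"
      using bk[OF gc] W(2) by (intro smooth_at_triv[OF _ W(1)]) (auto simp: fib_def)
    ultimately show ?thesis unfolding b_def by (rule smooth_at_compose[OF mfd_group mfd_total mfd_model[OF finite_dim_fibre]])
  qed
  have oC: "(\<lambda>g. hat_dual E \<beta> (\<Phi> g c)) \<in> Cinf \<G>" if "c \<in> fib E x" for c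
    using orbit_Cinf[OF hat_dual_Cinf[OF \<beta>(1)]] that by (simp add: fib_def)
  have Bs: "smooth_at \<G> model B g" if g: "g \<in> pts \<G>" for g
    unfolding B_def
    by (intro smooth_at_sum[OF mfd_group g finite_dim_fibre] smooth_at_linear[OF mfd_group finite_dim_real finite_dim_fibre bounded_linear_scaleR_left]
        Cinf_smooth_at[OF mfd_group oC g] lift_fib[OF W])
  have pair: "hat_dual E \<beta> (\<Phi> g c) = B g \<bullet> \<theta> c" if g: "g \<in> carrier G" and c: "c \<in> fib E x" for g c
  proof -
    have gx: "\<phi> g x \<in> pts M" by (rule base_action_pts[OF g x(1)])
    note d = dual_section(4)[OF \<beta>(1) gx]
    obtain W' \<theta>' where W': "(W', \<theta>') \<in> trivs E" "\<phi> g x \<in> W'" using triv_exists[OF gx] by blast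
    have hd: "hat_dual E \<beta> b = snd (\<beta> (\<phi> g x)) b" if "b \<in> fib E (\<phi> g x)" for b
      using that by (simp add: hat_dual_def fib_def)
    define l where "l v = hat_dual E \<beta> (\<Phi> g (lift E \<theta> x v))" for v
    have "linear l"
      using dual_fib_D(1,2)[OF d] action_fib[OF g lift_fib[OF W]] triv_props(2,4)[OF W']
      by (intro linearI) (simp_all add: l_def lift_add[OF W] lift_scale[OF W] hd
          action_linear[OF g lift_fib[OF W] lift_fib[OF W]])
    from linear_onb_expand[OF finite_dim_fibre this, of "\<theta> c"]
    show ?thesis by (simp add: l_def lift_triv[OF W c] B_def inner_sum_left mult.commute inner_commute[of "\<theta> c"])
  qed
  have b1: "b \<one> = \<theta> a"
    using a' x(1) by (simp add: b_def base_action Y(2))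
  have C: "(\<lambda>g. B g \<bullet> b g) \<in> Cinf \<G>" "(\<lambda>g. B \<one> \<bullet> b g) \<in> Cinf \<G>" "(\<lambda>g. B g \<bullet> b \<one>) \<in> Cinf \<G>"
    using Bs bs
    by (auto simp: Cinf_iff[OF mfd_group] intro!: smooth_at_bilinear[OF mfd_group finite_dim_fibre finite_dim_fibre finite_dim_real bounded_bilinear_inner]
        smooth_at_linear[OF mfd_group finite_dim_fibre finite_dim_real bounded_linear_inner_left]
        smooth_at_linear[OF mfd_group finite_dim_fibre finite_dim_real bounded_linear_inner_right])
  have "\<xi> (\<lambda>g. B g \<bullet> b g) = \<xi> (\<lambda>g. f (\<phi> g x))"
  proof (rule tangent_cong[OF mfd_group hausdorff_group one_pts v C(1)])
    fix g assume "g \<in> pts \<G>"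
    then have g: "g \<in> carrier G" by (simp add: pts_group)
    have Yg: "Y (\<phi> g x) \<in> fib E (\<phi> g x)" by (rule section_fib[OF Y(1) base_action_pts[OF g x(1)]])
    show "B g \<bullet> b g = f (\<phi> g x)"
      using pair[OF g bk[OF g]] Yg action_inv[OF g Yg] by (simp add: b_def f_def hat_dual_def fib_def)
  qed
  moreover have "\<xi> (\<lambda>g. B g \<bullet> b \<one>) = \<xi> (\<lambda>g. hat_dual E \<beta> (\<Phi> g a))"
    by (rule tangent_cong[OF mfd_group hausdorff_group one_pts v C(3)]) (simp add: pair a' b1 pts_group)
  moreover have "\<xi> (\<lambda>g. B \<one> \<bullet> b g) = \<xi> (\<lambda>g. hat Y (orb p g))"
  proof (rule tangent_cong[OF mfd_group hausdorff_group one_pts v C(2)])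
    fix g assume "g \<in> pts \<G>"
    then have g: "g \<in> carrier G" by (simp add: pts_group)
    have "B \<one> \<bullet> b g = hat_dual E \<beta> (\<Phi> (inv g) (Y (\<phi> g x)))"
      using pair[OF one_closed bk[OF g]] bk[OF g] by (simp add: b_def base_action fib_def)
    also have "\<dots> = hat Y (orb p g)"
      using hat_orb[OF p g Y(1)] bk[OF g] \<beta>(2) by (simp add: hat_dual_def fib_def x_def \<alpha>_def)
    finally show "B \<one> \<bullet> b g = hat Y (orb p g)" .
  qed
  moreover have "\<xi> (\<lambda>g. B g \<bullet> b g) = \<xi> (\<lambda>g. B \<one> \<bullet> b g) + \<xi> (\<lambda>g. B g \<bullet> b \<one>)"
    by (rule tangent_inner[OF mfd_group hausdorff_group one_pts finite_dim_fibre v Bs bs])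
  \<comment> \<open>The derivative of the full product is \<open>\<rho> (X x) f\<close>, and that
    with \<open>b\<close> frozen is \<open>\<rho> (X x) f - \<alpha> (br X Y x)\<close>. The
    derivative with \<open>B\<close> frozen is their difference.\<close>
  ultimately have "\<xi> (\<lambda>g. hat Y (orb p g)) = \<alpha> (br X Y x)"
    using fx Va Va' by simp
  then show ?thesis using Y by (auto simp: X_def x_def \<alpha>_def)
qed

section \<open>The Hamiltonian vector fields of the components of the momentum map\<close>

lemma hat_bracket_swap:
  assumes "X \<in> sections E" "Y \<in> sections E" "p \<in> total D"
  shows "hat (br Y X) p = - hat (br X Y) p"
proof -
  have x: "fst p \<in> pts M" "snd p \<in> dual_fib E (fst p)" using assms(3) by (auto simp: total_D)
  have "br Y X = sec_mult E (\<lambda>_. -1) (br X Y)" using algebroid assms(1,2) unfolding lie_algebroid_def by blast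
  then show ?thesis
    using x dual_fib_D(2)[OF x(2) section_fib[OF br_section[OF assms(1,2)] x(1)], of "-1"]
    by (simp add: hat_def split_beta sec_mult_def)
qed

lemma hamiltonian_hat:
  assumes \<xi>: "\<xi> \<in> \<gg>" and p: "p \<in> total D" and K: "K \<in> Cinf (total_atlas D)"
  shows "P K (hat (\<psi> \<xi>)) p = \<xi> (\<lambda>g. K (orb p g))"
proof -
  define X where "X = \<psi> \<xi>"
  have X: "X \<in> sections E" using psi_section[OF \<xi>] by (simp add: X_def)
  note hX = hat_Cinf[OF X] and pD = p[folded pts_dual] and v = lie_algD[OF \<xi>]
  have pb: "poisson_bracket (total_atlas D) P" using poisson by (simp add: linear_poisson_def)
  have skew: "P K (hat X) p = - P (hat X) K p" if "K \<in> Cinf (total_atlas D)" for K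
    using pb that hX pD unfolding poisson_bracket_def by blast
  have Padd: "P (hat X) (\<lambda>q. K q + L q) p = P (hat X) K p + P (hat X) L p"
    and Pmult: "P (hat X) (\<lambda>q. K q * L q) p = P (hat X) K p * L p + K p * P (hat X) L p"
    if "K \<in> Cinf (total_atlas D)" "L \<in> Cinf (total_atlas D)" for K L
    using pb that hX pD unfolding poisson_bracket_def by blast+
  have Pscale: "P (hat X) (\<lambda>q. c * K q) p = c * P (hat X) K p" if "K \<in> Cinf (total_atlas D)" for K c
    using pb that hX pD unfolding poisson_bracket_def by blast
  have cs: "(\<lambda>q. c * K q) \<in> Cinf (total_atlas D)" if "K \<in> Cinf (total_atlas D)" for c K
    using Cinf_mult[OF mfd_dual Cinf_const[OF mfd_dual] that] .
  \<comment> \<open>The Hamiltonian vector at \<open>p\<close>, turned by skew-symmetry so that the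
    varying function is in the second slot, for which \<open>poisson_bracket\<close> states
    linearity and the Leibniz rule. The value 0 off the smooth functions is the normalisation in
    \<open>tangent\<close>.\<close>
  define v1 where "v1 K = (if K \<in> Cinf (total_atlas D) then - P (hat X) K p else 0)" for K
  have v1: "v1 \<in> tangent (total_atlas D) p"
    unfolding tangent_def v1_def
    by (auto simp: Cinf_add[OF mfd_dual] Cinf_mult[OF mfd_dual] cs Padd Pmult Pscale)
  define v2 where "v2 = push (total_atlas D) (orb p) \<xi>"
  have v2: "v2 \<in> tangent (total_atlas D) p"
    using push_tangent[OF mfd_group mfd_dual smooth_at_orb[OF p] v] by (simp add: v2_def orb_one[OF p])
  have v2': "v2 K = \<xi> (\<lambda>g. K (orb p g))" if "K \<in> Cinf (total_atlas D)" for K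
    using that by (simp add: v2_def push_def comp_def)
  have "v1 K - v2 K = 0"
  proof (rule tangent_dual_eq_zero[OF p tangent_diff[OF v1 v2] _ _ K])
    fix f assume f: "f \<in> Cinf M"
    have ff: "f \<circ> fst \<in> Cinf (total_atlas D)"
      using Cinf_compose[OF mfd_dual mfd_base f smooth_at_fst_dual] by (simp add: comp_def pts_dual)
    have "P (hat X) (f \<circ> fst) p = - \<rho> (X (fst p)) f"
      using poisson X f p unfolding linear_poisson_def dual_bundle_simps(3) by blast
    moreover have "\<rho> (X (fst p)) f = \<xi> (\<lambda>g. f (\<phi> g (fst p)))"
      unfolding X_def using p by (intro anchor_psi[OF \<xi> _ f]) (simp add: total_D)
    ultimately show "v1 (f \<circ> fst) - v2 (f \<circ> fst) = 0"
      using ff by (simp add: v1_def v2' fst_orb)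
  next
    fix a assume a: "a \<in> fib E (fst p)"
    obtain Y where Y: "Y \<in> sections E" "Y (fst p) = a"
      "\<xi> (\<lambda>g. hat Y (orb p g)) = snd p (br X Y (fst p))"
      using derivative_hat_orb[OF \<xi> p a] unfolding X_def by blast
    have "P (hat X) (hat Y) p = - hat (br X Y) p"
      using poisson X Y(1) p by (simp add: linear_poisson_def)
    then have "v1 (hat Y) - v2 (hat Y) = 0"
      using Y(3) hat_Cinf[OF Y(1)] by (simp add: v1_def v2' hat_def split_beta)
    then show "\<exists>Y\<in>sections E. Y (fst p) = a \<and> v1 (hat Y) - v2 (hat Y) = 0" using Y by blast
  qed
  then show ?thesis using K skew[OF K] by (simp add: v1_def v2' X_def)
qed

text \<open>Extends \<open>derivative_hat_orb\<close> from the selected sections to all sections, by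
  evaluating the Hamiltonian identity at \<open>K = hat Y\<close>.\<close>

lemma derivative_hat_orb_bracket:
  assumes \<xi>: "\<xi> \<in> \<gg>" and p: "p \<in> total D" and Y: "Y \<in> sections E"
  shows "\<xi> (\<lambda>g. hat Y (orb p g)) = hat (br (\<psi> \<xi>) Y) p"
  using hamiltonian_hat[OF \<xi> p hat_Cinf[OF Y]] hat_bracket_swap[OF psi_section[OF \<xi>] Y p]
    poisson psi_section[OF \<xi>] Y p by (simp add: linear_poisson_def)

subsection \<open>The adjoint action\<close>

lemma smooth_at_group_prod:
  assumes "h \<in> carrier G" "k \<in> carrier G"
  shows "smooth_at (prod_atlas \<G> \<G>) \<G> fst (h, k)" "smooth_at (prod_atlas \<G> \<G>) \<G> snd (h, k)"
  using smooth_at_fst[OF mfd_group mfd_group, of "(h, k)"] assms by (simp_all add: pts_prod pts_group)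

lemma smooth_at_conj:
  assumes "g \<in> carrier G" "h \<in> carrier G"
  shows "smooth_at \<G> \<G> (\<lambda>h. g \<otimes> h \<otimes> inv g) h"
  by (intro smooth_at_group_mult[OF mfd_group] smooth_at_ident[OF mfd_group] smooth_at_const[OF mfd_group])
     (simp_all add: pts_group assms)

lemma conj_Cinf:
  assumes "g \<in> carrier G" "f \<in> Cinf \<G>"
  shows "(\<lambda>h. f (g \<otimes> h \<otimes> inv g)) \<in> Cinf \<G>"
  by (rule Cinf_compose[OF mfd_group mfd_group assms(2) smooth_at_conj[OF assms(1)]]) (simp add: pts_group)

lemma Ad_apply:
  "f \<in> Cinf \<G> \<Longrightarrow> Ad G \<G> g \<xi> f = \<xi> (\<lambda>h. f (g \<otimes> h \<otimes> inv g))"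
  by (simp add: Ad_def push_def comp_def)

lemma Ad_lie_alg:
  assumes "g \<in> carrier G" "\<xi> \<in> \<gg>"
  shows "Ad G \<G> g \<xi> \<in> \<gg>"
proof -
  have "push \<G> (\<lambda>h. g \<otimes> h \<otimes> inv g) \<xi> \<in> tangent \<G> (g \<otimes> \<one> \<otimes> inv g)"
    by (rule push_tangent[OF mfd_group mfd_group _ lie_algD[OF assms(2)]]) (simp add: smooth_at_conj assms(1) pts_group)
  then show ?thesis using assms(1) by (simp add: Ad_def lie_alg_def)
qed

lemma lie_alg_eqI:
  assumes "\<xi> \<in> \<gg>" "\<eta> \<in> \<gg>" "\<And>f. f \<in> Cinf \<G> \<Longrightarrow> \<xi> f = \<eta> f"
  shows "\<xi> = \<eta>"
proof
  show "\<xi> f = \<eta> f" for f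
    using assms(3)[of f] tangent_off_Cinf[OF lie_algD[OF assms(1)], of f] tangent_off_Cinf[OF lie_algD[OF assms(2)], of f]
    by (cases "f \<in> Cinf \<G>") auto
qed

lemma lie_alg_cong:
  assumes "\<xi> \<in> \<gg>" "f \<in> Cinf \<G>" "\<And>g. g \<in> carrier G \<Longrightarrow> f g = h g"
  shows "\<xi> f = \<xi> h"
  by (rule tangent_cong[OF mfd_group hausdorff_group one_pts lie_algD[OF assms(1)] assms(2)]) (simp add: assms(3) pts_group)

lemma Ad_one:
  assumes "\<xi> \<in> \<gg>"
  shows "Ad G \<G> \<one> \<xi> = \<xi>"
proof (rule lie_alg_eqI[OF Ad_lie_alg[OF one_closed assms] assms])
  fix f assume f: "f \<in> Cinf \<G>"
  show "Ad G \<G> \<one> \<xi> f = \<xi> f"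
    unfolding Ad_apply[OF f] by (rule lie_alg_cong[OF assms conj_Cinf[OF one_closed f]]) simp
qed

lemma Ad_mult:
  assumes "g \<in> carrier G" "h \<in> carrier G" "\<xi> \<in> \<gg>"
  shows "Ad G \<G> (g \<otimes> h) \<xi> = Ad G \<G> g (Ad G \<G> h \<xi>)"
proof (rule lie_alg_eqI)
  fix f assume f: "f \<in> Cinf \<G>"
  show "Ad G \<G> (g \<otimes> h) \<xi> f = Ad G \<G> g (Ad G \<G> h \<xi>) f"
    unfolding Ad_apply[OF f] Ad_apply[OF conj_Cinf[OF assms(1) f]] using assms(1,2)
    by (intro lie_alg_cong[OF assms(3) conj_Cinf[OF _ f]]) (simp_all add: m_assoc inv_mult_group)
qed (use assms in \<open>auto intro: Ad_lie_alg\<close>)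

section \<open>The Lie algebra in the coordinates of a chart at the unit\<close>

definition unit_chart where
  "unit_chart = (SOME c. c \<in> \<G> \<and> \<one> \<in> fst c)"

abbreviation "d w f \<equiv> chart_deriv (fst unit_chart) (snd unit_chart) \<one> f w"

lemma unit_chart: "(fst unit_chart, snd unit_chart) \<in> \<G>" "\<one> \<in> fst unit_chart"
proof -
  have "\<exists>c. c \<in> \<G> \<and> \<one> \<in> fst c"
    using pts_chart[OF one_pts] by auto
  from someI_ex[OF this] show "(fst unit_chart, snd unit_chart) \<in> \<G>" "\<one> \<in> fst unit_chart"
    by (auto simp: unit_chart_def)
qed

lemma finite_dim_group: "finite_dim TYPE('k)"
  by (rule mfd_finite_dim[OF mfd_group])

text \<open>A linear map from the model space onto the Lie algebra, so that \<open>onb\<close>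
  supplies finite expansions of Lie algebra elements.\<close>

definition alg_of :: "'k \<Rightarrow> 'g lie_vec" where
  "alg_of w = (\<lambda>f. if f \<in> Cinf \<G> then d w f else 0)"

lemma alg_of_lie_alg: "alg_of w \<in> \<gg>"
  using coord_tangent[OF mfd_group unit_chart] by (simp add: alg_of_def[abs_def] lie_alg_def)

lemma alg_of_surj:
  assumes "\<xi> \<in> \<gg>"
  obtains w where "\<xi> = alg_of w"
proof -
  obtain w where w: "\<forall>f\<in>Cinf \<G>. \<xi> f = d w f"
    using tangent_coord[OF mfd_group hausdorff_group unit_chart lie_algD[OF assms]] by blast
  then have "\<xi> = alg_of w"
    by (intro lie_alg_eqI[OF assms alg_of_lie_alg]) (simp add: alg_of_def)
  then show thesis by (rule that)
qed

lemma d_linear: "f \<in> Cinf \<G> \<Longrightarrow> linear (\<lambda>w. d w f)"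
  using chart_deriv_linear[OF mfd_group finite_dim_real unit_chart Cinf_smooth_at[OF mfd_group _ one_pts]] by blast

lemma d_cong: "(\<And>g. g \<in> carrier G \<Longrightarrow> f g = h g) \<Longrightarrow> d w f = d w h"
  by (rule fun_cong[OF chart_deriv_cong[OF mfd_group unit_chart openin_pts[OF mfd_group] one_pts]]) (simp add: pts_group)

lemma alg_of_add: "alg_of (v + w) = (\<lambda>f. alg_of v f + alg_of w f)"
  by (auto simp: alg_of_def fun_eq_iff linear_add[OF d_linear])

lemma alg_of_scale: "alg_of (c *\<^sub>R w) = (\<lambda>f. c * alg_of w f)"
  by (auto simp: alg_of_def fun_eq_iff linear_scale[OF d_linear])

lemma linear_hat_psi:
  assumes p: "p \<in> total D"
  shows "linear (\<lambda>w. hat (\<psi> (alg_of w)) p)"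
proof -
  have x: "fst p \<in> pts M" "snd p \<in> dual_fib E (fst p)" using p by (auto simp: total_D)
  have m: "lie_anti_morphism G \<G> E br \<psi>" using lifts by (simp add: by_complete_lifts_def)
  have s: "\<psi> (alg_of w) (fst p) \<in> fib E (fst p)" for w
    by (intro section_fib psi_section alg_of_lie_alg x)
  have "\<psi> (alg_of (v + w)) = sec_add E (\<psi> (alg_of v)) (\<psi> (alg_of w))" for v w
    using m alg_of_lie_alg unfolding alg_of_add lie_anti_morphism_def by blast
  moreover have "\<psi> (alg_of (c *\<^sub>R w)) = sec_mult E (\<lambda>_. c) (\<psi> (alg_of w))" for c w
    using m alg_of_lie_alg unfolding alg_of_scale lie_anti_morphism_def by blast
  ultimately show ?thesis
    using x dual_fib_D(1,2)[OF x(2)] s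
    by (intro linearI) (simp_all add: hat_def split_beta sec_add_def sec_mult_def)
qed

text \<open>Coordinates of the adjoint action on the element with coordinates \<open>w\<close>. The
  group element comes last because \<open>Ad_vec w\<close> is going to be differentiated as a
  vector-valued function on the group.\<close>

definition Ad_vec :: "'k \<Rightarrow> 'g \<Rightarrow> 'k" where
  "Ad_vec w g = d w (\<lambda>h. snd unit_chart (g \<otimes> h \<otimes> inv g))"

text \<open>Conjugation fixes the unit, so the chain rule can use the same chart on both
  sides.\<close>

lemma d_conj:
  assumes g: "g \<in> carrier G" and f: "f \<in> Cinf \<G>"
  shows "d w (\<lambda>h. f (g \<otimes> h \<otimes> inv g)) = d (Ad_vec w g) f"
proof -
  have 1: "g \<otimes> \<one> \<otimes> inv g = \<one>" using g by simp
  show ?thesis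
    unfolding Ad_vec_def
    using chart_deriv_compose[where h = "\<lambda>h. g \<otimes> h \<otimes> inv g" and f = f and w = w,
        OF mfd_group mfd_group finite_dim_real unit_chart unit_chart(1) _ smooth_at_conj[OF g one_closed]]
      unit_chart(2) Cinf_smooth_at[OF mfd_group f one_pts] unfolding 1 by blast
qed

lemma Ad_vec: "g \<in> carrier G \<Longrightarrow> Ad G \<G> g (alg_of w) = alg_of (Ad_vec w g)"
  by (rule lie_alg_eqI[OF Ad_lie_alg alg_of_lie_alg])
     (simp_all add: alg_of_lie_alg Ad_apply, simp add: alg_of_def conj_Cinf d_conj)

lemma Ad_vec_one: "Ad_vec w \<one> = w"
proof -
  have "Ad_vec w \<one> = d w (snd unit_chart)" unfolding Ad_vec_def by (rule d_cong) simp
  then show ?thesis using chart_deriv_chart[OF mfd_group unit_chart] by simp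
qed

text \<open>\<open>Ad_vec w\<close> is a derivative in the second variable of a smooth map on the
  product of the group with itself, with the first variable as parameter.\<close>

lemma smooth_at_Ad_vec:
  assumes g: "g \<in> carrier G"
  shows "smooth_at \<G> model (Ad_vec w) g"
proof -
  have "smooth_at (prod_atlas \<G> \<G>) \<G> (\<lambda>z. fst z \<otimes> snd z \<otimes> inv (fst z)) (g, \<one>)"
    using g by (intro smooth_at_group_mult[OF mfd_prod[OF mfd_group mfd_group]] smooth_at_group_inv[OF mfd_prod[OF mfd_group mfd_group]]
        smooth_at_group_prod) simp_all
  moreover have "smooth_at \<G> model (snd unit_chart) (fst (g, \<one>) \<otimes> snd (g, \<one>) \<otimes> inv (fst (g, \<one>)))"
    using g smooth_at_chart[OF mfd_group unit_chart] by simp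
  ultimately have "smooth_at (prod_atlas \<G> \<G>) model
      (\<lambda>z. snd unit_chart (fst z \<otimes> snd z \<otimes> inv (fst z))) (g, \<one>)"
    by (rule smooth_at_compose[OF mfd_prod[OF mfd_group mfd_group] mfd_group mfd_model[OF finite_dim_group]])
  from smooth_at_chart_deriv_param[OF mfd_group mfd_group finite_dim_group unit_chart this, of w]
  show ?thesis by (simp add: Ad_vec_def[abs_def])
qed

text \<open>Split the derivative of the constant function
  \<open>f (h \<otimes> g \<otimes> inv g)\<close> along the diagonal into the contributions of the
  two occurrences of \<open>g\<close>.\<close>

lemma d_inverse_translate:
  assumes h: "h \<in> carrier G" and f: "f \<in> Cinf \<G>"
  shows "d w (\<lambda>g. f (h \<otimes> inv g)) = - d w (\<lambda>g. f (h \<otimes> g))"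
proof -
  note GG = mfd_prod[OF mfd_group mfd_group]
  define S where "S z = f (h \<otimes> fst z \<otimes> inv (snd z))" for z
  have "smooth_at (prod_atlas \<G> \<G>) \<G> (\<lambda>z. h \<otimes> fst z \<otimes> inv (snd z)) (\<one>, \<one>)"
    using h by (intro smooth_at_group_mult[OF GG] smooth_at_group_inv[OF GG] smooth_at_group_prod smooth_at_const[OF GG])
      (simp_all add: pts_prod pts_group)
  moreover have "smooth_at \<G> model f (h \<otimes> fst (\<one>, \<one>) \<otimes> inv (snd (\<one>, \<one>)))"
    using h Cinf_smooth_at[OF mfd_group f] by (simp add: pts_group)
  ultimately have S: "smooth_at (prod_atlas \<G> \<G>) model S (\<one>, \<one>)"
    unfolding S_def[abs_def] by (rule smooth_at_compose[OF GG mfd_group mfd_model[OF finite_dim_real]])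
  have "d w (\<lambda>g. S (g, g)) = d w (\<lambda>g. S (g, \<one>)) + d w (\<lambda>g. S (\<one>, g))"
    by (rule chart_deriv_diagonal[OF mfd_group finite_dim_real unit_chart S])
  moreover have "d w (\<lambda>g. S (g, g)) = d w (\<lambda>_. f h)" using h by (intro d_cong) (simp add: S_def m_assoc)
  moreover have "d w (\<lambda>g. S (g, \<one>)) = d w (\<lambda>g. f (h \<otimes> g))" using h by (intro d_cong) (simp add: S_def)
  moreover have "d w (\<lambda>g. S (\<one>, g)) = d w (\<lambda>g. f (h \<otimes> inv g))" using h by (intro d_cong) (simp add: S_def)
  ultimately show ?thesis by (simp add: chart_deriv_const)
qed

lemma translate_Cinf:
  assumes g: "g \<in> carrier G" and f: "f \<in> Cinf \<G>"
  shows "(\<lambda>h. f (g \<otimes> h)) \<in> Cinf \<G>"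
  using g by (intro Cinf_compose[OF mfd_group mfd_group f] smooth_at_group_mult[OF mfd_group] smooth_at_ident[OF mfd_group] smooth_at_const[OF mfd_group])
    (simp_all add: pts_group)

text \<open>Left-invariant fields are smooth, so the derivatives in \<open>lie_bracket\<close> can
  be iterated.\<close>

lemma d_translate_Cinf:
  assumes f: "f \<in> Cinf \<G>"
  shows "(\<lambda>g. d w (\<lambda>h. f (g \<otimes> h))) \<in> Cinf \<G>"
  unfolding Cinf_iff[OF mfd_group]
proof
  fix g assume "g \<in> pts \<G>"
  then have g: "g \<in> carrier G" by (simp add: pts_group)
  note GG = mfd_prod[OF mfd_group mfd_group]
  have "smooth_at (prod_atlas \<G> \<G>) \<G> (\<lambda>z. fst z \<otimes> snd z) (g, \<one>)"
    using g by (intro smooth_at_group_mult[OF GG] smooth_at_group_prod) simp_all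
  moreover have "smooth_at \<G> model f (fst (g, \<one>) \<otimes> snd (g, \<one>))"
    using g Cinf_smooth_at[OF mfd_group f] by (simp add: pts_group)
  ultimately have "smooth_at (prod_atlas \<G> \<G>) model (\<lambda>z. f (fst z \<otimes> snd z)) (g, \<one>)"
    by (rule smooth_at_compose[OF GG mfd_group mfd_model[OF finite_dim_real]])
  from smooth_at_chart_deriv_param[OF mfd_group mfd_group finite_dim_real unit_chart this, of w]
  show "smooth_at \<G> model (\<lambda>g. d w (\<lambda>h. f (g \<otimes> h))) g" by simp
qed

lemma lie_bracket_vec:
  assumes f: "f \<in> Cinf \<G>"
  shows "lie_bracket G \<G> (alg_of v) (alg_of w) f =
    d v (\<lambda>g. d w (\<lambda>h. f (g \<otimes> h))) - d w (\<lambda>g. d v (\<lambda>h. f (g \<otimes> h)))"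
proof -
  have "alg_of v (\<lambda>g. left_inv_field G \<G> (alg_of w) g f) = d v (\<lambda>g. d w (\<lambda>h. f (g \<otimes> h)))" for v w
  proof -
    have "alg_of v (\<lambda>g. left_inv_field G \<G> (alg_of w) g f) = alg_of v (\<lambda>g. d w (\<lambda>h. f (g \<otimes> h)))"
      by (rule lie_alg_cong[OF alg_of_lie_alg d_translate_Cinf[OF f], symmetric])
         (simp add: left_inv_field_def push_def comp_def f alg_of_def translate_Cinf)
    then show ?thesis by (simp add: alg_of_def d_translate_Cinf[OF f])
  qed
  then show ?thesis by (simp add: lie_bracket_def f)
qed

text \<open>The derivative of \<open>g \<mapsto> Ad g \<eta>\<close> at the unit is the bracket: split \<open>f (g h g\<^sup>-\<^sup>1)\<close> along the
  diagonal into the derivatives of \<open>f (g h)\<close> and \<open>f (h g\<^sup>-\<^sup>1)\<close>, and commute derivatives in the latter.\<close>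

lemma lie_bracket_vec_eq: "lie_bracket G \<G> (alg_of v) (alg_of w) = alg_of (d v (Ad_vec w))"
proof
  fix f
  show "lie_bracket G \<G> (alg_of v) (alg_of w) f = alg_of (d v (Ad_vec w)) f"
  proof (cases "f \<in> Cinf \<G>")
    case False
    then show ?thesis by (simp add: lie_bracket_def alg_of_def)
  next
    case f: True
    note GG = mfd_prod[OF mfd_group mfd_group]
    define S where "S z = d w (\<lambda>h. f (fst z \<otimes> h \<otimes> inv (snd z)))" for z
    have S: "smooth_at (prod_atlas \<G> \<G>) model S (\<one>, \<one>)"
    proof -
      \<comment> \<open>\<open>S\<close> is a derivative in a third group variable, so its
        smoothness is obtained on a threefold product.\<close>
      note GGG = mfd_prod[OF GG mfd_group]
      let ?z = "((\<one>, \<one>), \<one>)"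
      have pr: "smooth_at (prod_atlas (prod_atlas \<G> \<G>) \<G>) (prod_atlas \<G> \<G>) fst ?z"
        "smooth_at (prod_atlas (prod_atlas \<G> \<G>) \<G>) \<G> snd ?z"
        using smooth_at_fst[OF GG mfd_group, of ?z] by (simp_all add: pts_prod pts_group)
      have f1: "smooth_at (prod_atlas (prod_atlas \<G> \<G>) \<G>) \<G> (\<lambda>z. fst (fst z)) ?z"
        by (rule smooth_at_compose[OF GGG GG mfd_group pr(1)]) (simp add: smooth_at_group_prod)
      have f2: "smooth_at (prod_atlas (prod_atlas \<G> \<G>) \<G>) \<G> (\<lambda>z. snd (fst z)) ?z"
        by (rule smooth_at_compose[OF GGG GG mfd_group pr(1)]) (simp add: smooth_at_group_prod)
      have "smooth_at (prod_atlas (prod_atlas \<G> \<G>) \<G>) \<G>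
          (\<lambda>z. fst (fst z) \<otimes> snd z \<otimes> inv (snd (fst z))) ?z"
        by (intro smooth_at_group_mult[OF GGG] smooth_at_group_inv[OF GGG] f1 f2 pr)
      moreover have "smooth_at \<G> model f (fst (fst ?z) \<otimes> snd ?z \<otimes> inv (snd (fst ?z)))"
        using Cinf_smooth_at[OF mfd_group f one_pts] by simp
      ultimately have "smooth_at (prod_atlas (prod_atlas \<G> \<G>) \<G>) model
          (\<lambda>z. f (fst (fst z) \<otimes> snd z \<otimes> inv (snd (fst z)))) ?z"
        by (rule smooth_at_compose[OF GGG mfd_group mfd_model[OF finite_dim_real]])
      from smooth_at_chart_deriv_param[OF GG mfd_group finite_dim_real unit_chart this, of w]
      show ?thesis by (simp add: S_def[abs_def])
    qed
    have "alg_of (d v (Ad_vec w)) f = d (d v (Ad_vec w)) f" by (simp add: alg_of_def f)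
    \<comment> \<open>The map from \<open>z\<close> to \<open>d z f\<close> is linear, and bounded
      by finite dimension, so it may be exchanged with the derivative of the vector-valued
      \<open>Ad_vec w\<close>.\<close>
    also have "\<dots> = d v (\<lambda>g. d (Ad_vec w g) f)"
      by (rule chart_deriv_linear_compose[OF mfd_group finite_dim_group unit_chart finite_dim_linear_bounded[OF finite_dim_group d_linear[OF f]]
            smooth_at_Ad_vec[OF one_closed], symmetric])
    also have "\<dots> = d v (\<lambda>g. S (g, g))"
      by (rule d_cong) (simp add: S_def d_conj[OF _ f])
    also have "\<dots> = d v (\<lambda>g. S (g, \<one>)) + d v (\<lambda>g. S (\<one>, g))"
      by (rule chart_deriv_diagonal[OF mfd_group finite_dim_real unit_chart S])
    also have "d v (\<lambda>g. S (g, \<one>)) = d v (\<lambda>g. d w (\<lambda>h. f (g \<otimes> h)))"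
      by (intro d_cong) (simp add: S_def, rule d_cong, simp)
    also have "d v (\<lambda>g. S (\<one>, g)) = d v (\<lambda>g. d w (\<lambda>h. f (h \<otimes> inv g)))"
      by (intro d_cong) (simp add: S_def, rule d_cong, simp)
    also have "\<dots> = d w (\<lambda>h. d v (\<lambda>g. f (h \<otimes> inv g)))"
    proof -
      have "smooth_at (prod_atlas \<G> \<G>) \<G> (\<lambda>z. snd z \<otimes> inv (fst z)) (\<one>, \<one>)"
        by (intro smooth_at_group_mult[OF GG] smooth_at_group_inv[OF GG] smooth_at_group_prod) simp_all
      moreover have "smooth_at \<G> model f (snd (\<one>, \<one>) \<otimes> inv (fst (\<one>, \<one>)))"
        using Cinf_smooth_at[OF mfd_group f one_pts] by simp
      ultimately have "smooth_at (prod_atlas \<G> \<G>) model (\<lambda>z. f (snd z \<otimes> inv (fst z))) (\<one>, \<one>)"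
        by (rule smooth_at_compose[OF GG mfd_group mfd_model[OF finite_dim_real]])
      from chart_deriv_slices_commute[OF mfd_group mfd_group unit_chart unit_chart this, of w v] show ?thesis by simp
    qed
    also have "\<dots> = d w (\<lambda>h. - d v (\<lambda>g. f (h \<otimes> g)))"
      by (rule d_cong) (rule d_inverse_translate[OF _ f])
    also have "\<dots> = - d w (\<lambda>h. d v (\<lambda>g. f (h \<otimes> g)))"
      using chart_deriv_linear_compose[OF mfd_group finite_dim_real unit_chart bounded_linear_minus[OF bounded_linear_ident]
          Cinf_smooth_at[OF mfd_group d_translate_Cinf[OF f] one_pts]] by simp
    finally show ?thesis by (simp add: lie_bracket_vec[OF f])
  qed
qed

subsection \<open>Equivariance\<close>

lemma hat_orb_Cinf:
  assumes "p \<in> total D" "Y \<in> sections E"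
  shows "(\<lambda>g. hat Y (orb p g)) \<in> Cinf \<G>"
  by (rule Cinf_compose[OF mfd_group mfd_dual hat_Cinf[OF assms(2)] smooth_at_orb[OF assms(1)]])

text \<open>The group element enters both through the section and through the point. Expanding the
  adjoint action in \<open>onb\<close> separates the two: the coefficients \<open>c b\<close> carry
  the first dependence, and the functions \<open>F b\<close>, built from fixed sections, carry the
  second. The Leibniz rule then applies termwise.\<close>

lemma transported_momentum:
  assumes p: "p \<in> total D" and \<xi>: "\<xi> \<in> \<gg>"
  shows "(\<lambda>g. hat (\<psi> (Ad G \<G> g \<xi>)) (orb p g)) \<in> Cinf \<G>"
    and "\<eta> \<in> \<gg> \<Longrightarrow> \<eta> (\<lambda>g. hat (\<psi> (Ad G \<G> g \<xi>)) (orb p g)) = 0"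
proof -
  obtain w where w: "\<xi> = alg_of w" using alg_of_surj[OF \<xi>] .
  define F where "F b g = hat (\<psi> (alg_of b)) (orb p g)" for b g
  have F: "F b \<in> Cinf \<G>" for b
    unfolding F_def[abs_def] by (intro hat_orb_Cinf[OF p] psi_section alg_of_lie_alg)
  define c where "c b g = Ad_vec w g \<bullet> b" for b g
  have c: "c b \<in> Cinf \<G>" for b
    unfolding c_def[abs_def] Cinf_iff[OF mfd_group]
    using smooth_at_linear[OF mfd_group finite_dim_group finite_dim_real bounded_linear_inner_left smooth_at_Ad_vec] by (simp add: pts_group)
  have expand: "hat (\<psi> (alg_of z)) (orb p g) = (\<Sum>b\<in>onb. (z \<bullet> b) * F b g)" if "g \<in> carrier G" for z g
    using linear_onb_expand[OF finite_dim_group linear_hat_psi[OF orb_total[OF p that]], of z] by (simp add: F_def)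
  have u: "(\<Sum>b\<in>onb. c b g * F b g) = hat (\<psi> (Ad G \<G> g \<xi>)) (orb p g)" if "g \<in> carrier G" for g
    using that by (simp add: w Ad_vec expand c_def)
  have uC: "(\<lambda>g. \<Sum>b\<in>onb. c b g * F b g) \<in> Cinf \<G>"
    by (intro Cinf_sum[OF mfd_group] Cinf_mult[OF mfd_group] c F)
  then show "(\<lambda>g. hat (\<psi> (Ad G \<G> g \<xi>)) (orb p g)) \<in> Cinf \<G>"
    by (rule Cinf_cong[OF mfd_group]) (simp add: u pts_group)
  assume \<eta>: "\<eta> \<in> \<gg>"
  obtain v where v: "\<eta> = alg_of v" using alg_of_surj[OF \<eta>] .
  note t = lie_algD[OF \<eta>]
  have m: "lie_anti_morphism G \<G> E br \<psi>" using lifts by (simp add: by_complete_lifts_def)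
  have "\<eta> (\<lambda>g. hat (\<psi> (Ad G \<G> g \<xi>)) (orb p g)) = \<eta> (\<lambda>g. \<Sum>b\<in>onb. c b g * F b g)"
    by (rule lie_alg_cong[OF \<eta> uC, symmetric]) (rule u)
  also have "\<dots> = (\<Sum>b\<in>onb. \<eta> (\<lambda>g. c b g * F b g))"
    by (rule tangent_sum[OF mfd_group t]) (intro Cinf_mult[OF mfd_group] c F)
  also have "\<dots> = (\<Sum>b\<in>onb. c b \<one> * \<eta> (F b)) + (\<Sum>b\<in>onb. \<eta> (c b) * F b \<one>)"
    by (simp add: tangent_mult[OF t c F] sum.distrib mult.commute[of "F _ _"])
  \<comment> \<open>With the coefficients frozen at the unit, where \<open>Ad_vec w\<close> equals
    \<open>w\<close>, the sum is the derivative of \<open>hat (\<psi> \<xi>)\<close> along the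
    orbit.\<close>
  also have "(\<Sum>b\<in>onb. c b \<one> * \<eta> (F b)) = hat (br (\<psi> \<eta>) (\<psi> \<xi>)) p"
  proof -
    have "(\<Sum>b\<in>onb. c b \<one> * \<eta> (F b)) = \<eta> (\<lambda>g. \<Sum>b\<in>onb. c b \<one> * F b g)"
      using Cinf_mult[OF mfd_group Cinf_const[OF mfd_group] F] by (simp add: tangent_sum[OF mfd_group t] tangent_scale[OF t F])
    also have "\<dots> = \<eta> (\<lambda>g. hat (\<psi> \<xi>) (orb p g))"
      by (rule lie_alg_cong[OF \<eta>]) (auto intro!: Cinf_sum[OF mfd_group] Cinf_mult[OF mfd_group] Cinf_const[OF mfd_group] F
          simp: w expand c_def Ad_vec_one)
    also have "\<dots> = hat (br (\<psi> \<eta>) (\<psi> \<xi>)) p"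
      by (rule derivative_hat_orb_bracket[OF \<eta> p psi_section[OF \<xi>]])
    finally show ?thesis .
  qed
  \<comment> \<open>Now the point stays at \<open>p\<close>, and the derivative of
    \<open>Ad_vec w\<close> gives the coordinates of the bracket.\<close>
  also have "(\<Sum>b\<in>onb. \<eta> (c b) * F b \<one>) = hat (\<psi> (lie_bracket G \<G> \<eta> \<xi>)) p"
  proof -
    have "\<eta> (c b) = d v (Ad_vec w) \<bullet> b" for b
      using c[of b] chart_deriv_linear_compose[OF mfd_group finite_dim_group unit_chart bounded_linear_inner_left smooth_at_Ad_vec[OF one_closed]]
      by (simp add: v alg_of_def c_def[abs_def])
    then show ?thesis
      using expand[OF one_closed, of "d v (Ad_vec w)"] by (simp add: v w lie_bracket_vec_eq orb_one[OF p])
  qed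
  also have "hat (\<psi> (lie_bracket G \<G> \<eta> \<xi>)) p = - hat (br (\<psi> \<eta>) (\<psi> \<xi>)) p"
  proof -
    have x: "fst p \<in> pts M" "snd p \<in> dual_fib E (fst p)" using p by (auto simp: total_D)
    have "\<psi> (lie_bracket G \<G> \<eta> \<xi>) = sec_mult E (\<lambda>_. -1) (br (\<psi> \<eta>) (\<psi> \<xi>))"
      using m \<eta> \<xi> unfolding lie_anti_morphism_def by blast
    then show ?thesis
      using x dual_fib_D(2)[OF x(2) section_fib[OF br_section[OF psi_section[OF \<eta>] psi_section[OF \<xi>]] x(1)], of "-1"]
      by (simp add: hat_def split_beta sec_mult_def)
  qed
  finally show "\<eta> (\<lambda>g. hat (\<psi> (Ad G \<G> g \<xi>)) (orb p g)) = 0" by simp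
qed

text \<open>Right translation by \<open>inv k\<close> carries a tangent vector at \<open>k\<close>
  to the unit. Since both \<open>orb\<close> and \<open>Ad\<close> are multiplicative, the
  translated function has the same form, with \<open>orb p k\<close> and
  \<open>Ad G \<G> k \<xi>\<close> in place of \<open>p\<close> and \<xi>.\<close>

lemma transported_momentum_derivative:
  assumes p: "p \<in> total D" and \<xi>: "\<xi> \<in> \<gg>" and k: "k \<in> carrier G" and v: "v \<in> tangent \<G> k"
  shows "v (\<lambda>g. hat (\<psi> (Ad G \<G> g \<xi>)) (orb p g)) = 0"
proof -
  define u where "u g = hat (\<psi> (Ad G \<G> g \<xi>)) (orb p g)" for g
  define u' where "u' g = hat (\<psi> (Ad G \<G> g (Ad G \<G> k \<xi>))) (orb (orb p k) g)" for g
  have u: "u \<in> Cinf \<G>" unfolding u_def[abs_def] by (rule transported_momentum(1)[OF p \<xi>])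
  note pk = orb_total[OF p k] and xk = Ad_lie_alg[OF k \<xi>]
  have u': "u' \<in> Cinf \<G>" unfolding u'_def[abs_def] by (rule transported_momentum(1)[OF pk xk])
  have shift: "u' g = u (g \<otimes> k)" if "g \<in> carrier G" for g
    using that k \<xi> p by (simp add: u_def u'_def Ad_mult orb_mult)
  have R: "smooth_at \<G> \<G> (\<lambda>g. g \<otimes> inv k) g" if "g \<in> pts \<G>" for g
    using that k by (intro smooth_at_group_mult[OF mfd_group] smooth_at_ident[OF mfd_group] smooth_at_const[OF mfd_group]) (simp_all add: pts_group)
  define \<eta> where "\<eta> = push \<G> (\<lambda>g. g \<otimes> inv k) v"
  have "\<eta> \<in> \<gg>" using push_tangent[OF mfd_group mfd_group R v] k by (simp add: \<eta>_def lie_alg_def)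
  from transported_momentum(2)[OF pk xk this]
  have "0 = \<eta> u'" by (simp add: u'_def[abs_def])
  also have "\<dots> = v (\<lambda>g. u' (g \<otimes> inv k))" by (simp add: \<eta>_def push_def u' comp_def)
  also have "\<dots> = v u"
  proof (rule tangent_cong[OF mfd_group hausdorff_group _ v])
    show "(\<lambda>g. u' (g \<otimes> inv k)) \<in> Cinf \<G>" by (rule Cinf_compose[OF mfd_group mfd_group u' R])
  qed (use k in \<open>simp_all add: pts_group shift m_assoc\<close>)
  finally show ?thesis by (simp add: u_def[abs_def])
qed

lemma equivariance:
  assumes conn: "connected_space (mtop \<G>)" and p: "p \<in> total D" and \<xi>: "\<xi> \<in> \<gg>" and g: "g \<in> carrier G"
  shows "hat (\<psi> \<xi>) (orb p g) = hat (\<psi> (Ad G \<G> (inv g) \<xi>)) p"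
proof -
  \<comment> \<open>Chosen so that the constant function \<open>u\<close> is the right side of the
    claim at the unit and the left side at \<open>g\<close>.\<close>
  define \<eta> where "\<eta> = Ad G \<G> (inv g) \<xi>"
  have \<eta>: "\<eta> \<in> \<gg>" using Ad_lie_alg g \<xi> by (simp add: \<eta>_def)
  define u where "u h = hat (\<psi> (Ad G \<G> h \<eta>)) (orb p h)" for h
  have "u g = u \<one>"
  proof (rule Cinf_eq_if_tangent_zero[OF mfd_group conn])
    show "u \<in> Cinf \<G>" unfolding u_def[abs_def] by (rule transported_momentum(1)[OF p \<eta>])
    show "v u = 0" if "k \<in> pts \<G>" "v \<in> tangent \<G> k" for k v
      using transported_momentum_derivative[OF p \<eta>] that by (simp add: u_def[abs_def] pts_group)
  qed (simp_all add: pts_group g)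
  moreover have "Ad G \<G> g \<eta> = \<xi>"
    using g \<xi> Ad_mult[of g "inv g" \<xi>] by (simp add: \<eta>_def Ad_one)
  ultimately show ?thesis by (simp add: u_def orb_one[OF p] Ad_one[OF \<eta>]) (simp add: \<eta>_def)
qed

section \<open>The momentum map and its equivariance\<close>

lemma J_dual_eq: "\<xi> \<in> \<gg> \<Longrightarrow> J_dual G \<G> \<psi> p \<xi> = hat (\<psi> \<xi>) p"
  by (cases p) (simp add: J_dual_def hat_def)

lemma J_dual_lie_dual:
  assumes p: "p \<in> total D"
  shows "J_dual G \<G> \<psi> p \<in> lie_dual G \<G>"
proof -
  have "hat (\<psi> (\<lambda>f. \<xi> f + \<eta> f)) p = hat (\<psi> \<xi>) p + hat (\<psi> \<eta>) p" "hat (\<psi> (\<lambda>f. c * \<xi> f)) p = c * hat (\<psi> \<xi>) p"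
    and "(\<lambda>f. \<xi> f + \<eta> f) \<in> \<gg>" "(\<lambda>f. c * \<xi> f) \<in> \<gg>"
    if \<xi>: "\<xi> \<in> \<gg>" and \<eta>: "\<eta> \<in> \<gg>" for \<xi> \<eta> c
  proof -
    obtain v w where vw: "\<xi> = alg_of v" "\<eta> = alg_of w" using alg_of_surj[OF \<xi>] alg_of_surj[OF \<eta>] by metis
    note l = linear_hat_psi[OF p]
    show "hat (\<psi> (\<lambda>f. \<xi> f + \<eta> f)) p = hat (\<psi> \<xi>) p + hat (\<psi> \<eta>) p" "(\<lambda>f. \<xi> f + \<eta> f) \<in> \<gg>"
      using linear_add[OF l, of v w] alg_of_lie_alg[of "v + w"] unfolding alg_of_add vw by simp_all
    show "hat (\<psi> (\<lambda>f. c * \<xi> f)) p = c * hat (\<psi> \<xi>) p" "(\<lambda>f. c * \<xi> f) \<in> \<gg>"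
      using linear_scale[OF l, of c v] alg_of_lie_alg[of "c *\<^sub>R v"] unfolding alg_of_scale vw by simp_all
  qed
  moreover have "J_dual G \<G> \<psi> p \<in> extensional \<gg>" by (cases p) (simp add: J_dual_def)
  ultimately show ?thesis by (simp add: lie_dual_def J_dual_eq)
qed

lemma equivariant_momentum_map_J_dual:
  assumes "connected_space (mtop \<G>)"
  shows "equivariant_momentum_map G \<G> (total_atlas D) P (dual_action G E \<Phi> \<phi>) (J_dual G \<G> \<psi>)"
  unfolding equivariant_momentum_map_def momentum_map_def pts_dual
proof (intro conjI ballI)
  show "J_dual G \<G> \<psi> p \<in> lie_dual G \<G>" if "p \<in> total D" for p by (rule J_dual_lie_dual[OF that])
  fix \<xi> assume \<xi>: "\<xi> \<in> \<gg>"
  have J: "(\<lambda>p. J_dual G \<G> \<psi> p \<xi>) = hat (\<psi> \<xi>)" by (simp add: J_dual_eq[OF \<xi>])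
  show "(\<lambda>p. J_dual G \<G> \<psi> p \<xi>) \<in> Cinf (total_atlas D)" unfolding J by (rule hat_Cinf[OF psi_section[OF \<xi>]])
  show "ham_field P (\<lambda>q. J_dual G \<G> \<psi> q \<xi>) p K = inf_gen (total_atlas D) (dual_action G E \<Phi> \<phi>) \<xi> p K"
    if "p \<in> total D" "K \<in> Cinf (total_atlas D)" for p K
    unfolding J using hamiltonian_hat[OF \<xi> that] that(2)
    by (simp add: ham_field_def inf_gen_def push_def comp_def)
next
  fix g p assume g: "g \<in> carrier G" and p: "p \<in> total D"
  show "J_dual G \<G> \<psi> (dual_action G E \<Phi> \<phi> g p) = Coad G \<G> g (J_dual G \<G> \<psi> p)"
  proof
    fix \<xi>
    show "J_dual G \<G> \<psi> (dual_action G E \<Phi> \<phi> g p) \<xi> = Coad G \<G> g (J_dual G \<G> \<psi> p) \<xi>"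
    proof (cases "\<xi> \<in> \<gg>")
      case True
      then show ?thesis
        using equivariance[OF assms p True g] Ad_lie_alg[OF inv_closed[OF g] True]
        by (simp add: J_dual_eq Coad_def)
    next
      \<comment> \<open>Both sides are restricted to the Lie algebra, hence take the same default
        value outside it.\<close>
      case False
      then show ?thesis by (simp add: J_dual_def Coad_def split_beta)
    qed
  qed
qed

end

theorem proposition4p3:
  fixes E :: "('m, 'e::real_inner, 'a, 'f::real_inner) vbundle"
    and br :: "('m \<Rightarrow> 'a) \<Rightarrow> ('m \<Rightarrow> 'a) \<Rightarrow> 'm \<Rightarrow> 'a"
    and \<rho> :: "'a \<Rightarrow> ('m \<Rightarrow> real) \<Rightarrow> real"
    and G :: "('g, 'b) monoid_scheme"
    and \<G> :: "('g, 'k::real_inner) atlas"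
    and \<Phi> :: "'g \<Rightarrow> 'a \<Rightarrow> 'a"
    and \<phi> :: "'g \<Rightarrow> 'm \<Rightarrow> 'm"
    and \<psi> :: "'g lie_vec \<Rightarrow> 'm \<Rightarrow> 'a"
    and P :: "('m \<times> ('a \<Rightarrow> real) \<Rightarrow> real) \<Rightarrow> ('m \<times> ('a \<Rightarrow> real) \<Rightarrow> real) \<Rightarrow> 'm \<times> ('a \<Rightarrow> real) \<Rightarrow> real"
  assumes "lie_algebroid E br \<rho>"
    and "lie_group G \<G>"
    and "connected_space (mtop \<G>)"
    and "bundle_action G \<G> E \<Phi> \<phi>"
    and "free_action G (total_atlas E) \<Phi>"
    and "proper_action \<G> (total_atlas E) \<Phi>"
    and "by_complete_lifts G \<G> E br \<rho> \<Phi> \<psi>"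
    and "linear_poisson E br \<rho> P"
  shows "equivariant_momentum_map G \<G> (total_atlas (dual_bundle E)) P
           (dual_action G E \<Phi> \<phi>) (J_dual G \<G> \<psi>)"
proof -
  have "is_bundle E" using assms(1) by (simp add: lie_algebroid_def vector_bundle_bundle)
  then interpret lift_action E br \<rho> G \<G> \<Phi> \<phi> \<psi> P
    using assms by unfold_locales
  show ?thesis by (rule equivariant_momentum_map_J_dual) (rule assms)
qed

end
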